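(* Let $L$ be a finite flag complex which is not a full simplex. Then the automorphism group $\mathrm{Aut}(\widetilde{X}_L)$ of the universal cover of the Salvetti complex of $L$ contains an ascending tower of uniform lattices $(\Gamma_n)_{n\ge1}$. In particular, $\mathrm{Covol}(\Gamma_n)$ converges to $0$ as $n$ goes to infinity.
   Context: The Salvetti complex $X_L$ of $L$ is the cube complex with one vertex, a loop for each vertex of $L$, and an $r$-torus for each set of $r\ge2$ vertices spanning a simplex of $L$, with faces the tori already attached; its fundamental group is the right-angled Artin group on $L$. $\widetilde{X}_L$ is its universal cover, and $\mathrm{Aut}(\widetilde{X}_L)$ is a locally compact group with the topology of uniform convergence on compacta. Actions on polyhedral complexes are admissible (each element fixes pointwise every cell it stabilises). A uniform lattice in a locally compact group $G$ is a discrete cocompact subgroup; $\mathrm{Covol}(\Gamma)=\mu(G/\Gamma)$ with $\mu$ a fixed Haar measure. A sequence of lattices $(\Gamma_n)_{n\ge1}$ in $G$ is an ascending tower if there are proper inclusions $\Gamma_n\rightarrowtail\Gamma_{n+1}$ for all $n$. *)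

theory Defs
  imports "HOL-Analysis.Analysis" "HOL-Algebra.Bij" "HOL-Algebra.Left_Coset"
begin

section \<open>Flag complexes and Salvetti complexes\<close>

text \<open>A finite simplicial complex is given by its set of simplices; its vertices are all the
  elements of a finite type. The empty simplex is included.\<close>

definition simplicial_complex :: "'v::finite set set \<Rightarrow> bool" where
  "simplicial_complex L \<longleftrightarrow> (\<forall>v. {v} \<in> L) \<and> (\<forall>\<sigma>\<in>L. \<forall>\<tau>. \<tau> \<subseteq> \<sigma> \<longrightarrow> \<tau> \<in> L)"

definition flag_complex :: "'v::finite set set \<Rightarrow> bool" where
  "flag_complex L \<longleftrightarrow> simplicial_complex L \<and>
     (\<forall>\<sigma>. (\<forall>u\<in>\<sigma>. \<forall>v\<in>\<sigma>. {u, v} \<in> L) \<longrightarrow> \<sigma> \<in> L)"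

definition full_simplex :: "'v::finite set set \<Rightarrow> bool" where
  "full_simplex L \<longleftrightarrow> UNIV \<in> L"

text \<open>The unit cube \<open>[0,1]\<^sup>\<sigma>\<close>, regarded as a face of \<open>[0,1]\<^sup>V\<close>.\<close>

definition unit_cube :: "'v::finite set \<Rightarrow> (real ^ 'v) set" where
  "unit_cube \<sigma> = {x. \<forall>v. (v \<in> \<sigma> \<longrightarrow> 0 \<le> x $ v \<and> x $ v \<le> 1) \<and> (v \<notin> \<sigma> \<longrightarrow> x $ v = 0)}"

definition torus_map :: "real ^ 'v \<Rightarrow> complex ^ 'v::finite" where
  "torus_map x = (\<chi> v. cis (2 * pi * x $ v))"

text \<open>The Salvetti complex is realised inside the torus \<open>(S\<^sup>1)\<^sup>V\<close>: each simplex \<open>\<sigma>\<close> contributes the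
  coordinate subtorus \<open>(S\<^sup>1)\<^sup>\<sigma>\<close>, whose top cell has characteristic map \<open>torus_map\<close> on
  \<open>unit_cube \<sigma>\<close>, and the subtorus of a face of \<open>\<sigma>\<close> is contained in that of \<open>\<sigma>\<close>. The empty simplex
  gives the only vertex.\<close>

definition salvetti :: "'v::finite set set \<Rightarrow> (complex ^ 'v) set" where
  "salvetti L = (\<Union>\<sigma>\<in>L. torus_map ` unit_cube \<sigma>)"


section \<open>The automorphism group of a covering of the Salvetti complex\<close>

text \<open>In the cube structure lifted along a covering \<open>p\<close> from \<open>Y\<close> to \<open>salvetti L\<close>, the
  characteristic maps of the cubes are the lifts of those downstairs.\<close>

definition lifted_cube ::
  "'v::finite set set \<Rightarrow> 'y::topological_space set \<Rightarrow> ('y \<Rightarrow> complex ^ 'v) \<Rightarrow>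
     'v set \<Rightarrow> (real ^ 'v \<Rightarrow> 'y) \<Rightarrow> bool" where
  "lifted_cube L Y p \<sigma> \<phi> \<longleftrightarrow> \<sigma> \<in> L \<and> continuous_on (unit_cube \<sigma>) \<phi> \<and> \<phi> ` unit_cube \<sigma> \<subseteq> Y \<and>
     (\<forall>x\<in>unit_cube \<sigma>. p (\<phi> x) = torus_map x)"

text \<open>Automorphisms of the cube complex: homeomorphisms carrying each cube isometrically onto a cube.
  They need not preserve the labels or the orientations of the edges.\<close>

definition cube_automorphism ::
  "'v::finite set set \<Rightarrow> 'y::topological_space set \<Rightarrow> ('y \<Rightarrow> complex ^ 'v) \<Rightarrow> ('y \<Rightarrow> 'y) \<Rightarrow> bool" where
  "cube_automorphism L Y p f \<longleftrightarrow> (\<exists>g. homeomorphism Y Y f g) \<and>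
     (\<forall>\<sigma> \<phi>. lifted_cube L Y p \<sigma> \<phi> \<longrightarrow>
        (\<exists>\<tau> \<psi> \<iota>. lifted_cube L Y p \<tau> \<psi> \<and> \<iota> ` unit_cube \<sigma> = unit_cube \<tau> \<and>
           (\<forall>x\<in>unit_cube \<sigma>. \<forall>y\<in>unit_cube \<sigma>. dist (\<iota> x) (\<iota> y) = dist x y) \<and>
           (\<forall>x\<in>unit_cube \<sigma>. f (\<phi> x) = \<psi> (\<iota> x))))"

definition aut_group ::
  "'v::finite set set \<Rightarrow> 'y::topological_space set \<Rightarrow> ('y \<Rightarrow> complex ^ 'v) \<Rightarrow> ('y \<Rightarrow> 'y) monoid" where
  "aut_group L Y p = (BijGroup Y)\<lparr>carrier := {f \<in> Bij Y. cube_automorphism L Y p f}\<rparr>"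

definition acts_admissibly ::
  "'v::finite set set \<Rightarrow> 'y::topological_space set \<Rightarrow> ('y \<Rightarrow> complex ^ 'v) \<Rightarrow> ('y \<Rightarrow> 'y) set \<Rightarrow> bool" where
  "acts_admissibly L Y p \<Gamma> \<longleftrightarrow>
     (\<forall>f\<in>\<Gamma>. \<forall>\<sigma> \<phi>. lifted_cube L Y p \<sigma> \<phi> \<longrightarrow> f ` \<phi> ` unit_cube \<sigma> = \<phi> ` unit_cube \<sigma> \<longrightarrow>
        (\<forall>x\<in>\<phi> ` unit_cube \<sigma>. f x = x))"

text \<open>On a set of continuous maps this topology does not depend on the choice of the metric within
  its topological equivalence class.\<close>

definition compact_convergence_topology ::
  "'y::metric_space set \<Rightarrow> ('y \<Rightarrow> 'y) set \<Rightarrow> ('y \<Rightarrow> 'y) topology" where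
  "compact_convergence_topology Y F = topology (\<lambda>U. U \<subseteq> F \<and>
     (\<forall>f\<in>U. \<exists>K \<epsilon>. compact K \<and> K \<subseteq> Y \<and> \<epsilon> > 0 \<and> {g \<in> F. \<forall>x\<in>K. dist (f x) (g x) < \<epsilon>} \<subseteq> U))"

lemma openin_compact_convergence_topology:
  "openin (compact_convergence_topology Y F) U \<longleftrightarrow> U \<subseteq> F \<and>
     (\<forall>f\<in>U. \<exists>K \<epsilon>. compact K \<and> K \<subseteq> Y \<and> \<epsilon> > 0 \<and> {g \<in> F. \<forall>x\<in>K. dist (f x) (g x) < \<epsilon>} \<subseteq> U)"
proof -
  let ?P = "\<lambda>U. U \<subseteq> F \<and>
     (\<forall>f\<in>U. \<exists>K \<epsilon>. compact K \<and> K \<subseteq> Y \<and> \<epsilon> > 0 \<and> {g \<in> F. \<forall>x\<in>K. dist (f x) (g x) < \<epsilon>} \<subseteq> U)"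
  have "istopology ?P"
    unfolding istopology_def
  proof (intro conjI allI impI)
    fix S T assume S: "?P S" and T: "?P T"
    show "S \<inter> T \<subseteq> F" using S by blast
    show "\<forall>f\<in>S \<inter> T. \<exists>K \<epsilon>. compact K \<and> K \<subseteq> Y \<and> \<epsilon> > 0 \<and>
            {g \<in> F. \<forall>x\<in>K. dist (f x) (g x) < \<epsilon>} \<subseteq> S \<inter> T"
    proof
      fix f assume "f \<in> S \<inter> T"
      then obtain K1 \<epsilon>1 K2 \<epsilon>2 where
        1: "compact K1" "K1 \<subseteq> Y" "\<epsilon>1 > 0" "{g \<in> F. \<forall>x\<in>K1. dist (f x) (g x) < \<epsilon>1} \<subseteq> S" and
        2: "compact K2" "K2 \<subseteq> Y" "\<epsilon>2 > 0" "{g \<in> F. \<forall>x\<in>K2. dist (f x) (g x) < \<epsilon>2} \<subseteq> T"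
        using S T by (meson IntD1 IntD2)
      have "{g \<in> F. \<forall>x\<in>K1 \<union> K2. dist (f x) (g x) < min \<epsilon>1 \<epsilon>2} \<subseteq> S \<inter> T"
        using 1(4) 2(4) by auto
      moreover have "compact (K1 \<union> K2)" "K1 \<union> K2 \<subseteq> Y" "min \<epsilon>1 \<epsilon>2 > 0"
        using 1 2 by auto
      ultimately show "\<exists>K \<epsilon>. compact K \<and> K \<subseteq> Y \<and> \<epsilon> > 0 \<and>
            {g \<in> F. \<forall>x\<in>K. dist (f x) (g x) < \<epsilon>} \<subseteq> S \<inter> T"
        by blast
    qed
  next
    fix \<K> assume K: "\<forall>S\<in>\<K>. ?P S"
    show "\<Union>\<K> \<subseteq> F" using K by blast
    show "\<forall>f\<in>\<Union>\<K>. \<exists>K \<epsilon>. compact K \<and> K \<subseteq> Y \<and> \<epsilon> > 0 \<and>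
            {g \<in> F. \<forall>x\<in>K. dist (f x) (g x) < \<epsilon>} \<subseteq> \<Union>\<K>"
    proof
      fix f assume "f \<in> \<Union>\<K>"
      then obtain S where "S \<in> \<K>" "f \<in> S" by blast
      then obtain K \<epsilon> where "compact K" "K \<subseteq> Y" "\<epsilon> > 0" "{g \<in> F. \<forall>x\<in>K. dist (f x) (g x) < \<epsilon>} \<subseteq> S"
        using K by meson
      then show "\<exists>K \<epsilon>. compact K \<and> K \<subseteq> Y \<and> \<epsilon> > 0 \<and>
            {g \<in> F. \<forall>x\<in>K. dist (f x) (g x) < \<epsilon>} \<subseteq> \<Union>\<K>"
        using \<open>S \<in> \<K>\<close> by (meson Union_upper order_trans)
    qed
  qed
  then show ?thesis
    unfolding compact_convergence_topology_def by (simp add: topology_inverse')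
qed

lemma topspace_compact_convergence_topology [simp]:
  "topspace (compact_convergence_topology Y F) = F"
proof -
  have "openin (compact_convergence_topology Y F) F"
    unfolding openin_compact_convergence_topology
    by (auto intro!: exI[of _ "{}"] exI[of _ "1::real"])
  then show ?thesis
    by (metis openin_compact_convergence_topology openin_subset openin_topspace subset_antisym)
qed

definition aut_topology ::
  "'v::finite set set \<Rightarrow> 'y::metric_space set \<Rightarrow> ('y \<Rightarrow> complex ^ 'v) \<Rightarrow> ('y \<Rightarrow> 'y) topology" where
  "aut_topology L Y p = compact_convergence_topology Y (carrier (aut_group L Y p))"


section \<open>Uniform lattices and covolumes\<close>

definition locally_compact_group :: "('a, 'b) monoid_scheme \<Rightarrow> 'a topology \<Rightarrow> bool" where
  "locally_compact_group G T \<longleftrightarrow> group G \<and> topspace T = carrier G \<and>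
     continuous_map (prod_topology T T) T (\<lambda>(x, y). x \<otimes>\<^bsub>G\<^esub> y) \<and>
     continuous_map T T (\<lambda>x. inv\<^bsub>G\<^esub> x) \<and>
     Hausdorff_space T \<and> locally_compact_space T"

text \<open>The space \<open>Q\<close> below is \<open>G/\<Gamma>\<close>, the set of left cosets with its quotient topology.\<close>

definition cocompact :: "('a, 'b) monoid_scheme \<Rightarrow> 'a topology \<Rightarrow> 'a set \<Rightarrow> bool" where
  "cocompact G T \<Gamma> \<longleftrightarrow> (\<exists>Q. quotient_map T Q (\<lambda>g. g <#\<^bsub>G\<^esub> \<Gamma>) \<and> compact_space Q)"

definition uniform_lattice :: "('a, 'b) monoid_scheme \<Rightarrow> 'a topology \<Rightarrow> 'a set \<Rightarrow> bool" where
  "uniform_lattice G T \<Gamma> \<longleftrightarrow> locally_compact_group G T \<and> subgroup \<Gamma> G \<and>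
     subtopology T \<Gamma> = discrete_topology \<Gamma> \<and> cocompact G T \<Gamma>"

definition ascending_tower :: "(nat \<Rightarrow> 'a set) \<Rightarrow> bool" where
  "ascending_tower \<Gamma> \<longleftrightarrow> (\<forall>n\<ge>1. \<Gamma> n \<subset> \<Gamma> (Suc n))"

text \<open>Haar measures are normalised to be right invariant, which is the side compatible with the
  quotient \<open>G/\<Gamma>\<close>. A group that contains a lattice is unimodular, so for such groups these are also
  the left Haar measures.\<close>

definition haar_measure :: "('a, 'b) monoid_scheme \<Rightarrow> 'a topology \<Rightarrow> 'a measure \<Rightarrow> bool" where
  "haar_measure G T \<mu> \<longleftrightarrow>
     space \<mu> = carrier G \<and> sets \<mu> = sigma_sets (carrier G) {U. openin T U} \<and>
     (\<forall>A\<in>sets \<mu>. \<forall>g\<in>carrier G. emeasure \<mu> (A #>\<^bsub>G\<^esub> g) = emeasure \<mu> A) \<and>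
     (\<forall>K. compactin T K \<longrightarrow> emeasure \<mu> K < \<infinity>) \<and>
     (\<forall>A\<in>sets \<mu>. emeasure \<mu> A = (INF U\<in>{U. openin T U \<and> A \<subseteq> U}. emeasure \<mu> U)) \<and>
     (\<forall>U. openin T U \<longrightarrow> emeasure \<mu> U = (SUP K\<in>{K. compactin T K \<and> K \<subseteq> U}. emeasure \<mu> K)) \<and>
     emeasure \<mu> (carrier G) \<noteq> 0"

definition fundamental_domain :: "('a, 'b) monoid_scheme \<Rightarrow> 'a measure \<Rightarrow> 'a set \<Rightarrow> 'a set \<Rightarrow> bool" where
  "fundamental_domain G \<mu> \<Gamma> F \<longleftrightarrow> F \<in> sets \<mu> \<and> (\<forall>g\<in>carrier G. \<exists>!x. x \<in> F \<inter> (g <#\<^bsub>G\<^esub> \<Gamma>))"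

text \<open>For discrete \<open>\<Gamma>\<close> the measure induced by \<open>\<mu>\<close> on \<open>G/\<Gamma>\<close> is the one for which the projection
  from a Borel set of coset representatives \<open>F\<close> is measure preserving, so \<open>\<mu>(G/\<Gamma>) = \<mu>(F)\<close>. For
  countable \<open>\<Gamma>\<close> and right-invariant \<open>\<mu>\<close> this number does not depend on \<open>F\<close>.\<close>

definition covolume :: "('a, 'b) monoid_scheme \<Rightarrow> 'a measure \<Rightarrow> 'a set \<Rightarrow> ennreal" where
  "covolume G \<mu> \<Gamma> = emeasure \<mu> (SOME F. fundamental_domain G \<mu> \<Gamma> F)"

end

theory Submission
  imports Defs
begin

text \<open>Since \<open>L\<close> is flag but not a simplex, two of its vertices \<open>u\<close> and \<open>v\<close> span no edge, and no cube of
  the cube complex \<open>Y\<close> has edges in both directions \<open>u\<close> and \<open>v\<close>. Counting \<open>v\<close>-edges with sign gives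
  every vertex of \<open>Y\<close> an integer level, and the two ends of an edge in any other direction have the
  same level. For an arbitrary set of levels there is then an automorphism of \<open>Y\<close> that fixes a
  chosen vertex, preserves the labels of the edges, and reverses exactly the \<open>u\<close>-edges at these levels:
  a square with a \<open>u\<close>-edge has no \<open>v\<close>-edge, so its two \<open>u\<close>-edges lie on one level and are treated alike.

  The lattices are the groups \<open>flip_group N\<close> of the automorphisms that preserve the labels of all
  edges and the orientations of those in directions other than \<open>u\<close>, reverse the \<open>u\<close>-edges on an
  \<open>N\<close>-periodic set of levels, and preserve the parity of the number of \<open>u\<close>-edges crossed. Such an
  automorphism is determined by the set of levels and the image of one point, so point stabilisers
  have at most \<open>2\<^sup>N\<close> elements and the group is discrete. It contains the deck transformations that
  respect the parity, so it has at most two orbits of vertices and is cocompact. An element that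
  stabilises a cube can move it only by reversing its \<open>u\<close>-edges, and then it interchanges the ends of
  an edge, contrary to the parity condition; hence the action is admissible. Since some sets of levels
  have period \<open>2 * N\<close> but not \<open>N\<close>, the groups for \<open>N = 2\<^sup>n\<close> form an ascending tower.

  In place of words in the right-angled Artin group, the proof uses coverings. As \<open>Y\<close> is simply
  connected, each coordinate of \<open>p\<close> has a real-valued logarithm \<open>angle w\<close> (\<open>angle_exists\<close>); the level
  of a point is the integer part of its \<open>angle v\<close>. Reversing \<open>u\<close>-edges is conjugating one coordinate of
  \<open>p\<close> on some levels, and the automorphisms arise by lifting the resulting maps to the Salvetti
  complex (\<open>flips_exists\<close>); the laws of composition follow from the uniqueness of lifts.

  That \<open>Aut(Y)\<close> is a locally compact group rests on one finiteness property: the automorphisms that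
  take one given point to another restrict to any compact set in finitely many ways
  (\<open>finite_restrictions\<close>). Consequently its topology is that of a group of permutations of the set
  \<open>Y\<close>, in which a basic neighbourhood prescribes the values at finitely many points
  (\<open>openin_aut_topology\<close>), and the sets prescribing one value are compact by the theorem of Tychonoff
  (\<open>compactin_transporter\<close>).

  Covolumes tend to \<open>0\<close> along any tower of countable uniform lattices (\<open>covolume_tower_tendsto_0\<close>): the
  first one has finite covolume, and its index in the \<open>m\<close>-th one is at least \<open>m\<close>.\<close>

section \<open>Lifting through coverings of metric spaces\<close>


text \<open>The Kuratowski embedding sends \<open>y\<close> to its distance function; subtracting the distance to a base
  point \<open>b\<close> makes that function bounded.\<close>

definition kuratowski :: "'a::metric_space \<Rightarrow> 'a \<Rightarrow> 'a \<Rightarrow>\<^sub>C real" where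
  "kuratowski b y = Bcontfun (\<lambda>x. dist x y - dist x b)"

lemma kuratowski_apply: "apply_bcontfun (kuratowski b y) x = dist x y - dist x b"
proof -
  have "norm (dist x y - dist x b) \<le> dist y b" for x
    using dist_triangle[of x y b] dist_triangle[of x b y] by (auto simp: dist_commute abs_le_iff)
  then have "(\<lambda>x. dist x y - dist x b) \<in> bcontfun"
    by (intro bcontfun_normI[where b = "dist y b"]) (auto intro!: continuous_intros)
  then show ?thesis
    by (simp add: kuratowski_def Bcontfun_inverse)
qed

lemma dist_kuratowski: "dist (kuratowski b y) (kuratowski b z) = dist y z"
proof (rule antisym)
  show "dist (kuratowski b y) (kuratowski b z) \<le> dist y z"
    by (rule dist_bound)
       (use dist_triangle[of _ y z] dist_triangle[of _ z y] in
         \<open>auto simp: kuratowski_apply dist_real_def abs_le_iff dist_commute algebra_simps\<close>)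
  show "dist y z \<le> dist (kuratowski b y) (kuratowski b z)"
    using dist_bounded[of "kuratowski b y" y "kuratowski b z"]
    by (simp add: kuratowski_apply dist_real_def)
qed

lemma homeomorphism_isometric_embedding:
  fixes e :: "'a::metric_space \<Rightarrow> 'b::metric_space"
  assumes e: "\<And>x y. dist (e x) (e y) = dist x y"
  shows "homeomorphism S (e ` S) e (inv_into UNIV e)"
proof -
  have inj: "inj e"
    by (metis e dist_eq_0_iff injI)
  have "continuous_on S e"
    using e by (auto simp: continuous_on_iff)
  moreover have "continuous_on (e ` S) (inv_into UNIV e)"
    by (rule continuous_onI) (use e inj in \<open>auto\<close>)
  ultimately show ?thesis
    using inj by (auto simp: homeomorphism_def image_comp)
qed

text \<open>Being a covering, simply connected or locally path connected are topological properties. Along this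
  embedding they pass to subsets of a normed space, where the theory of lifts is developed, and the
  resulting lifts are pulled back.\<close>

lemma metric_space_embeds_in_normed_space:
  fixes S :: "'a::metric_space set"
  obtains e :: "'a \<Rightarrow> 'a \<Rightarrow>\<^sub>C real" and e' where "homeomorphism S (e ` S) e e'"
  by (metis homeomorphism_isometric_embedding dist_kuratowski)

lemma covering_space_homeomorphism_compose:
  assumes cov: "covering_space C p S" and hom: "homeomorphism C D e e'"
  shows "covering_space D (p \<circ> e') S"
proof
  note h = hom[unfolded homeomorphism_def]
  have e'D: "e' ` D = C" and eC: "e ` C = D"
    using h by auto
  show "continuous_on D (p \<circ> e')"
    unfolding comp_def using h covering_space_imp_continuous[OF cov]
    by (intro continuous_on_compose2[of C p D e']) auto
  show "(p \<circ> e') ` D = S"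
    using e'D covering_space_imp_surjective[OF cov] by (simp only: image_comp[symmetric])
  fix x assume "x \<in> S"
  then obtain T v where T: "x \<in> T" "openin (top_of_set S) T" and v: "\<Union>v = C \<inter> p -` T"
    "\<forall>u \<in> v. openin (top_of_set C) u" "pairwise disjnt v" "\<forall>u \<in> v. \<exists>q. homeomorphism u T p q"
    using cov unfolding covering_space_def by (metis (no_types, lifting))
  have vC: "u \<subseteq> C" if "u \<in> v" for u
    using v(1) that by blast
  have inj: "inj_on e C"
    using h by (metis inj_on_def)
  show "\<exists>T. x \<in> T \<and> openin (top_of_set S) T \<and>
     (\<exists>v. \<Union>v = D \<inter> (p \<circ> e') -` T \<and> (\<forall>u \<in> v. openin (top_of_set D) u) \<and>
       pairwise disjnt v \<and> (\<forall>u \<in> v. \<exists>q. homeomorphism u T (p \<circ> e') q))"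
  proof (intro exI conjI)
    show "x \<in> T" "openin (top_of_set S) T" by fact+
    have "\<Union>((`) e ` v) = e ` (C \<inter> p -` T)"
      unfolding v(1)[symmetric] by blast
    also have "\<dots> = D \<inter> (p \<circ> e') -` T"
    proof (intro equalityI subsetI)
      fix y assume "y \<in> e ` (C \<inter> p -` T)"
      then show "y \<in> D \<inter> (p \<circ> e') -` T" using h by auto
    next
      fix y assume y: "y \<in> D \<inter> (p \<circ> e') -` T"
      then have "e' y \<in> C \<inter> p -` T" "y = e (e' y)" using h by auto
      then show "y \<in> e ` (C \<inter> p -` T)" by blast
    qed
    finally show "\<Union>((`) e ` v) = D \<inter> (p \<circ> e') -` T" .
    show "\<forall>u \<in> (`) e ` v. openin (top_of_set D) u"
      using v(2) hom homeomorphism_imp_open_map by blast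
    show "pairwise disjnt ((`) e ` v)"
    proof (rule pairwise_imageI)
      fix a b assume "a \<in> v" "b \<in> v" "a \<noteq> b"
      then have "a \<inter> b = {}" using v(3) by (auto simp: pairwise_def disjnt_def)
      then show "disjnt (e ` a) (e ` b)"
        using inj_on_image_Int[OF inj vC[OF \<open>a \<in> v\<close>] vC[OF \<open>b \<in> v\<close>]] by (simp add: disjnt_def)
    qed
    show "\<forall>u \<in> (`) e ` v. \<exists>q. homeomorphism u T (p \<circ> e') q"
    proof clarify
      fix u assume u: "u \<in> v"
      then obtain q where "homeomorphism u T p q" using v(4) by blast
      moreover have "homeomorphism (e ` u) u e' e"
        by (rule homeomorphism_symD, rule homeomorphism_of_subsets[OF hom vC[OF u]]) (use eC vC[OF u] in auto)
      ultimately show "\<exists>q. homeomorphism (e ` u) T (p \<circ> e') q"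
        by (blast intro: homeomorphism_compose)
    qed
  qed
qed

lemma simply_connected_homeomorphic_image:
  assumes S: "simply_connected S" and hom: "homeomorphism S T e e'"
  shows "simply_connected T"
  unfolding simply_connected_def
proof (intro allI impI, elim conjE)
  fix a b assume a: "path a" "pathfinish a = pathstart a" "path_image a \<subseteq> T"
    and b: "path b" "pathfinish b = pathstart b" "path_image b \<subseteq> T"
  note h = hom[unfolded homeomorphism_def]
  have pull: "path (e' \<circ> c)" "path_image (e' \<circ> c) \<subseteq> S" if "path c" "path_image c \<subseteq> T" for c
    using that h by (auto intro!: path_continuous_image continuous_on_subset[of T e'] simp: path_image_compose)
  have "homotopic_loops S (e' \<circ> a) (e' \<circ> b)"
    using S a b pull unfolding simply_connected_def
    by (auto simp: pathfinish_compose pathstart_compose)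
  then have "homotopic_loops T (e \<circ> (e' \<circ> a)) (e \<circ> (e' \<circ> b))"
    using h by (intro homotopic_loops_continuous_image[of S _ _ e T]) auto
  moreover have "homotopic_loops T (e \<circ> (e' \<circ> c)) c \<and> homotopic_loops T c (e \<circ> (e' \<circ> c))"
    if "path c" "path_image c \<subseteq> T" "pathfinish c = pathstart c" for c
  proof -
    have "homotopic_loops T c (e \<circ> (e' \<circ> c))"
      using that homeomorphism_apply2[OF hom]
      by (intro homotopic_loops_eq) (simp_all add: path_image_def image_subset_iff)
    then show ?thesis by (simp add: homotopic_loops_sym)
  qed
  ultimately show "homotopic_loops T a b"
    using a b by (meson homotopic_loops_trans)
qed

lemma simply_connected_metric_imp_connected:
  fixes S :: "'a::metric_space set"
  assumes "simply_connected S"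
  shows "connected S"
proof -
  obtain e :: "'a \<Rightarrow> 'a \<Rightarrow>\<^sub>C real" and e' where e: "homeomorphism S (e ` S) e e'"
    by (rule metric_space_embeds_in_normed_space)
  then have "connected (e ` S)"
    using assms simply_connected_homeomorphic_image simply_connected_imp_connected by blast
  then show ?thesis
    using e homeomorphism_symD homeomorphism_def connected_continuous_image by metis
qed

lemma covering_metric_lift_unique:
  fixes C :: "'a::metric_space set" and f :: "'c::topological_space \<Rightarrow> 'b::topological_space"
  assumes cov: "covering_space C p S" and T: "connected T" "a \<in> T" "x \<in> T"
    and f: "continuous_on T f" "f \<in> T \<rightarrow> S"
    and g: "continuous_on T g" "g \<in> T \<rightarrow> C" "\<And>x. x \<in> T \<Longrightarrow> p (g x) = f x"
    and h: "continuous_on T h" "h \<in> T \<rightarrow> C" "\<And>x. x \<in> T \<Longrightarrow> p (h x) = f x"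
    and eq: "g a = h a"
  shows "g x = h x"
proof -
  obtain e :: "'a \<Rightarrow> 'a \<Rightarrow>\<^sub>C real" and e' where e: "homeomorphism C (e ` C) e e'"
    by (rule metric_space_embeds_in_normed_space)
  note e1 = e[unfolded homeomorphism_def]
  have "(e \<circ> g) x = (e \<circ> h) x"
  proof (rule covering_space_lift_unique[OF covering_space_homeomorphism_compose[OF cov e], of "e \<circ> g" a "e \<circ> h" T f])
    have "continuous_on C e" using e1 by blast
    then show "continuous_on T (e \<circ> g)" "continuous_on T (e \<circ> h)"
      unfolding comp_def using g(1,2) h(1,2)
      by (auto intro: continuous_on_compose2[of C e T])
    show "f x = (p \<circ> e') ((e \<circ> g) x)" "f x = (p \<circ> e') ((e \<circ> h) x)" if "x \<in> T" for x
      using e1 g h that by (auto simp: Pi_iff)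
  qed (use assms in auto)
  then show ?thesis
    using e1 g(2) h(2) T by (metis Pi_iff comp_apply)
qed

lemma locally_path_connected_homeomorphic_image:
  fixes S :: "'a::metric_space set" and T :: "'b::metric_space set"
  assumes "homeomorphism S T e e'" "locally path_connected S"
  shows "locally path_connected T"
  using homeomorphism_locally_imp[OF assms(2,1)] homeomorphic_path_connectedness
  unfolding homeomorphic_def by blast

lemma covering_metric_locally_path_connected:
  fixes C :: "'a::metric_space set" and S :: "'b::real_normed_vector set"
  assumes cov: "covering_space C p S" and "locally path_connected S"
  shows "locally path_connected C"
proof -
  obtain e :: "'a \<Rightarrow> 'a \<Rightarrow>\<^sub>C real" and e' where e: "homeomorphism C (e ` C) e e'"
    by (rule metric_space_embeds_in_normed_space)
  have "locally path_connected (e ` C)"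
    using covering_space_locally_path_connected_eq[OF covering_space_homeomorphism_compose[OF cov e]] assms by blast
  then show ?thesis
    using e homeomorphism_symD locally_path_connected_homeomorphic_image by metis
qed

lemma covering_metric_lift_exists:
  fixes C :: "'a::metric_space set" and S :: "'b::real_normed_vector set" and U :: "'c::metric_space set"
  assumes cov: "covering_space C p S" and "a \<in> C" "z \<in> U"
    and U: "simply_connected U" "locally path_connected U"
    and f: "continuous_on U f" "f \<in> U \<rightarrow> S" "f z = p a"
  obtains g where "continuous_on U g" "g \<in> U \<rightarrow> C" "g z = a" "\<And>y. y \<in> U \<Longrightarrow> p (g y) = f y"
proof -
  obtain e :: "'a \<Rightarrow> 'a \<Rightarrow>\<^sub>C real" and e' where e: "homeomorphism C (e ` C) e e'"
    by (rule metric_space_embeds_in_normed_space)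
  obtain d :: "'c \<Rightarrow> 'c \<Rightarrow>\<^sub>C real" and d' where d: "homeomorphism U (d ` U) d d'"
    by (rule metric_space_embeds_in_normed_space)
  note e1 = e[unfolded homeomorphism_def] and d1 = d[unfolded homeomorphism_def]
  obtain g where g: "continuous_on (d ` U) g" "g \<in> d ` U \<rightarrow> e ` C" "g (d z) = e a"
      "\<And>y. y \<in> d ` U \<Longrightarrow> (p \<circ> e') (g y) = (f \<circ> d') y"
  proof (rule covering_space_lift_strong[OF covering_space_homeomorphism_compose[OF cov e]])
    show "simply_connected (d ` U)"
      using simply_connected_homeomorphic_image[OF U(1) d] .
    show "locally path_connected (d ` U)"
      using locally_path_connected_homeomorphic_image[OF d U(2)] .
    show "continuous_on (d ` U) (f \<circ> d')"
      using d1 f by (intro continuous_on_compose) auto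
    show "(f \<circ> d') (d z) = (p \<circ> e') (e a)"
      using d1 e1 assms by auto
  qed (use assms d1 e1 in auto)
  show ?thesis
  proof
    show "continuous_on U (e' \<circ> g \<circ> d)"
    proof -
      have "continuous_on U d" "continuous_on (e ` C) e'" using d1 e1 by blast+
      then have "continuous_on U (\<lambda>x. g (d x))"
        using g(1) by (blast intro: continuous_on_compose2[of "d ` U" g U d])
      then show ?thesis
        unfolding comp_def using g(2) \<open>continuous_on (e ` C) e'\<close>
        by (intro continuous_on_compose2[OF \<open>continuous_on (e ` C) e'\<close> \<open>continuous_on U (\<lambda>x. g (d x))\<close>]) blast
    qed
    show "e' \<circ> g \<circ> d \<in> U \<rightarrow> C"
      using e1 g(2) by fastforce
    show "(e' \<circ> g \<circ> d) z = a"
      using e1 g(3) assms by auto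
    show "p ((e' \<circ> g \<circ> d) y) = f y" if "y \<in> U" for y
      using g(4)[of "d y"] d1 that by auto
  qed
qed


section \<open>Points of the Salvetti complex\<close>

lemma cis_2pi_eq_iff: "cis (2 * pi * a) = cis (2 * pi * b) \<longleftrightarrow> a - b \<in> \<int>"
proof
  assume "cis (2 * pi * a) = cis (2 * pi * b)"
  then have "exp (\<i> * complex_of_real (2 * pi * a)) = exp (\<i> * complex_of_real (2 * pi * b))"
    by (simp only: cis_conv_exp)
  then obtain n :: int where
    "\<i> * complex_of_real (2 * pi * a) = \<i> * complex_of_real (2 * pi * b) + (of_int (2 * n) * pi) * \<i>"
    unfolding exp_eq by blast
  then have "Im (\<i> * complex_of_real (2 * pi * a)) =
      Im (\<i> * complex_of_real (2 * pi * b) + (of_int (2 * n) * pi) * \<i>)"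
    by (rule arg_cong)
  then have "pi * a = pi * (b + of_int n)"
    by (simp add: algebra_simps)
  then have "a = b + of_int n"
    by simp
  then show "a - b \<in> \<int>" by simp
next
  assume "a - b \<in> \<int>"
  then have "cis (2 * pi * (a - b)) = 1" by simp
  moreover have "cis (2 * pi * a) = cis (2 * pi * (a - b)) * cis (2 * pi * b)"
    by (simp add: cis_mult algebra_simps)
  ultimately show "cis (2 * pi * a) = cis (2 * pi * b)" by simp
qed

lemma cis_2pi_eq_1_iff: "cis (2 * pi * a) = 1 \<longleftrightarrow> a \<in> \<int>"
  using cis_2pi_eq_iff[of a 0] by simp

lemma norm_1_cis_2pi:
  assumes "norm z = 1"
  obtains t where "0 \<le> t" "t < 1" "z = cis (2 * pi * t)"
proof -
  have "z = cis (Arg2pi z)"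
    using Arg2pi_eq[of z] assms by (simp add: cis_conv_exp)
  then show thesis
    using that[of "Arg2pi z / (2 * pi)"] Arg2pi_ge_0[of z] Arg2pi_lt_2pi[of z] by (simp add: field_simps)
qed

lemma torus_map_nth [simp]: "torus_map x $ v = cis (2 * pi * x $ v)"
  by (simp add: torus_map_def)

lemma continuous_on_torus_map: "continuous_on S torus_map"
proof -
  have "continuous_on S (\<lambda>x::real^'a::finite. cis (2 * pi * x $ v))" for v
    unfolding cis_conv_exp by (intro continuous_intros)
  then show ?thesis
    unfolding torus_map_def by (intro continuous_on_vec_lambda)
qed

lemma unit_cube_eq_cbox: "unit_cube \<sigma> = cbox 0 (\<chi> v. if v \<in> \<sigma> then 1 else 0)"
proof -
  have "(0 \<le> a \<and> a \<le> (if v \<in> \<sigma> then 1 else 0)) \<longleftrightarrow> (v \<in> \<sigma> \<longrightarrow> 0 \<le> a \<and> a \<le> 1) \<and> (v \<notin> \<sigma> \<longrightarrow> a = 0)"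
    for v and a :: real by auto
  then show ?thesis unfolding unit_cube_def by (auto simp: mem_box_cart)
qed

lemma compact_unit_cube: "compact (unit_cube \<sigma>)"
  and convex_unit_cube: "convex (unit_cube \<sigma>)"
  by (simp_all add: unit_cube_eq_cbox)

lemma unit_cube_zero: "0 \<in> unit_cube \<sigma>"
  by (simp add: unit_cube_def)

lemma unit_cube_mono: "\<sigma> \<subseteq> \<tau> \<Longrightarrow> unit_cube \<sigma> \<subseteq> unit_cube \<tau>"
  unfolding unit_cube_def by (auto; metis order_refl zero_le_one)

text \<open>The relative interior of the unit cube. The Salvetti complex is the disjoint union of the images
  of these open cubes.\<close>

definition open_cube :: "'v::finite set \<Rightarrow> (real ^ 'v) set" where
  "open_cube \<sigma> = {x. \<forall>v. (v \<in> \<sigma> \<longrightarrow> 0 < x $ v \<and> x $ v < 1) \<and> (v \<notin> \<sigma> \<longrightarrow> x $ v = 0)}"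

lemma open_cube_subset: "open_cube \<sigma> \<subseteq> unit_cube \<sigma>"
  unfolding open_cube_def unit_cube_def by fastforce

text \<open>The coordinates in \<open>\<sigma>\<close> of an interior point are not integers and the others vanish. Thus a point
  of the Salvetti complex determines the open cube that contains it.\<close>

lemma torus_map_open_cube_support:
  assumes "x \<in> open_cube \<sigma>"
  shows "{w. torus_map x $ w \<noteq> 1} = \<sigma>"
proof -
  have "x $ w \<in> \<int> \<longleftrightarrow> w \<notin> \<sigma>" for w
  proof
    assume "x $ w \<in> \<int>"
    then obtain k :: int where k: "x $ w = of_int k" by (auto elim: Ints_cases)
    show "w \<notin> \<sigma>"
    proof
      assume "w \<in> \<sigma>"
      then have "0 < k" "k < 1" using assms k unfolding open_cube_def by force+
      then show False by simp
    qed
  qed (use assms in \<open>auto simp: open_cube_def\<close>)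
  then show ?thesis by (simp add: cis_2pi_eq_1_iff)
qed

text \<open>The torus map identifies only points whose coordinates differ by integers, and within the unit
  interval these are its two ends.\<close>

lemma torus_map_eq_open_cube:
  assumes x: "x \<in> open_cube \<sigma>" and y: "y \<in> unit_cube \<sigma>" and eq: "torus_map x = torus_map y"
  shows "x = y"
proof (rule vec_eq_iff[THEN iffD2, rule_format])
  fix v
  have "x $ v - y $ v \<in> \<int>"
    using eq by (simp add: vec_eq_iff cis_2pi_eq_iff)
  then obtain k :: int where k: "x $ v - y $ v = of_int k" by (auto elim: Ints_cases)
  show "x $ v = y $ v"
  proof (cases "v \<in> \<sigma>")
    case True
    then have "0 < x $ v" "x $ v < 1" "0 \<le> y $ v" "y $ v \<le> 1"
      using x y by (auto simp: open_cube_def unit_cube_def)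
    then have "k = 0" using k by linarith
    then show ?thesis using k by simp
  next
    case False
    then show ?thesis using x y by (auto simp: open_cube_def unit_cube_def)
  qed
qed

lemma unit_modulus_eq_torus_map:
  assumes "\<And>w. norm (z $ w) = 1"
  obtains x where "x \<in> open_cube {w. z $ w \<noteq> 1}" "torus_map x = z"
proof -
  have "\<exists>t. 0 \<le> t \<and> t < 1 \<and> z $ w = cis (2 * pi * t)" for w
    using norm_1_cis_2pi assms by metis
  then obtain t where t: "\<And>w. 0 \<le> t w \<and> t w < 1 \<and> z $ w = cis (2 * pi * t w)" by metis
  have t0: "t w = 0 \<longleftrightarrow> z $ w = 1" for w
    using t[of w] cis_2pi_eq_1_iff[of "t w"] by (auto elim!: Ints_cases)
  show thesis
    by (rule that[of "\<chi> w. t w"]) (use t t0 in \<open>auto simp: open_cube_def vec_eq_iff less_le\<close>)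
qed

lemma salvetti_iff:
  assumes "simplicial_complex L"
  shows "z \<in> salvetti L \<longleftrightarrow> (\<forall>w. norm (z $ w) = 1) \<and> {w. z $ w \<noteq> 1} \<in> L"
proof
  assume "z \<in> salvetti L"
  then obtain \<sigma> x where "\<sigma> \<in> L" "x \<in> unit_cube \<sigma>" "z = torus_map x"
    by (auto simp: salvetti_def)
  moreover from this have "x $ w = 0" if "w \<notin> \<sigma>" for w
    using that by (simp add: unit_cube_def)
  then have "{w. z $ w \<noteq> 1} \<subseteq> \<sigma>"
    using \<open>z = torus_map x\<close> by (force simp: cis_2pi_eq_1_iff)
  ultimately show "(\<forall>w. norm (z $ w) = 1) \<and> {w. z $ w \<noteq> 1} \<in> L"
    using assms unfolding simplicial_complex_def by auto
next
  assume z: "(\<forall>w. norm (z $ w) = 1) \<and> {w. z $ w \<noteq> 1} \<in> L"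
  then obtain x where "x \<in> open_cube {w. z $ w \<noteq> 1}" "torus_map x = z"
    using unit_modulus_eq_torus_map[of z] by blast
  then show "z \<in> salvetti L"
    using z open_cube_subset unfolding salvetti_def by blast
qed

lemma finite_vec_box:
  assumes "\<And>v. finite (A v)"
  shows "finite {x::'a ^ 'v::finite. \<forall>v. x $ v \<in> A v}"
proof (rule finite_subset)
  show "{x::'a ^ 'v::finite. \<forall>v. x $ v \<in> A v} \<subseteq> vec_lambda ` Pi\<^sub>E UNIV A"
    by (auto intro!: image_eqI[where x = "\<lambda>v. _ $ v"])
  show "finite (vec_lambda ` Pi\<^sub>E UNIV A)"
    using assms by (intro finite_imageI finite_PiE) auto
qed

lemma finite_torus_fibre: "finite {x \<in> unit_cube \<sigma>. torus_map x = z}"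
proof (cases "\<exists>y \<in> unit_cube \<sigma>. torus_map y = z")
  case True
  then obtain y where y: "y \<in> unit_cube \<sigma>" "torus_map y = z" by blast
  have "finite {x::real^'a. \<forall>v. x $ v \<in> {0, y $ v, 1}}"
    by (rule finite_vec_box) auto
  moreover have "{x \<in> unit_cube \<sigma>. torus_map x = z} \<subseteq> {x. \<forall>v. x $ v \<in> {0, y $ v, 1}}"
  proof clarify
    fix x v assume x: "x \<in> unit_cube \<sigma>" "z = torus_map x" "x $ v \<notin> {}" "x $ v \<noteq> y $ v" "x $ v \<noteq> 0"
    have "x $ v - y $ v \<in> \<int>"
      using x y by (simp add: vec_eq_iff flip: cis_2pi_eq_iff)
    then obtain k :: int where k: "x $ v - y $ v = of_int k" by (auto elim: Ints_cases)
    have "0 \<le> x $ v" "x $ v \<le> 1" "0 \<le> y $ v" "y $ v \<le> 1"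
      using x y unfolding unit_cube_def by force+
    moreover have "k \<noteq> 0" using k x by auto
    ultimately show "x $ v = 1"
      using k x(5) by linarith
  qed
  ultimately show ?thesis by (rule finite_subset[rotated])
next
  case False
  then have "{x \<in> unit_cube \<sigma>. torus_map x = z} = {}" by blast
  then show ?thesis by (simp only: finite.emptyI)
qed

text \<open>The points of \<open>K\<close> away from the fibre form a compact set, whose image misses a neighbourhood of
  \<open>s\<close>.\<close>

lemma compact_preimage_near_fibre:
  fixes f :: "'a::metric_space \<Rightarrow> 'b::metric_space"
  assumes K: "compact K" and f: "continuous_on K f" and "\<delta> > 0"
  obtains \<epsilon> where "\<epsilon> > 0" "\<And>x. \<lbrakk>x \<in> K; dist (f x) s < \<epsilon>\<rbrakk> \<Longrightarrow> \<exists>x0\<in>K. f x0 = s \<and> dist x0 x < \<delta>"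
proof -
  let ?N = "\<Union>x0\<in>{x0\<in>K. f x0 = s}. ball x0 \<delta>"
  have "compact (K - ?N)"
    using K by (intro compact_diff open_UN) auto
  moreover have "continuous_on (K - ?N) f"
    using f by (rule continuous_on_subset) simp
  ultimately have "compact (f ` (K - ?N))"
    by (rule compact_continuous_image[rotated])
  then have "closed (f ` (K - ?N))"
    by (rule compact_imp_closed)
  moreover have "s \<notin> f ` (K - ?N)"
    using \<open>\<delta> > 0\<close> by force
  ultimately have "open (- f ` (K - ?N))" "s \<in> - f ` (K - ?N)"
    by auto
  then obtain d where "d > 0" and d: "ball s d \<subseteq> - f ` (K - ?N)"
    unfolding open_contains_ball by meson
  show thesis
  proof (rule that[OF \<open>d > 0\<close>])
    fix x assume "x \<in> K" "dist (f x) s < d"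
    then have "x \<in> ?N"
      using d by (force simp: dist_commute subset_iff)
    then show "\<exists>x0\<in>K. f x0 = s \<and> dist x0 x < \<delta>" by auto
  qed
qed

lemma unit_cube_near_torus_fibre:
  fixes s :: "complex ^ 'v::finite"
  assumes "\<delta> > 0"
  obtains \<epsilon> where "\<epsilon> > 0"
    "\<And>\<sigma> x. \<lbrakk>x \<in> unit_cube \<sigma>; dist (torus_map x) s < \<epsilon>\<rbrakk>
        \<Longrightarrow> \<exists>x0\<in>unit_cube \<sigma>. torus_map x0 = s \<and> dist x0 x < \<delta>"
proof -
  have "\<exists>\<epsilon>>0. \<forall>x\<in>unit_cube \<sigma>. dist (torus_map x) s < \<epsilon> \<longrightarrow>
          (\<exists>x0\<in>unit_cube \<sigma>. torus_map x0 = s \<and> dist x0 x < \<delta>)" for \<sigma>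
    by (rule compact_preimage_near_fibre[OF compact_unit_cube[of \<sigma>] continuous_on_torus_map assms, of s]) blast
  then obtain \<epsilon> where \<epsilon>: "\<And>\<sigma>::'v set. \<epsilon> \<sigma> > 0"
    "\<And>\<sigma> x. \<lbrakk>x \<in> unit_cube \<sigma>; dist (torus_map x) s < \<epsilon> \<sigma>\<rbrakk>
        \<Longrightarrow> \<exists>x0\<in>unit_cube \<sigma>. torus_map x0 = s \<and> dist x0 x < \<delta>"
    by metis
  have "Min (range \<epsilon>) > 0" using \<epsilon>(1) by (subst Min_gr_iff) auto
  moreover have "Min (range \<epsilon>) \<le> \<epsilon> \<sigma>" for \<sigma> by simp
  ultimately show thesis
    using \<epsilon>(2) that[of "Min (range \<epsilon>)"] by (meson less_le_trans)
qed

text \<open>Near \<open>s\<close> the Salvetti complex is a cone: inside every cube that comes close to \<open>s\<close>, a short segment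
  leads to a preimage of \<open>s\<close>. Local path connectedness and the local finiteness of the lifted cubes
  both follow from this.\<close>

lemma segment_to_torus_fibre:
  fixes s :: "complex ^ 'v::finite"
  assumes "r > 0"
  obtains \<epsilon> where "\<epsilon> > 0"
    "\<And>\<sigma> x. \<lbrakk>x \<in> unit_cube \<sigma>; dist (torus_map x) s < \<epsilon>\<rbrakk>
        \<Longrightarrow> \<exists>x0\<in>unit_cube \<sigma>. torus_map x0 = s \<and> closed_segment x0 x \<subseteq> unit_cube \<sigma> \<and>
              torus_map ` closed_segment x0 x \<subseteq> ball s r"
proof -
  have "uniformly_continuous_on (unit_cube UNIV) (torus_map :: real^'v \<Rightarrow> complex^'v)"
    by (intro compact_uniformly_continuous continuous_on_torus_map compact_unit_cube)
  then obtain \<delta> where \<delta>: "\<delta> > 0"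
    "\<And>x x'::real^'v. \<lbrakk>x \<in> unit_cube UNIV; x' \<in> unit_cube UNIV; dist x' x < \<delta>\<rbrakk> \<Longrightarrow> dist (torus_map x') (torus_map x) < r"
    using assms unfolding uniformly_continuous_on_def by metis
  obtain \<epsilon> where \<epsilon>: "\<epsilon> > 0" "\<And>\<sigma> x. \<lbrakk>x \<in> unit_cube \<sigma>; dist (torus_map x) s < \<epsilon>\<rbrakk>
        \<Longrightarrow> \<exists>x0\<in>unit_cube \<sigma>. torus_map x0 = s \<and> dist x0 x < \<delta>"
    using unit_cube_near_torus_fibre[OF \<delta>(1)] by metis
  show thesis
  proof (rule that[OF \<epsilon>(1)])
    fix \<sigma> x assume x: "x \<in> unit_cube \<sigma>" "dist (torus_map x) s < \<epsilon>"
    obtain x0 where x0: "x0 \<in> unit_cube \<sigma>" "torus_map x0 = s" "dist x0 x < \<delta>"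
      using \<epsilon>(2)[OF x] by blast
    have seg: "closed_segment x0 x \<subseteq> unit_cube \<sigma>"
      using x0 x closed_segment_subset convex_unit_cube by blast
    have "dist s (torus_map z) < r" if z: "z \<in> closed_segment x0 x" for z
    proof -
      have "dist z x0 < \<delta>"
        using x0(3) dist_in_closed_segment[OF z] by (simp add: dist_commute)
      moreover have "unit_cube \<sigma> \<subseteq> unit_cube UNIV" by (rule unit_cube_mono) simp
      moreover have "z \<in> unit_cube \<sigma>" using seg z by blast
      ultimately show ?thesis
        using \<delta>(2)[of x0 z] x0 by (auto simp: dist_commute)
    qed
    then have "torus_map ` closed_segment x0 x \<subseteq> ball s r" by auto
    then show "\<exists>x0\<in>unit_cube \<sigma>. torus_map x0 = s \<and> closed_segment x0 x \<subseteq> unit_cube \<sigma> \<and>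
        torus_map ` closed_segment x0 x \<subseteq> ball s r"
      using x0 seg by blast
  qed
qed

lemma locally_path_connected_salvetti: "locally path_connected (salvetti L)"
  unfolding locally_path_connected_im_kleinen
proof (intro allI impI, elim conjE)
  fix V s assume V: "openin (top_of_set (salvetti L)) V" and s: "s \<in> V"
  then obtain r where r: "r > 0" "ball s r \<inter> salvetti L \<subseteq> V"
    by (auto simp: openin_contains_ball)
  obtain \<epsilon> where \<epsilon>: "\<epsilon> > 0" "\<And>\<sigma> x. \<lbrakk>x \<in> unit_cube \<sigma>; dist (torus_map x) s < \<epsilon>\<rbrakk>
        \<Longrightarrow> \<exists>x0\<in>unit_cube \<sigma>. torus_map x0 = s \<and> closed_segment x0 x \<subseteq> unit_cube \<sigma> \<and>
              torus_map ` closed_segment x0 x \<subseteq> ball s r"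
    using segment_to_torus_fibre[OF r(1)] by metis
  let ?U = "salvetti L \<inter> ball s (min \<epsilon> r)"
  show "\<exists>U. openin (top_of_set (salvetti L)) U \<and> s \<in> U \<and> U \<subseteq> V \<and>
          (\<forall>y. y \<in> U \<longrightarrow> (\<exists>p. path p \<and> path_image p \<subseteq> V \<and> pathstart p = s \<and> pathfinish p = y))"
  proof (rule exI[of _ ?U], intro conjI allI impI)
    show "openin (top_of_set (salvetti L)) ?U" by (intro openin_open_Int) simp
    show "s \<in> ?U" using s V \<epsilon>(1) r(1) openin_imp_subset by fastforce
    show "?U \<subseteq> V" using r(2) by auto
    fix y assume y: "y \<in> ?U"
    then obtain \<sigma> x where x: "\<sigma> \<in> L" "x \<in> unit_cube \<sigma>" "y = torus_map x"
      by (auto simp: salvetti_def)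
    then obtain x0 where x0: "torus_map x0 = s" "closed_segment x0 x \<subseteq> unit_cube \<sigma>"
        "torus_map ` closed_segment x0 x \<subseteq> ball s r"
      using \<epsilon>(2)[of x \<sigma>] y by (auto simp: dist_commute)
    have "torus_map ` closed_segment x0 x \<subseteq> salvetti L"
      using x0(2) x(1) by (auto simp: salvetti_def)
    then have sub: "torus_map ` closed_segment x0 x \<subseteq> V"
      using x0(3) r(2) by blast
    have "path (torus_map \<circ> linepath x0 x)"
      by (intro path_continuous_image continuous_on_torus_map) simp
    moreover have "path_image (torus_map \<circ> linepath x0 x) \<subseteq> V"
      using sub by (simp add: path_image_compose)
    moreover have "pathstart (torus_map \<circ> linepath x0 x) = s" "pathfinish (torus_map \<circ> linepath x0 x) = y"
      using x0 x by (simp_all add: pathstart_compose pathfinish_compose)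
    ultimately show "\<exists>p. path p \<and> path_image p \<subseteq> V \<and> pathstart p = s \<and> pathfinish p = y"
      by blast
  qed
qed


section \<open>Cubes of the covering\<close>

locale salvetti_cover =
  fixes L :: "'v::finite set set" and Y :: "'y::metric_space set" and p :: "'y \<Rightarrow> complex ^ 'v"
  assumes simplicial: "simplicial_complex L"
    and covering: "covering_space Y p (salvetti L)"
    and simply_connected: "simply_connected Y"
begin

abbreviation cube where "cube \<equiv> lifted_cube L Y p"

definition cells :: "'y set set" where
  "cells = {\<phi> ` unit_cube \<sigma> |\<sigma> \<phi>. cube \<sigma> \<phi>}"

lemma continuous_p: "continuous_on Y p"
  using covering by (rule covering_space_imp_continuous)

lemma image_p: "p ` Y = salvetti L"
  using covering by (rule covering_space_imp_surjective)

lemma p_in: "y \<in> Y \<Longrightarrow> p y \<in> salvetti L"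
  using image_p by blast

lemma connected_Y: "connected Y"
  using simply_connected by (rule simply_connected_metric_imp_connected)

lemma locally_path_connected_Y: "locally path_connected Y"
  using covering locally_path_connected_salvetti by (rule covering_metric_locally_path_connected)

lemma lift_unique:
  fixes g h :: "'c::topological_space \<Rightarrow> 'y"
  assumes "connected T" "a \<in> T" "x \<in> T"
    and g: "continuous_on T g" "g \<in> T \<rightarrow> Y" and h: "continuous_on T h" "h \<in> T \<rightarrow> Y"
    and eq: "\<And>x. x \<in> T \<Longrightarrow> p (g x) = p (h x)" "g a = h a"
  shows "g x = h x"
proof (rule covering_metric_lift_unique[OF covering assms(1-3), where f = "\<lambda>x. p (g x)"])
  show "continuous_on T (\<lambda>x. p (g x))"
    by (rule continuous_on_compose2[OF continuous_p g(1)]) (use g(2) in auto)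
  show "(\<lambda>x. p (g x)) \<in> T \<rightarrow> salvetti L"
    using g(2) p_in by auto
qed (use assms in auto)

lemma lift_exists:
  fixes f :: "'c::metric_space \<Rightarrow> complex ^ 'v"
  assumes "simply_connected U" "locally path_connected U" "continuous_on U f" "f \<in> U \<rightarrow> salvetti L"
    and "z \<in> U" "a \<in> Y" "f z = p a"
  obtains g where "continuous_on U g" "g \<in> U \<rightarrow> Y" "g z = a" "\<And>y. y \<in> U \<Longrightarrow> p (g y) = f y"
  using covering_metric_lift_exists[OF covering assms(6,5,1,2,3,4,7)] by blast

lemma cubeD:
  assumes "cube \<sigma> \<phi>"
  shows "\<sigma> \<in> L" "continuous_on (unit_cube \<sigma>) \<phi>" "\<phi> \<in> unit_cube \<sigma> \<rightarrow> Y"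
    "\<And>x. x \<in> unit_cube \<sigma> \<Longrightarrow> \<phi> x \<in> Y" "\<And>x. x \<in> unit_cube \<sigma> \<Longrightarrow> p (\<phi> x) = torus_map x"
  using assms unfolding lifted_cube_def by auto

lemma cube_lift_exists:
  assumes "\<sigma> \<in> L" "x \<in> unit_cube \<sigma>" "y \<in> Y" "p y = torus_map x"
  obtains \<phi> where "cube \<sigma> \<phi>" "\<phi> x = y"
proof -
  obtain g where "continuous_on (unit_cube \<sigma>) g" "g \<in> unit_cube \<sigma> \<rightarrow> Y" "g x = y"
    "\<And>y. y \<in> unit_cube \<sigma> \<Longrightarrow> p (g y) = torus_map y"
  proof (rule lift_exists[of "unit_cube \<sigma>" torus_map x y])
    show "simply_connected (unit_cube \<sigma>)"
      by (intro convex_imp_simply_connected convex_unit_cube)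
    show "locally path_connected (unit_cube \<sigma>)"
      by (intro convex_imp_locally_path_connected convex_unit_cube)
    show "torus_map \<in> unit_cube \<sigma> \<rightarrow> salvetti L"
      using \<open>\<sigma> \<in> L\<close> by (auto simp: salvetti_def)
  qed (use assms continuous_on_torus_map in auto)
  then show thesis
    using that[of g] assms unfolding lifted_cube_def by auto
qed

lemma connected_unit_cube: "connected (unit_cube \<sigma>)"
  by (intro convex_connected convex_unit_cube)

lemma cube_lift_unique:
  assumes "cube \<sigma> \<phi>" "cube \<sigma> \<psi>" "a \<in> unit_cube \<sigma>" "x \<in> unit_cube \<sigma>" "\<phi> a = \<psi> a"
  shows "\<phi> x = \<psi> x"
  by (rule lift_unique[OF connected_unit_cube[of \<sigma>] assms(3,4)])
     (use cubeD[OF assms(1)] cubeD[OF assms(2)] assms(5) in auto)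

lemma open_cube_through:
  assumes "y \<in> Y"
  obtains \<sigma> \<phi> x where "cube \<sigma> \<phi>" "x \<in> open_cube \<sigma>" "\<phi> x = y"
proof -
  let ?\<sigma> = "{w. p y $ w \<noteq> 1}"
  have *: "\<And>w. norm (p y $ w) = 1" "?\<sigma> \<in> L"
    using p_in[OF assms] salvetti_iff[OF simplicial] by blast+
  obtain x where x: "x \<in> open_cube ?\<sigma>" "torus_map x = p y"
    using unit_modulus_eq_torus_map[of "p y"] *(1) by blast
  then obtain \<phi> where "cube ?\<sigma> \<phi>" "\<phi> x = y"
    using cube_lift_exists[OF *(2), of x y] open_cube_subset assms by (metis subsetD)
  then show thesis using that x by blast
qed

lemma in_some_cell:
  assumes "y \<in> Y"
  obtains C where "C \<in> cells" "y \<in> C"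
proof -
  obtain \<sigma> \<phi> x where \<phi>: "cube \<sigma> \<phi>" and x: "x \<in> open_cube \<sigma>" "\<phi> x = y"
    using open_cube_through[OF assms] .
  have "\<phi> ` unit_cube \<sigma> \<in> cells" using \<phi> unfolding cells_def by blast
  moreover have "y \<in> \<phi> ` unit_cube \<sigma>" using x open_cube_subset by blast
  ultimately show thesis by (rule that)
qed

lemma cellD:
  assumes "C \<in> cells"
  shows "C \<subseteq> Y" "compact C" "C \<noteq> {}"
proof -
  obtain \<sigma> \<phi> where \<phi>: "cube \<sigma> \<phi>" and C: "C = \<phi> ` unit_cube \<sigma>"
    using assms unfolding cells_def by blast
  show "C \<subseteq> Y" "compact C" "C \<noteq> {}"
    unfolding C using cubeD(3)[OF \<phi>] compact_continuous_image[OF cubeD(2)[OF \<phi>] compact_unit_cube]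
      unit_cube_zero by blast+
qed

text \<open>Take a small neighbourhood of \<open>y\<close> inside a sheet of the covering. If a cube has a point there, the
  segment from this point to a preimage of \<open>p y\<close> stays over the evenly covered set, so its lift stays
  in the sheet and ends at \<open>y\<close>.\<close>

lemma cells_locally_finite:
  assumes y: "y \<in> Y"
  obtains U where "openin (top_of_set Y) U" "y \<in> U" "\<And>C. \<lbrakk>C \<in> cells; C \<inter> U \<noteq> {}\<rbrakk> \<Longrightarrow> y \<in> C"
proof -
  define s where "s = p y"
  obtain T U' q where T: "y \<in> T" "openin (top_of_set Y) T" and U': "s \<in> U'" "openin (top_of_set (salvetti L)) U'"
    and q: "homeomorphism T U' p q"
    using covering_space_local_homeomorphism[OF covering y] unfolding s_def by metis
  obtain r where r: "r > 0" "ball s r \<inter> salvetti L \<subseteq> U'"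
    using U' by (auto simp: openin_contains_ball)
  obtain \<epsilon> where \<epsilon>: "\<epsilon> > 0" "\<And>\<sigma> x. \<lbrakk>x \<in> unit_cube \<sigma>; dist (torus_map x) s < \<epsilon>\<rbrakk>
        \<Longrightarrow> \<exists>x0\<in>unit_cube \<sigma>. torus_map x0 = s \<and> closed_segment x0 x \<subseteq> unit_cube \<sigma> \<and>
              torus_map ` closed_segment x0 x \<subseteq> ball s r"
    using segment_to_torus_fibre[OF r(1)] by metis
  let ?U = "T \<inter> (Y \<inter> p -` ball s \<epsilon>)"
  show thesis
  proof (rule that[of ?U])
    show "openin (top_of_set Y) ?U"
      using T(2) continuous_p by (intro openin_Int continuous_openin_preimage_gen) auto
    show "y \<in> ?U" using T(1) y \<epsilon>(1) by (simp add: s_def)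
    fix C assume "C \<in> cells" "C \<inter> ?U \<noteq> {}"
    then obtain \<sigma> \<phi> x where \<phi>: "cube \<sigma> \<phi>" and x: "x \<in> unit_cube \<sigma>" "\<phi> x \<in> ?U" and C: "C = \<phi> ` unit_cube \<sigma>"
      unfolding cells_def by blast
    note cube = cubeD[OF \<phi>]
    have "dist (torus_map x) s < \<epsilon>"
      using x cube by (auto simp: dist_commute)
    then obtain x0 where x0: "x0 \<in> unit_cube \<sigma>" "torus_map x0 = s"
        and seg: "closed_segment x0 x \<subseteq> unit_cube \<sigma>" and ball: "torus_map ` closed_segment x0 x \<subseteq> ball s r"
      using \<epsilon>(2) x(1) by metis
    let ?S = "closed_segment x0 x"
    have tm: "torus_map z \<in> U'" if "z \<in> ?S" for z
    proof -
      have "torus_map z \<in> salvetti L" using that seg cube(1) by (auto simp: salvetti_def)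
      then show ?thesis using ball r(2) that by blast
    qed
    have "\<phi> x0 = q (torus_map x0)"
    proof (rule lift_unique[of ?S x x0 \<phi> "\<lambda>z. q (torus_map z)"])
      show "continuous_on ?S \<phi>" "\<phi> \<in> ?S \<rightarrow> Y"
        using cube seg continuous_on_subset by blast+
      show "continuous_on ?S (\<lambda>z. q (torus_map z))"
        using q tm by (intro continuous_on_compose2[OF _ continuous_on_torus_map, of U' q])
          (auto simp: homeomorphism_def)
      have "q t \<in> Y" if "t \<in> U'" for t
        using homeomorphism_image2[OF q] T(2) that openin_imp_subset by blast
      then show "(\<lambda>z. q (torus_map z)) \<in> ?S \<rightarrow> Y"
        using tm by blast
      show "p (\<phi> z) = p (q (torus_map z))" if "z \<in> ?S" for z
        using that seg cube tm homeomorphism_apply2[OF q] by (metis subsetD)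
      show "\<phi> x = q (torus_map x)"
        using x cube(5)[OF x(1)] homeomorphism_apply1[OF q, of "\<phi> x"] by simp
    qed auto
    also have "\<dots> = y"
      using x0(2) T(1) homeomorphism_apply1[OF q, of y] by (simp add: s_def)
    finally show "y \<in> C"
      using x0(1) C by blast
  qed
qed

text \<open>Restricting the characteristic maps to the unit cubes makes the set finite: the behaviour of a
  \<open>lifted_cube\<close> outside its domain is arbitrary.\<close>

definition charts_at :: "'y \<Rightarrow> ('v set \<times> (real ^ 'v \<Rightarrow> 'y)) set" where
  "charts_at y = {(\<sigma>, restrict \<phi> (unit_cube \<sigma>)) |\<sigma> \<phi>. cube \<sigma> \<phi> \<and> y \<in> \<phi> ` unit_cube \<sigma>}"

text \<open>A characteristic map is the unique lift of the torus map with a prescribed value at one point, and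
  only finitely many points of a unit cube can be mapped to \<open>y\<close>.\<close>

lemma finite_charts_at: "finite (charts_at y)"
proof -
  let ?B = "\<lambda>\<sigma> x. {(\<sigma>, restrict \<phi> (unit_cube \<sigma>)) |\<phi>. cube \<sigma> \<phi> \<and> \<phi> x = y}"
  have "finite (?B \<sigma> x)" if "x \<in> unit_cube \<sigma>" for \<sigma> x
  proof (cases "\<exists>\<phi>. cube \<sigma> \<phi> \<and> \<phi> x = y")
    case True
    then obtain \<phi> where \<phi>: "cube \<sigma> \<phi>" "\<phi> x = y" by blast
    have "restrict \<psi> (unit_cube \<sigma>) = restrict \<phi> (unit_cube \<sigma>)" if "cube \<sigma> \<psi>" "\<psi> x = y" for \<psi>
      using cube_lift_unique[OF that(1) \<phi>(1) \<open>x \<in> unit_cube \<sigma>\<close>] that(2) \<phi>(2)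
      by (intro restrict_ext) simp
    then have "?B \<sigma> x \<subseteq> {(\<sigma>, restrict \<phi> (unit_cube \<sigma>))}" by blast
    then show ?thesis by (rule finite_subset) simp
  next
    case False
    then have "?B \<sigma> x = {}" by blast
    then show ?thesis by (simp only: finite.emptyI)
  qed
  then have "finite (\<Union>\<sigma>\<in>L. \<Union>x\<in>{x \<in> unit_cube \<sigma>. torus_map x = p y}. ?B \<sigma> x)"
    using finite_torus_fibre by (intro finite_UN_I) auto
  moreover have "charts_at y \<subseteq> (\<Union>\<sigma>\<in>L. \<Union>x\<in>{x \<in> unit_cube \<sigma>. torus_map x = p y}. ?B \<sigma> x)"
    unfolding charts_at_def using cubeD by fastforce
  ultimately show ?thesis by (rule finite_subset[rotated])
qed

lemma finite_cells_at: "finite {C \<in> cells. y \<in> C}"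
proof (rule finite_subset)
  show "{C \<in> cells. y \<in> C} \<subseteq> (\<lambda>(\<sigma>, \<phi>). \<phi> ` unit_cube \<sigma>) ` charts_at y"
  proof clarify
    fix C assume "C \<in> cells" "y \<in> C"
    then obtain \<sigma> \<phi> where "cube \<sigma> \<phi>" "C = \<phi> ` unit_cube \<sigma>" "y \<in> \<phi> ` unit_cube \<sigma>"
      unfolding cells_def by blast
    then show "C \<in> (\<lambda>(\<sigma>, \<phi>). \<phi> ` unit_cube \<sigma>) ` charts_at y"
      unfolding charts_at_def
      by (intro image_eqI[where x = "(\<sigma>, restrict \<phi> (unit_cube \<sigma>))"]) auto
  qed
  show "finite ((\<lambda>(\<sigma>, \<phi>). \<phi> ` unit_cube \<sigma>) ` charts_at y)"
    using finite_charts_at by blast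
qed

lemma finite_cells_meeting_compact:
  assumes K: "compact K" "K \<subseteq> Y"
  shows "finite {C \<in> cells. C \<inter> K \<noteq> {}}"
proof -
  have "\<exists>U. openin (top_of_set Y) U \<and> y \<in> U \<and> (\<forall>C\<in>cells. C \<inter> U \<noteq> {} \<longrightarrow> y \<in> C)" if "y \<in> Y" for y
    using cells_locally_finite[OF that] by metis
  then obtain U where U: "\<And>y. y \<in> Y \<Longrightarrow> openin (top_of_set Y) (U y) \<and> y \<in> U y \<and> (\<forall>C\<in>cells. C \<inter> U y \<noteq> {} \<longrightarrow> y \<in> C)"
    by metis
  then have "\<forall>y\<in>K. \<exists>W. open W \<and> U y = Y \<inter> W"
    using K(2) by (auto simp: openin_open)
  then obtain W where W: "\<And>y. y \<in> K \<Longrightarrow> open (W y) \<and> U y = Y \<inter> W y"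
    by metis
  have "\<forall>y\<in>K. y \<in> W y" using U W K(2) by blast
  then have cover: "K \<subseteq> (\<Union>y\<in>K. W y)" by blast
  obtain D where D: "D \<subseteq> K" "finite D" "K \<subseteq> (\<Union>y\<in>D. W y)"
    by (rule compactE_image[OF K(1) _ cover]) (use W in auto)
  have "{C \<in> cells. C \<inter> K \<noteq> {}} \<subseteq> (\<Union>y\<in>D. {C \<in> cells. y \<in> C})"
  proof clarify
    fix C assume C: "C \<in> cells" "C \<inter> K \<noteq> {}"
    then obtain z where z: "z \<in> C" "z \<in> K" by blast
    then obtain y where y: "y \<in> D" "z \<in> W y" using D(3) by blast
    then have "z \<in> U y" using W[of y] z K(2) D(1) by auto
    then have "y \<in> C" using U[of y] D(1) y(1) K(2) C(1) z(1) by blast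
    then show "C \<in> (\<Union>y\<in>D. {C \<in> cells. y \<in> C})" using C(1) y(1) by blast
  qed
  moreover have "finite (\<Union>y\<in>D. {C \<in> cells. y \<in> C})"
    using D(2) finite_cells_at by blast
  ultimately show ?thesis by (rule finite_subset)
qed

text \<open>The union of the cubes with property \<open>P\<close> is open and closed by \<open>cells_locally_finite\<close>, and \<open>Y\<close>
  is connected.\<close>

lemma cell_induct:
  assumes C: "C \<in> cells" and C0: "C0 \<in> cells" "P C0"
    and step: "\<And>C C'. \<lbrakk>C \<in> cells; P C; C' \<in> cells; C \<inter> C' \<noteq> {}\<rbrakk> \<Longrightarrow> P C'"
  shows "P C"
proof -
  let ?S = "\<Union>{C \<in> cells. P C}"
  have "openin (top_of_set Y) ?S"
  proof (subst openin_subopen, intro ballI)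
    fix y assume "y \<in> ?S"
    then obtain C1 where C1: "C1 \<in> cells" "P C1" "y \<in> C1" by blast
    then have "y \<in> Y" using cellD by blast
    then obtain U where U: "openin (top_of_set Y) U" "y \<in> U" "\<And>C. \<lbrakk>C \<in> cells; C \<inter> U \<noteq> {}\<rbrakk> \<Longrightarrow> y \<in> C"
      using cells_locally_finite by (metis (lifting))
    have "U \<subseteq> ?S"
    proof
      fix z assume z: "z \<in> U"
      then have "z \<in> Y" using U(1) openin_imp_subset by blast
      then obtain C2 where C2: "C2 \<in> cells" "z \<in> C2" by (rule in_some_cell)
      then have "y \<in> C2" using U(3) z by blast
      then have "P C2" using step[of C1 C2] C1 C2 by blast
      then show "z \<in> ?S" using C2 by blast
    qed
    then show "\<exists>T. openin (top_of_set Y) T \<and> y \<in> T \<and> T \<subseteq> ?S" using U by blast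
  qed
  moreover have "closedin (top_of_set Y) ?S"
    unfolding closedin_def topspace_euclidean_subtopology
  proof
    show "?S \<subseteq> Y" using cellD by blast
    show "openin (top_of_set Y) (Y - ?S)"
    proof (subst openin_subopen, intro ballI)
      fix y assume y: "y \<in> Y - ?S"
      then obtain U where U: "openin (top_of_set Y) U" "y \<in> U" "\<And>C. \<lbrakk>C \<in> cells; C \<inter> U \<noteq> {}\<rbrakk> \<Longrightarrow> y \<in> C"
        using cells_locally_finite[of y] by blast
      then have "U \<subseteq> Y - ?S" using y openin_imp_subset by blast
      then show "\<exists>T. openin (top_of_set Y) T \<and> y \<in> T \<and> T \<subseteq> Y - ?S" using U by blast
    qed
  qed
  ultimately have "?S = {} \<or> ?S = Y"
    using connected_Y connected_clopen by blast
  moreover have "?S \<noteq> {}"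
    using C0 cellD(3) by blast
  ultimately have S: "?S = Y" by blast
  obtain y where "y \<in> C" "y \<in> Y" using cellD[OF C] by blast
  then obtain C1 where "C1 \<in> cells" "P C1" "y \<in> C1" using S by blast
  then show ?thesis using step[of C1 C] C \<open>y \<in> C\<close> by blast
qed

text \<open>Each cube meets only finitely many others, so only finitely many cubes can be reached from a given
  one in \<open>n\<close> steps, and every cube is reached eventually.\<close>

lemma countable_cells: "countable cells"
proof (cases "cells = {}")
  case False
  then obtain C0 where C0: "C0 \<in> cells" by blast
  define near where "near = rec_nat {C0} (\<lambda>_ A. {C' \<in> cells. C' \<inter> \<Union>A \<noteq> {}})"
  have near_0: "near 0 = {C0}" and near_Suc: "near (Suc n) = {C' \<in> cells. C' \<inter> \<Union>(near n) \<noteq> {}}" for n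
    by (simp_all add: near_def)
  have fin: "finite (near n) \<and> near n \<subseteq> cells" for n
  proof (induction n)
    case (Suc n)
    then have "compact (\<Union>(near n))" "\<Union>(near n) \<subseteq> Y"
      using cellD by (auto intro!: compact_Union)
    then show ?case
      using finite_cells_meeting_compact unfolding near_Suc by auto
  qed (simp add: near_0 C0)
  have "C \<in> (\<Union>n. near n)" if "C \<in> cells" for C
  proof (rule cell_induct[OF that C0])
    show "C0 \<in> (\<Union>n. near n)" using near_0 by blast
    fix C C' assume "C \<in> cells" "C \<in> (\<Union>n. near n)" "C' \<in> cells" "C \<inter> C' \<noteq> {}"
    then obtain n where "C' \<in> near (Suc n)" unfolding near_Suc by blast
    then show "C' \<in> (\<Union>n. near n)" by blast
  qed
  then have "cells \<subseteq> (\<Union>n. near n)" by blast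
  moreover have "countable (\<Union>n. near n)"
    using fin countable_finite by blast
  ultimately show ?thesis by (rule countable_subset)
qed simp

lemma countable_fibre: "countable {y \<in> Y. p y = z}"
proof (rule countable_subset)
  show "{y \<in> Y. p y = z} \<subseteq> (\<Union>C\<in>cells. {y \<in> C. p y = z})"
    using in_some_cell by blast
  have "finite {y \<in> C. p y = z}" if "C \<in> cells" for C
  proof -
    from that obtain \<sigma> \<phi> where \<phi>: "cube \<sigma> \<phi>" "C = \<phi> ` unit_cube \<sigma>" unfolding cells_def by blast
    have "{y \<in> C. p y = z} \<subseteq> \<phi> ` {x \<in> unit_cube \<sigma>. torus_map x = z}"
      using \<phi> cubeD(5)[OF \<phi>(1)] by auto
    then show ?thesis using finite_torus_fibre finite_subset by blast
  qed
  then show "countable (\<Union>C\<in>cells. {y \<in> C. p y = z})"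
    using countable_cells countable_finite by blast
qed

end


section \<open>Isometries between cubes\<close>

definition cube_isometry :: "'v::finite set \<Rightarrow> 'v set \<Rightarrow> (real ^ 'v \<Rightarrow> real ^ 'v) \<Rightarrow> bool" where
  "cube_isometry \<sigma> \<tau> \<iota> \<longleftrightarrow> \<iota> ` unit_cube \<sigma> = unit_cube \<tau> \<and>
     (\<forall>x\<in>unit_cube \<sigma>. \<forall>y\<in>unit_cube \<sigma>. dist (\<iota> x) (\<iota> y) = dist x y)"

definition corners :: "'v::finite set \<Rightarrow> (real ^ 'v) set" where
  "corners \<sigma> = {x \<in> unit_cube \<sigma>. \<forall>v. x $ v = 0 \<or> x $ v = 1}"

lemma cube_isometry_inj_on: "cube_isometry \<sigma> \<tau> \<iota> \<Longrightarrow> inj_on \<iota> (unit_cube \<sigma>)"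
  unfolding cube_isometry_def by (metis (no_types, lifting) dist_eq_0_iff inj_onI)

lemma cube_isometry_inverse:
  assumes "cube_isometry \<sigma> \<tau> \<iota>"
  shows "cube_isometry \<tau> \<sigma> (inv_into (unit_cube \<sigma>) \<iota>)"
proof -
  note inj = cube_isometry_inj_on[OF assms]
  have im: "\<iota> ` unit_cube \<sigma> = unit_cube \<tau>" using assms by (simp add: cube_isometry_def)
  let ?j = "inv_into (unit_cube \<sigma>) \<iota>"
  have "dist (?j x) (?j y) = dist x y" if "x \<in> unit_cube \<tau>" "y \<in> unit_cube \<tau>" for x y
  proof -
    have "?j x \<in> unit_cube \<sigma>" "?j y \<in> unit_cube \<sigma>" "\<iota> (?j x) = x" "\<iota> (?j y) = y"
      using that im by (auto intro!: inv_into_into f_inv_into_f)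
    then show ?thesis using assms unfolding cube_isometry_def by metis
  qed
  moreover have "?j ` unit_cube \<tau> = unit_cube \<sigma>"
    using inv_into_image_cancel[OF inj order_refl] im by simp
  ultimately show ?thesis by (simp add: cube_isometry_def)
qed

lemma unit_cubeD:
  assumes "x \<in> unit_cube \<sigma>"
  shows "0 \<le> x $ v" "x $ v \<le> 1" "v \<notin> \<sigma> \<Longrightarrow> x $ v = 0"
  using assms unfolding unit_cube_def by (auto; metis order_refl zero_le_one)+

lemma between_convex_combination:
  fixes x y z :: "'a::euclidean_space"
  shows "dist y z = dist y x + dist x z \<longleftrightarrow> (\<exists>t\<ge>0. t \<le> 1 \<and> x = (1 - t) *\<^sub>R y + t *\<^sub>R z)"
  using between[of y z x] by (auto simp: between_mem_segment in_segment)

lemma convex_combination_corner: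
  fixes a b c t :: real
  assumes "c = (1 - t) * a + t * b" "0 < t" "t < 1" "0 \<le> a" "a \<le> 1" "0 \<le> b" "b \<le> 1" "c = 0 \<or> c = 1"
  shows "a = c"
proof (cases "c = 0")
  case True
  moreover have "(1 - t) * a \<ge> 0" "t * b \<ge> 0" using assms by auto
  ultimately have "(1 - t) * a = 0" using assms(1) by linarith
  then show ?thesis using assms True by simp
next
  case False
  then have "c = 1" using assms by blast
  then have "(1 - t) * (1 - a) + t * (1 - b) = 0" using assms(1) by (simp add: algebra_simps)
  moreover have "(1 - t) * (1 - a) \<ge> 0" "t * (1 - b) \<ge> 0" using assms by auto
  ultimately have "(1 - t) * (1 - a) = 0" by linarith
  then show ?thesis using assms \<open>c = 1\<close> by simp
qed

text \<open>Corners are the extreme points, and betweenness is expressed by distances. Hence isometries of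
  cubes preserve corners; the next lemma characterises interior points in the same spirit.\<close>

lemma corner_iff_extreme:
  "x \<in> corners \<sigma> \<longleftrightarrow> x \<in> unit_cube \<sigma> \<and>
     (\<forall>y\<in>unit_cube \<sigma>. \<forall>z\<in>unit_cube \<sigma>. dist y z = dist y x + dist x z \<longrightarrow> y = x \<or> z = x)"
proof (intro iffI conjI ballI impI)
  assume x: "x \<in> corners \<sigma>"
  then show "x \<in> unit_cube \<sigma>" by (simp add: corners_def)
  fix y z assume yz: "y \<in> unit_cube \<sigma>" "z \<in> unit_cube \<sigma>" and "dist y z = dist y x + dist x z"
  then obtain t where t: "0 \<le> t" "t \<le> 1" "x = (1 - t) *\<^sub>R y + t *\<^sub>R z"
    unfolding between_convex_combination by blast
  consider "t = 0" | "t = 1" | "0 < t" "t < 1" using t by linarith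
  then show "y = x \<or> z = x"
  proof cases
    case 3
    have "y $ v = x $ v" for v
      by (rule convex_combination_corner[of _ t _ "z $ v"])
         (use x t 3 unit_cubeD[OF yz(1)] unit_cubeD[OF yz(2)] in \<open>auto simp: corners_def\<close>)
    then show ?thesis by (simp add: vec_eq_iff)
  qed (use t in auto)
next
  assume x: "x \<in> unit_cube \<sigma> \<and>
     (\<forall>y\<in>unit_cube \<sigma>. \<forall>z\<in>unit_cube \<sigma>. dist y z = dist y x + dist x z \<longrightarrow> y = x \<or> z = x)"
  have "x $ v = 0 \<or> x $ v = 1" for v
  proof (rule ccontr)
    assume "\<not> ?thesis"
    then have v: "v \<in> \<sigma>" "x $ v \<noteq> 0" "x $ v \<noteq> 1" using unit_cubeD[of x \<sigma> v] x by auto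
    define y where "y = (\<chi> w. if w = v then 0 else x $ w)"
    define z where "z = (\<chi> w. if w = v then 1 else x $ w)"
    have "y \<in> unit_cube \<sigma>" "z \<in> unit_cube \<sigma>"
      using x v unfolding unit_cube_def y_def z_def by auto
    moreover have "dist y z = dist y x + dist x z"
      unfolding between_convex_combination
      by (rule exI[of _ "x $ v"]) (use unit_cubeD[of x \<sigma> v] x in \<open>auto simp: y_def z_def vec_eq_iff algebra_simps\<close>)
    moreover have "y \<noteq> x" "z \<noteq> x"
      using v by (auto simp: vec_eq_iff y_def z_def intro!: exI[of _ v])
    ultimately show False using x by blast
  qed
  then show "x \<in> corners \<sigma>" using x by (simp add: corners_def)
qed

text \<open>Every segment of the cube that ends at an interior point can be prolonged beyond it, whereas a
  segment that reaches a proper face from the opposite face cannot.\<close>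

lemma open_cube_iff_extendable:
  "x \<in> open_cube \<sigma> \<longleftrightarrow> x \<in> unit_cube \<sigma> \<and>
     (\<forall>y\<in>unit_cube \<sigma>. y \<noteq> x \<longrightarrow> (\<exists>z\<in>unit_cube \<sigma>. z \<noteq> x \<and> dist y z = dist y x + dist x z))"
proof (intro iffI conjI ballI impI)
  assume x: "x \<in> open_cube \<sigma>"
  then show xc: "x \<in> unit_cube \<sigma>" using open_cube_subset by blast
  fix y assume y: "y \<in> unit_cube \<sigma>" "y \<noteq> x"
  \<comment> \<open>The distance from \<open>x\<close> to the boundary; coordinates of \<open>x - y\<close> are at most \<open>1\<close>.\<close>
  define s where "s = Min (insert 1 ((\<lambda>v. min (x $ v) (1 - x $ v)) ` \<sigma>))"
  have s: "s > 0" "\<And>v. v \<in> \<sigma> \<Longrightarrow> s \<le> x $ v \<and> s \<le> 1 - x $ v"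
  proof -
    show "s > 0" unfolding s_def using x by (subst Min_gr_iff) (auto simp: open_cube_def)
    fix v assume "v \<in> \<sigma>"
    then have "s \<le> min (x $ v) (1 - x $ v)" unfolding s_def by (intro Min_le) auto
    then show "s \<le> x $ v \<and> s \<le> 1 - x $ v" by simp
  qed
  define z where "z = x + s *\<^sub>R (x - y)"
  have "0 \<le> z $ v \<and> z $ v \<le> 1" if "v \<in> \<sigma>" for v
  proof -
    have "\<bar>x $ v - y $ v\<bar> \<le> 1"
      using unit_cubeD[OF xc, of v] unit_cubeD[OF y(1), of v] by auto
    then have "\<bar>s * (x $ v - y $ v)\<bar> \<le> s"
      using s(1) mult_left_mono[of _ 1 s] by (simp add: abs_mult)
    then show ?thesis using s(2)[OF that] by (simp add: z_def abs_le_iff)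
  qed
  moreover have "z $ v = 0" if "v \<notin> \<sigma>" for v
    using that unit_cubeD[OF xc, of v] unit_cubeD[OF y(1), of v] by (simp add: z_def)
  ultimately have "z \<in> unit_cube \<sigma>" unfolding unit_cube_def by blast
  moreover have "z \<noteq> x" using s(1) y(2) by (simp add: z_def)
  moreover have "dist y z = dist y x + dist x z"
    unfolding between_convex_combination
  proof (intro exI[of _ "1 / (1 + s)"] conjI)
    let ?t = "1 / (1 + s)"
    have "?t + ?t * s = 1" using s(1) by (simp add: field_simps)
    moreover have "(1 - ?t) *\<^sub>R y + ?t *\<^sub>R z = (1 - (?t + ?t * s)) *\<^sub>R y + (?t + ?t * s) *\<^sub>R x"
      unfolding z_def by (simp only: algebra_simps scaleR_scaleR)
    ultimately show "x = (1 - ?t) *\<^sub>R y + ?t *\<^sub>R z" by simp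
  qed (use s(1) in auto)
  ultimately show "\<exists>z\<in>unit_cube \<sigma>. z \<noteq> x \<and> dist y z = dist y x + dist x z" by blast
next
  assume x: "x \<in> unit_cube \<sigma> \<and>
     (\<forall>y\<in>unit_cube \<sigma>. y \<noteq> x \<longrightarrow> (\<exists>z\<in>unit_cube \<sigma>. z \<noteq> x \<and> dist y z = dist y x + dist x z))"
  have "x $ v \<noteq> 0 \<and> x $ v \<noteq> 1" if v: "v \<in> \<sigma>" for v
  proof (rule ccontr)
    assume "\<not> ?thesis"
    then have xv: "x $ v = 0 \<or> x $ v = 1" by blast
    define y where "y = (\<chi> w. if w = v then 1 - x $ v else x $ w)"
    have "y \<in> unit_cube \<sigma>"
      using x v unfolding unit_cube_def y_def by auto
    moreover have "y \<noteq> x"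
      using xv by (auto simp: vec_eq_iff y_def intro!: exI[of _ v])
    ultimately obtain z where z: "z \<in> unit_cube \<sigma>" "z \<noteq> x" "dist y z = dist y x + dist x z"
      using x by blast
    then obtain t where t: "0 \<le> t" "t \<le> 1" "x = (1 - t) *\<^sub>R y + t *\<^sub>R z"
      unfolding between_convex_combination by blast
    have "x $ v = (1 - t) * (1 - x $ v) + t * z $ v"
      by (subst t(3)) (simp add: y_def)
    moreover have "0 \<le> z $ v" "z $ v \<le> 1" using unit_cubeD[OF z(1)] by auto
    moreover have "0 \<le> t * z $ v" "t * z $ v \<le> t"
      using t(1) \<open>0 \<le> z $ v\<close> \<open>z $ v \<le> 1\<close> by (auto intro: mult_left_le)
    ultimately have "t = 1" using xv t(2) by auto
    then show False using t(3) z(2) by simp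
  qed
  then show "x \<in> open_cube \<sigma>"
    using x unit_cubeD[of x \<sigma>] unfolding open_cube_def by (simp add: less_le)
qed

lemma cube_isometry_open_cube:
  assumes "cube_isometry \<sigma> \<tau> \<iota>" and x: "x \<in> open_cube \<sigma>"
  shows "\<iota> x \<in> open_cube \<tau>"
proof -
  have im: "\<iota> ` unit_cube \<sigma> = unit_cube \<tau>" and d: "\<And>x y. x \<in> unit_cube \<sigma> \<Longrightarrow> y \<in> unit_cube \<sigma> \<Longrightarrow> dist (\<iota> x) (\<iota> y) = dist x y"
    using assms by (auto simp: cube_isometry_def)
  have xc: "x \<in> unit_cube \<sigma>" using x open_cube_subset by blast
  have "\<exists>z\<in>unit_cube \<tau>. z \<noteq> \<iota> x \<and> dist y z = dist y (\<iota> x) + dist (\<iota> x) z"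
    if y: "y \<in> unit_cube \<tau>" "y \<noteq> \<iota> x" for y
  proof -
    obtain y' where y': "y' \<in> unit_cube \<sigma>" "y = \<iota> y'" using y im by blast
    then have "y' \<noteq> x" using y(2) by blast
    obtain z where z: "z \<in> unit_cube \<sigma>" "z \<noteq> x" "dist y' z = dist y' x + dist x z"
      using x[unfolded open_cube_iff_extendable, THEN conjunct2, rule_format, OF y'(1) \<open>y' \<noteq> x\<close>] by blast
    have "\<iota> z \<noteq> \<iota> x" using d[OF z(1) xc] z(2) by auto
    then show ?thesis using z y' d xc im by (intro bexI[of _ "\<iota> z"]) auto
  qed
  then show ?thesis unfolding open_cube_iff_extendable using xc im by blast
qed

lemma cube_isometry_corners:
  assumes "cube_isometry \<sigma> \<tau> \<iota>" and x: "x \<in> corners \<sigma>"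
  shows "\<iota> x \<in> corners \<tau>"
proof -
  have im: "\<iota> ` unit_cube \<sigma> = unit_cube \<tau>" and d: "\<And>x y. x \<in> unit_cube \<sigma> \<Longrightarrow> y \<in> unit_cube \<sigma> \<Longrightarrow> dist (\<iota> x) (\<iota> y) = dist x y"
    using assms by (auto simp: cube_isometry_def)
  have xc: "x \<in> unit_cube \<sigma>" using x by (simp add: corners_def)
  have "y = \<iota> x \<or> z = \<iota> x"
    if yz: "y \<in> unit_cube \<tau>" "z \<in> unit_cube \<tau>" "dist y z = dist y (\<iota> x) + dist (\<iota> x) z" for y z
  proof -
    obtain y' z' where "y' \<in> unit_cube \<sigma>" "y = \<iota> y'" "z' \<in> unit_cube \<sigma>" "z = \<iota> z'" using yz im by blast
    moreover from this have "dist y' z' = dist y' x + dist x z'" using yz(3) d xc by metis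
    ultimately show ?thesis using x unfolding corner_iff_extreme by blast
  qed
  then show ?thesis unfolding corner_iff_extreme using xc im by blast
qed

text \<open>A point is determined by its distances to the corners: the distances to \<open>0\<close> and to the unit vector
  in direction \<open>v\<close> give its coordinate at \<open>v\<close>.\<close>

lemma cube_isometries_eq_if_eq_on_corners:
  assumes f: "cube_isometry \<sigma> \<tau> f" and g: "cube_isometry \<sigma> \<tau> g"
    and eq: "\<And>c. c \<in> corners \<sigma> \<Longrightarrow> f c = g c" and x: "x \<in> unit_cube \<sigma>"
  shows "f x = g x"
proof -
  have fx: "f x \<in> unit_cube \<tau>" "g x \<in> unit_cube \<tau>" using f g x by (auto simp: cube_isometry_def)
  have d: "dist (f x) c = dist (g x) c" if "c \<in> corners \<tau>" for c
  proof -
    let ?c = "inv_into (unit_cube \<sigma>) f c"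
    have "?c \<in> corners \<sigma>" by (rule cube_isometry_corners[OF cube_isometry_inverse[OF f] that])
    moreover have "f ?c = c"
      using f that by (intro f_inv_into_f) (auto simp: cube_isometry_def corners_def)
    ultimately show ?thesis
      using eq[of ?c] f g x unfolding cube_isometry_def corners_def by (metis (no_types, lifting) mem_Collect_eq)
  qed
  have "f x $ v = g x $ v" for v
  proof (cases "v \<in> \<tau>")
    case True
    have "0 \<in> corners \<tau>" "axis v 1 \<in> corners \<tau>"
      using True by (auto simp: corners_def unit_cube_def axis_def)
    then have "norm (f x) = norm (g x)" "norm (f x - axis v 1) = norm (g x - axis v 1)"
      using d[of 0] d[of "axis v 1"] by (auto simp: dist_norm)
    then have "f x \<bullet> f x = g x \<bullet> g x" "(f x - axis v 1) \<bullet> (f x - axis v 1) = (g x - axis v 1) \<bullet> (g x - axis v 1)"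
      by (simp_all add: dot_square_norm)
    then have "f x \<bullet> axis v 1 = g x \<bullet> axis v 1"
      by (simp add: inner_diff_left inner_diff_right inner_commute)
    then show ?thesis by (simp add: inner_axis)
  next
    case False
    then show ?thesis using fx unit_cubeD(3) by metis
  qed
  then show ?thesis by (simp add: vec_eq_iff)
qed

lemma finite_corners: "finite (corners \<sigma>)"
  by (rule finite_subset[OF _ finite_vec_box[of "\<lambda>_. {0, 1}"]]) (auto simp: corners_def)

lemma finite_cube_isometries: "finite {restrict \<iota> (unit_cube \<sigma>) |\<iota>. cube_isometry \<sigma> \<tau> \<iota>}"
proof (rule inj_on_finite)
  let ?F = "{restrict \<iota> (unit_cube \<sigma>) |\<iota>. cube_isometry \<sigma> \<tau> \<iota>}"
  have sub: "corners \<sigma> \<subseteq> unit_cube \<sigma>" by (auto simp: corners_def)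
  show "inj_on (\<lambda>f. restrict f (corners \<sigma>)) ?F"
  proof (rule inj_onI, clarify)
    fix f g assume f: "cube_isometry \<sigma> \<tau> f" and g: "cube_isometry \<sigma> \<tau> g"
      and eq: "restrict (restrict f (unit_cube \<sigma>)) (corners \<sigma>) = restrict (restrict g (unit_cube \<sigma>)) (corners \<sigma>)"
    have "f c = g c" if "c \<in> corners \<sigma>" for c
      using fun_cong[OF eq, of c] that sub by auto
    then show "restrict f (unit_cube \<sigma>) = restrict g (unit_cube \<sigma>)"
      using cube_isometries_eq_if_eq_on_corners[OF f g] by (intro restrict_ext) blast
  qed
  show "(\<lambda>f. restrict f (corners \<sigma>)) ` ?F \<subseteq> corners \<sigma> \<rightarrow>\<^sub>E corners \<tau>"
    using cube_isometry_corners sub by fastforce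
  show "finite (corners \<sigma> \<rightarrow>\<^sub>E corners \<tau>)"
    by (intro finite_PiE finite_corners)
qed


section \<open>The automorphism group\<close>

text \<open>Agreement on all of \<open>K\<close> can be tested at finitely many points: choose one point to exclude each of
  the finitely many restrictions that differ from \<open>f\<close>.\<close>

lemma finite_restrictions_determined:
  assumes fin: "finite ((\<lambda>g. restrict g K) ` H)"
  obtains P where "finite P" "P \<subseteq> K" "\<And>g. \<lbrakk>g \<in> H; \<And>y. y \<in> P \<Longrightarrow> g y = f y\<rbrakk> \<Longrightarrow> \<forall>y\<in>K. g y = f y"
proof -
  let ?R = "{r \<in> (\<lambda>g. restrict g K) ` H. \<exists>y\<in>K. r y \<noteq> f y}"
  have "\<forall>r\<in>?R. \<exists>y. y \<in> K \<and> r y \<noteq> f y" by (intro ballI) (simp only: mem_Collect_eq Bex_def)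
  then obtain y where y: "\<And>r. r \<in> ?R \<Longrightarrow> y r \<in> K \<and> r (y r) \<noteq> f (y r)"
    using bchoice[of ?R "\<lambda>r y. y \<in> K \<and> r y \<noteq> f y"] by blast
  show thesis
  proof (rule that[of "y ` ?R"])
    show "finite (y ` ?R)" using fin by simp
    show "y ` ?R \<subseteq> K" using y by blast
    fix g assume g: "g \<in> H" and eq: "\<And>z. z \<in> y ` ?R \<Longrightarrow> g z = f z"
    show "\<forall>z\<in>K. g z = f z"
    proof (rule ccontr)
      assume "\<not> ?thesis"
      then have r: "restrict g K \<in> ?R" using g by auto
      then show False using y[OF r] eq[of "y (restrict g K)"] by auto
    qed
  qed
qed

context salvetti_cover
begin

abbreviation Aut :: "('y \<Rightarrow> 'y) set" where "Aut \<equiv> carrier (aut_group L Y p)"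

lemma Aut_iff: "f \<in> Aut \<longleftrightarrow> f \<in> Bij Y \<and> (\<exists>g. homeomorphism Y Y f g) \<and>
    (\<forall>\<sigma> \<phi>. cube \<sigma> \<phi> \<longrightarrow> (\<exists>\<tau> \<psi> \<iota>. cube \<tau> \<psi> \<and> cube_isometry \<sigma> \<tau> \<iota> \<and> (\<forall>x\<in>unit_cube \<sigma>. f (\<phi> x) = \<psi> (\<iota> x))))"
  unfolding aut_group_def cube_automorphism_def cube_isometry_def by simp

lemma AutD:
  assumes "f \<in> Aut"
  shows "f \<in> Bij Y" "f \<in> extensional Y" "bij_betw f Y Y" "continuous_on Y f" "y \<in> Y \<Longrightarrow> f y \<in> Y"
proof -
  show *: "f \<in> Bij Y" using assms Aut_iff by blast
  then show "f \<in> extensional Y" "bij_betw f Y Y" by (auto simp: Bij_def)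
  then show "y \<in> Y \<Longrightarrow> f y \<in> Y" by (auto simp: bij_betw_def)
  show "continuous_on Y f" using assms Aut_iff homeomorphism_def by blast
qed

lemma Aut_cube:
  assumes "f \<in> Aut" "cube \<sigma> \<phi>"
  obtains \<tau> \<psi> \<iota> where "cube \<tau> \<psi>" "cube_isometry \<sigma> \<tau> \<iota>" "\<And>x. x \<in> unit_cube \<sigma> \<Longrightarrow> f (\<phi> x) = \<psi> (\<iota> x)"
  using assms(1)[unfolded Aut_iff, THEN conjunct2, THEN conjunct2, rule_format, OF assms(2)] that by metis

lemma Aut_eqI:
  assumes "f \<in> Aut" "g \<in> Aut" "\<And>y. y \<in> Y \<Longrightarrow> f y = g y"
  shows "f = g"
  using AutD(2)[OF assms(1)] AutD(2)[OF assms(2)] assms(3) by (rule extensionalityI)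

lemma mult_aut [simp]: "\<lbrakk>f \<in> Aut; g \<in> Aut\<rbrakk> \<Longrightarrow> f \<otimes>\<^bsub>aut_group L Y p\<^esub> g = compose Y f g"
  using AutD(1)[of f] AutD(1)[of g] by (simp add: aut_group_def BijGroup_def)

lemma id_Aut: "(\<lambda>x\<in>Y. x) \<in> Aut"
  unfolding Aut_iff
proof (intro conjI allI impI)
  show "(\<lambda>x\<in>Y. x) \<in> Bij Y" by (rule id_Bij)
  have "homeomorphism Y Y (\<lambda>x\<in>Y. x) (\<lambda>x. x)"
    by (rule homeomorphismI) (auto simp: continuous_on_cong[of Y Y "\<lambda>x\<in>Y. x" "\<lambda>x. x"])
  then show "\<exists>g. homeomorphism Y Y (\<lambda>x\<in>Y. x) g" by blast
  fix \<sigma> \<phi> assume "cube \<sigma> \<phi>"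
  then show "\<exists>\<tau> \<psi> \<iota>. cube \<tau> \<psi> \<and> cube_isometry \<sigma> \<tau> \<iota> \<and> (\<forall>x\<in>unit_cube \<sigma>. (\<lambda>x\<in>Y. x) (\<phi> x) = \<psi> (\<iota> x))"
    by (intro exI[of _ \<sigma>] exI[of _ \<phi>] exI[of _ id]) (auto simp: cube_isometry_def cubeD)
qed

lemma compose_Aut:
  assumes f: "f \<in> Aut" and g: "g \<in> Aut"
  shows "compose Y f g \<in> Aut"
  unfolding Aut_iff
proof (intro conjI allI impI)
  show "compose Y f g \<in> Bij Y" using AutD(1)[OF f] AutD(1)[OF g] by (rule compose_Bij)
  obtain f' g' where "homeomorphism Y Y f f'" "homeomorphism Y Y g g'" using f g Aut_iff by blast
  then have "homeomorphism Y Y (f \<circ> g) (g' \<circ> f')" by (blast intro: homeomorphism_compose)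
  then have "homeomorphism Y Y (compose Y f g) (g' \<circ> f')"
    by (rule homeomorphism_cong) (auto simp: compose_def)
  then show "\<exists>h. homeomorphism Y Y (compose Y f g) h" by blast
  fix \<sigma> \<phi> assume \<phi>: "cube \<sigma> \<phi>"
  obtain \<tau> \<psi> \<iota> where 1: "cube \<tau> \<psi>" "cube_isometry \<sigma> \<tau> \<iota>" "\<And>x. x \<in> unit_cube \<sigma> \<Longrightarrow> g (\<phi> x) = \<psi> (\<iota> x)"
    using Aut_cube[OF g \<phi>] by blast
  obtain \<tau>' \<psi>' \<iota>' where 2: "cube \<tau>' \<psi>'" "cube_isometry \<tau> \<tau>' \<iota>'" "\<And>x. x \<in> unit_cube \<tau> \<Longrightarrow> f (\<psi> x) = \<psi>' (\<iota>' x)"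
    using Aut_cube[OF f 1(1)] by blast
  have \<iota>: "\<iota> x \<in> unit_cube \<tau>" if "x \<in> unit_cube \<sigma>" for x
    using 1(2) that by (auto simp: cube_isometry_def)
  have "cube_isometry \<sigma> \<tau>' (\<iota>' \<circ> \<iota>)"
    using 1(2) 2(2) \<iota> unfolding cube_isometry_def by (auto simp only: image_comp[symmetric] comp_apply)
  moreover have "compose Y f g (\<phi> x) = \<psi>' ((\<iota>' \<circ> \<iota>) x)" if "x \<in> unit_cube \<sigma>" for x
    using that 1(3) 2(3) \<iota> cubeD(4)[OF \<phi>] by (simp add: compose_eq)
  ultimately show "\<exists>\<tau> \<psi> \<iota>. cube \<tau> \<psi> \<and> cube_isometry \<sigma> \<tau> \<iota> \<and> (\<forall>x\<in>unit_cube \<sigma>. compose Y f g (\<phi> x) = \<psi> (\<iota> x))"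
    using 2(1) by blast
qed

text \<open>A cube automorphism is only required to map cubes onto cubes. For the inverse, let \<open>\<phi>\<close> be a cube
  and let \<open>\<phi>'\<close> be the cube whose interior contains the preimage of the centre of \<open>\<phi>\<close>. The image of
  \<open>\<phi>'\<close> is a cube with that centre in its interior, hence is \<open>\<phi>\<close>.\<close>

lemma inverse_Aut:
  assumes f: "f \<in> Aut"
  shows "(\<lambda>x\<in>Y. inv_into Y f x) \<in> Aut"
  unfolding Aut_iff
proof (intro conjI allI impI)
  let ?f = "\<lambda>x\<in>Y. inv_into Y f x"
  note bij = AutD(3)[OF f]
  show "?f \<in> Bij Y" using AutD(1)[OF f] by (rule restrict_inv_into_Bij)
  obtain g where g: "homeomorphism Y Y f g" using f Aut_iff by blast
  have "g y = ?f y" if "y \<in> Y" for y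
  proof -
    have "g y \<in> Y" "f (g y) = y" using that g unfolding homeomorphism_def by auto
    then show ?thesis using that bij by (simp add: bij_betw_def inv_into_f_eq)
  qed
  then have "homeomorphism Y Y ?f f"
    by (intro homeomorphism_cong[OF homeomorphism_symD[OF g]]) auto
  then show "\<exists>h. homeomorphism Y Y ?f h" by blast
  fix \<sigma> \<phi> assume \<phi>: "cube \<sigma> \<phi>"
  \<comment> \<open>Follow the cube of the preimage of an interior point.\<close>
  define c :: "real ^ 'v" where "c = (\<chi> v. if v \<in> \<sigma> then 1 / 2 else 0)"
  have c: "c \<in> open_cube \<sigma>" by (simp add: c_def open_cube_def)
  then have c': "c \<in> unit_cube \<sigma>" using open_cube_subset by blast
  let ?y = "inv_into Y f (\<phi> c)"
  have y: "?y \<in> Y" "f ?y = \<phi> c"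
    using bij cubeD(4)[OF \<phi> c'] by (auto simp: bij_betw_def inv_into_into f_inv_into_f)
  obtain \<sigma>' \<phi>' x' where \<phi>': "cube \<sigma>' \<phi>'" and x': "x' \<in> open_cube \<sigma>'" "\<phi>' x' = ?y"
    using open_cube_through[OF y(1)] by blast
  obtain \<tau> \<psi> \<iota> where \<psi>: "cube \<tau> \<psi>" and \<iota>: "cube_isometry \<sigma>' \<tau> \<iota>"
    and eq: "\<And>x. x \<in> unit_cube \<sigma>' \<Longrightarrow> f (\<phi>' x) = \<psi> (\<iota> x)"
    using Aut_cube[OF f \<phi>'] by blast
  have o: "\<iota> x' \<in> open_cube \<tau>" using cube_isometry_open_cube[OF \<iota> x'(1)] .
  have u: "x' \<in> unit_cube \<sigma>'" "\<iota> x' \<in> unit_cube \<tau>" using x' o open_cube_subset by blast+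
  have e: "\<phi> c = \<psi> (\<iota> x')" using eq[OF u(1)] x'(2) y(2) by simp
  then have t: "torus_map c = torus_map (\<iota> x')"
    using cubeD(5)[OF \<phi> c'] cubeD(5)[OF \<psi> u(2)] by simp
  then have \<tau>: "\<tau> = \<sigma>" using torus_map_open_cube_support[OF c] torus_map_open_cube_support[OF o] by simp
  then have "c = \<iota> x'" using torus_map_eq_open_cube[OF c _ t] u(2) by simp
  then have \<psi>\<phi>: "\<psi> x = \<phi> x" if "x \<in> unit_cube \<sigma>" for x
    using cube_lift_unique[of \<sigma> \<psi> \<phi> c x] \<psi> \<phi> \<tau> c' that e by simp
  let ?j = "inv_into (unit_cube \<sigma>') \<iota>"
  have j: "cube_isometry \<sigma> \<sigma>' ?j" using cube_isometry_inverse[OF \<iota>] \<tau> by simp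
  have "?f (\<phi> x) = \<phi>' (?j x)" if x: "x \<in> unit_cube \<sigma>" for x
  proof -
    have jx: "?j x \<in> unit_cube \<sigma>'" "\<iota> (?j x) = x"
      using j x \<iota> \<tau> by (auto simp: cube_isometry_def intro: f_inv_into_f)
    then have "f (\<phi>' (?j x)) = \<phi> x" using eq \<psi>\<phi>[OF x] by simp
    then show ?thesis
      using bij cubeD(4)[OF \<phi>' jx(1)] cubeD(4)[OF \<phi> x] by (auto simp: bij_betw_def inv_into_f_eq)
  qed
  then show "\<exists>\<tau> \<psi> \<iota>. cube \<tau> \<psi> \<and> cube_isometry \<sigma> \<tau> \<iota> \<and> (\<forall>x\<in>unit_cube \<sigma>. ?f (\<phi> x) = \<psi> (\<iota> x))"
    using \<phi>' j by blast
qed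

lemma subgroup_Aut: "subgroup Aut (BijGroup Y)"
proof (rule group.subgroupI[OF group_BijGroup])
  show "Aut \<subseteq> carrier (BijGroup Y)" using AutD(1) unfolding BijGroup_def by (simp add: subset_iff)
  show "Aut \<noteq> {}" using id_Aut by blast
  show "inv\<^bsub>BijGroup Y\<^esub> f \<in> Aut" if "f \<in> Aut" for f
    unfolding inv_BijGroup[OF AutD(1)[OF that]] using that by (rule inverse_Aut)
  show "f \<otimes>\<^bsub>BijGroup Y\<^esub> g \<in> Aut" if "f \<in> Aut" "g \<in> Aut" for f g
    using compose_Aut[OF that] AutD(1)[OF that(1)] AutD(1)[OF that(2)] by (simp add: BijGroup_def)
qed

lemma group_aut: "group (aut_group L Y p)"
proof -
  have "aut_group L Y p = (BijGroup Y)\<lparr>carrier := Aut\<rparr>"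
    by (simp add: aut_group_def)
  then show ?thesis
    using subgroup.subgroup_is_group[OF subgroup_Aut group_BijGroup] by simp
qed

lemma inv_aut: "f \<in> Aut \<Longrightarrow> inv\<^bsub>aut_group L Y p\<^esub> f = (\<lambda>x\<in>Y. inv_into Y f x)"
proof -
  assume f: "f \<in> Aut"
  have "aut_group L Y p = (BijGroup Y)\<lparr>carrier := Aut\<rparr>"
    by (simp add: aut_group_def)
  then show ?thesis
    using group.m_inv_consistent[OF group_BijGroup subgroup_Aut f] inv_BijGroup[OF AutD(1)[OF f]] by simp
qed

lemma inv_aut_apply:
  assumes f: "f \<in> Aut" and y: "y \<in> Y"
  shows "(inv\<^bsub>aut_group L Y p\<^esub> f) y \<in> Y" "f ((inv\<^bsub>aut_group L Y p\<^esub> f) y) = y" "(inv\<^bsub>aut_group L Y p\<^esub> f) (f y) = y"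
  using y AutD(3)[OF f] AutD(5)[OF f y] unfolding inv_aut[OF f] bij_betw_def
  by (auto simp: inv_into_into f_inv_into_f)

lemma inv_aut_eq_iff:
  assumes f: "f \<in> Aut" and y: "y \<in> Y" "z \<in> Y"
  shows "(inv\<^bsub>aut_group L Y p\<^esub> f) y = z \<longleftrightarrow> f z = y"
  using inv_aut_apply[OF f y(1)] inv_aut_apply[OF f y(2)] by metis

text \<open>An automorphism carries a cube through \<open>y\<close> to one of the finitely many cubes through the image of
  \<open>y\<close>, by one of finitely many isometries.\<close>

lemma finite_restrictions_cell_step:
  assumes H: "H \<subseteq> Aut" and C: "C \<in> cells" and y: "y \<in> C" and fin: "finite ((\<lambda>g. g y) ` H)"
  shows "finite ((\<lambda>g. restrict g C) ` H)"
proof -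
  obtain \<sigma> \<phi> where \<phi>: "cube \<sigma> \<phi>" "C = \<phi> ` unit_cube \<sigma>" using C unfolding cells_def by blast
  obtain x where x: "x \<in> unit_cube \<sigma>" "y = \<phi> x" using y \<phi>(2) by blast
  let ?I = "\<lambda>\<tau>. {restrict \<iota> (unit_cube \<sigma>) |\<iota>. cube_isometry \<sigma> \<tau> \<iota>}"
  let ?D = "SIGMA d : (\<Union>z\<in>(\<lambda>g. g y) ` H. charts_at z). ?I (fst d)"
  let ?F = "\<lambda>(d, \<iota>). \<lambda>c\<in>C. snd d (\<iota> (inv_into (unit_cube \<sigma>) \<phi> c))"
  have "finite ?D"
    using fin finite_charts_at finite_cube_isometries by (intro finite_SigmaI finite_UN_I) auto
  moreover have "(\<lambda>g. restrict g C) ` H \<subseteq> ?F ` ?D"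
  proof clarify
    fix g assume g: "g \<in> H"
    obtain \<tau> \<psi> \<iota> where \<psi>: "cube \<tau> \<psi>" and \<iota>: "cube_isometry \<sigma> \<tau> \<iota>"
      and eq: "\<And>x. x \<in> unit_cube \<sigma> \<Longrightarrow> g (\<phi> x) = \<psi> (\<iota> x)"
      using Aut_cube[of g, OF _ \<phi>(1)] g H by blast
    have im: "\<iota> x \<in> unit_cube \<tau>" if "x \<in> unit_cube \<sigma>" for x using \<iota> that by (auto simp: cube_isometry_def)
    have "(\<tau>, restrict \<psi> (unit_cube \<tau>)) \<in> charts_at (g y)"
      using \<psi> eq[OF x(1)] x(2) im[OF x(1)] unfolding charts_at_def by blast
    then have "((\<tau>, restrict \<psi> (unit_cube \<tau>)), restrict \<iota> (unit_cube \<sigma>)) \<in> ?D"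
      using g \<iota> by auto
    moreover have "restrict g C = ?F ((\<tau>, restrict \<psi> (unit_cube \<tau>)), restrict \<iota> (unit_cube \<sigma>))"
    proof
      fix c
      show "restrict g C c = ?F ((\<tau>, restrict \<psi> (unit_cube \<tau>)), restrict \<iota> (unit_cube \<sigma>)) c"
      proof (cases "c \<in> C")
        case True
        then have "inv_into (unit_cube \<sigma>) \<phi> c \<in> unit_cube \<sigma>" "\<phi> (inv_into (unit_cube \<sigma>) \<phi> c) = c"
          using \<phi>(2) by (auto intro: inv_into_into f_inv_into_f)
        then show ?thesis using True eq[of "inv_into (unit_cube \<sigma>) \<phi> c"] im by simp
      qed simp
    qed
    ultimately show "restrict g C \<in> ?F ` ?D" by blast
  qed
  ultimately show ?thesis by (rule finite_surj)
qed

lemma finite_restrictions_cell: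
  assumes "x \<in> Y" "C \<in> cells"
  shows "finite ((\<lambda>g. restrict g C) ` {g \<in> Aut. g x = z})"
proof -
  let ?H = "{g \<in> Aut. g x = z}"
  obtain C0 where C0: "C0 \<in> cells" "x \<in> C0" using in_some_cell[OF assms(1)] .
  have "(\<lambda>g. g x) ` ?H \<subseteq> {z}" by auto
  then have fin0: "finite ((\<lambda>g. g x) ` ?H)" by (rule finite_subset) simp
  show ?thesis
  proof (rule cell_induct[OF assms(2) C0(1)])
    show "finite ((\<lambda>g. restrict g C0) ` ?H)"
      by (rule finite_restrictions_cell_step[OF _ C0 fin0]) blast
    fix C C' assume C: "C \<in> cells" and fin: "finite ((\<lambda>g. restrict g C) ` ?H)"
      and C': "C' \<in> cells" and "C \<inter> C' \<noteq> {}"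
    then obtain y where y: "y \<in> C" "y \<in> C'" by blast
    have "(\<lambda>g. g y) ` ?H = (\<lambda>r. r y) ` (\<lambda>g. restrict g C) ` ?H"
      using y(1) by (force simp: image_image)
    then have "finite ((\<lambda>g. g y) ` ?H)" using fin by simp
    then show "finite ((\<lambda>g. restrict g C') ` ?H)"
      by (rule finite_restrictions_cell_step[OF _ C' y(2), rotated]) blast
  qed
qed

text \<open>This rigidity is the source of local compactness. Starting from the prescribed value at \<open>x\<close>,
  finiteness spreads from cube to adjacent cube, and a compact set meets only finitely many cubes.\<close>

lemma finite_restrictions:
  assumes x: "x \<in> Y" and K: "compact K" "K \<subseteq> Y"
  shows "finite ((\<lambda>g. restrict g K) ` {g \<in> Aut. g x = z})"
proof -
  let ?H = "{g \<in> Aut. g x = z}"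
  let ?D = "{C \<in> cells. C \<inter> K \<noteq> {}}"
  have "finite (\<Pi>\<^sub>E C\<in>?D. (\<lambda>g. restrict g C) ` ?H)"
    using finite_cells_meeting_compact[OF K] finite_restrictions_cell[OF x] by (intro finite_PiE) auto
  moreover have "(\<lambda>g. restrict g K) ` ?H \<subseteq> (\<lambda>d. \<lambda>y\<in>K. d (SOME C. C \<in> ?D \<and> y \<in> C) y) ` (\<Pi>\<^sub>E C\<in>?D. (\<lambda>g. restrict g C) ` ?H)"
  proof clarify
    fix g assume g: "g \<in> Aut" "z = g x"
    show "restrict g K \<in> (\<lambda>d. \<lambda>y\<in>K. d (SOME C. C \<in> ?D \<and> y \<in> C) y) ` (\<Pi>\<^sub>E C\<in>?D. (\<lambda>f. restrict f C) ` {f \<in> Aut. f x = g x})"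
    proof (rule image_eqI[where x = "\<lambda>C\<in>?D. restrict g C"])
      show "restrict g K = (\<lambda>y\<in>K. (\<lambda>C\<in>?D. restrict g C) (SOME C. C \<in> ?D \<and> y \<in> C) y)"
      proof
        fix y
        show "restrict g K y = (\<lambda>y\<in>K. (\<lambda>C\<in>?D. restrict g C) (SOME C. C \<in> ?D \<and> y \<in> C) y) y"
        proof (cases "y \<in> K")
          case True
          then obtain C where "C \<in> ?D \<and> y \<in> C" using in_some_cell[of y] K(2) by blast
          then have "(SOME C. C \<in> ?D \<and> y \<in> C) \<in> ?D \<and> y \<in> (SOME C. C \<in> ?D \<and> y \<in> C)"
            by (rule someI)
          then show ?thesis using True by simp
        qed simp
      qed
      show "(\<lambda>C\<in>?D. restrict g C) \<in> (\<Pi>\<^sub>E C\<in>?D. (\<lambda>f. restrict f C) ` {f \<in> Aut. f x = g x})"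
        using g by auto
    qed
  qed
  ultimately show ?thesis by (rule finite_surj)
qed

lemma finite_orbit:
  assumes "x \<in> Y" "y \<in> Y"
  shows "finite ((\<lambda>g. g y) ` {g \<in> Aut. g x = z})"
proof -
  have "(\<lambda>g. g y) ` {g \<in> Aut. g x = z} = (\<lambda>r. r y) ` (\<lambda>g. restrict g {y}) ` {g \<in> Aut. g x = z}"
    by (force simp: image_image)
  then show ?thesis using finite_restrictions[OF assms(1), of "{y}" z] assms(2) by simp
qed

end


section \<open>The topology of the automorphism group\<close>

context salvetti_cover
begin

lemma empty_simplex: "{} \<in> L"
  using simplicial unfolding simplicial_complex_def by blast

lemma vertex_exists: obtains y where "y \<in> Y" "p y = 1"
proof -
  have "1 \<in> salvetti L"
    using empty_simplex unfolding salvetti_iff[OF simplicial] by simp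
  then show thesis using image_p that by (metis imageE)
qed

text \<open>A vertex is a cube with a single point, and so is its isometric image.\<close>

lemma Aut_vertex:
  assumes f: "f \<in> Aut" and y: "y \<in> Y" "p y = 1"
  shows "p (f y) = 1"
proof -
  have t0: "torus_map 0 = (1 :: complex ^ 'v)" by (simp add: vec_eq_iff)
  have u: "unit_cube {} = {0 :: real ^ 'v}"
    by (auto simp: unit_cube_def vec_eq_iff)
  obtain \<phi> where \<phi>: "cube {} \<phi>" "\<phi> 0 = y"
    using cube_lift_exists[OF empty_simplex unit_cube_zero y(1)] y(2) t0 by auto
  obtain \<tau> \<psi> \<iota> where \<psi>: "cube \<tau> \<psi>" "cube_isometry {} \<tau> \<iota>" "\<And>x. x \<in> unit_cube {} \<Longrightarrow> f (\<phi> x) = \<psi> (\<iota> x)"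
    using Aut_cube[OF f \<phi>(1)] by blast
  have "unit_cube \<tau> = {\<iota> 0}" using \<psi>(2) unfolding cube_isometry_def u by simp
  then have "\<iota> 0 = 0" using unit_cube_zero[of \<tau>] by auto
  then have "f y = \<psi> 0" using \<psi>(3)[of 0] \<phi>(2) u by simp
  then show ?thesis using cubeD(5)[OF \<psi>(1) unit_cube_zero] t0 by simp
qed

lemma fibre_discrete:
  assumes "y \<in> Y"
  obtains \<epsilon> where "\<epsilon> > 0" "\<And>z. \<lbrakk>z \<in> Y; p z = p y; dist y z < \<epsilon>\<rbrakk> \<Longrightarrow> z = y"
proof -
  obtain T U q where T: "y \<in> T" "openin (top_of_set Y) T" and q: "homeomorphism T U p q"
    using covering_space_local_homeomorphism[OF covering assms] by metis
  then obtain \<epsilon> where "\<epsilon> > 0" "ball y \<epsilon> \<inter> Y \<subseteq> T"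
    by (auto simp: openin_contains_ball)
  then have "z = y" if "z \<in> Y" "p z = p y" "dist y z < \<epsilon>" for z
    using that T(1) homeomorphism_apply1[OF q, of y] homeomorphism_apply1[OF q, of z] by auto
  then show thesis using that \<open>\<epsilon> > 0\<close> by blast
qed

text \<open>The basic neighbourhoods of \<open>f\<close>, see \<open>openin_aut_topology\<close>.\<close>

definition agreeing :: "('y \<Rightarrow> 'y) \<Rightarrow> 'y set \<Rightarrow> ('y \<Rightarrow> 'y) set" where
  "agreeing f P = {g \<in> Aut. \<forall>y\<in>P. g y = f y}"

text \<open>Uniform closeness on a compact set can be replaced by equality at finitely many points. An
  automorphism close to \<open>f\<close> at a vertex agrees with \<open>f\<close> there, because vertices are sent to vertices and
  these are isolated from each other; then there are only finitely many possibilities for its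
  values on a given compact set, so closeness to \<open>f\<close> means equality.\<close>

lemma openin_aut_topology:
  "openin (aut_topology L Y p) U \<longleftrightarrow>
     U \<subseteq> Aut \<and> (\<forall>f\<in>U. \<exists>P. finite P \<and> P \<subseteq> Y \<and> agreeing f P \<subseteq> U)"
proof -
  have "(\<exists>P. finite P \<and> P \<subseteq> Y \<and> agreeing f P \<subseteq> U) \<longleftrightarrow>
      (\<exists>K \<epsilon>. compact K \<and> K \<subseteq> Y \<and> \<epsilon> > 0 \<and> {g \<in> Aut. \<forall>x\<in>K. dist (f x) (g x) < \<epsilon>} \<subseteq> U)"
    if f: "f \<in> Aut" for f
  proof
    assume "\<exists>P. finite P \<and> P \<subseteq> Y \<and> agreeing f P \<subseteq> U"
    then obtain P where P: "finite P" "P \<subseteq> Y" "agreeing f P \<subseteq> U" by blast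
    obtain v where v: "v \<in> Y" "p v = 1" by (rule vertex_exists)
    obtain \<epsilon>0 where \<epsilon>0: "\<epsilon>0 > 0" "\<And>z. \<lbrakk>z \<in> Y; p z = p (f v); dist (f v) z < \<epsilon>0\<rbrakk> \<Longrightarrow> z = f v"
      using fibre_discrete[OF AutD(5)[OF f v(1)]] by blast
    have "\<forall>x\<in>P. \<exists>\<epsilon>>0. \<forall>z\<in>(\<lambda>g. g x) ` {g \<in> Aut. g v = f v}. z \<noteq> f x \<longrightarrow> \<epsilon> \<le> dist (f x) z"
      using finite_orbit[OF v(1)] P(2) by (intro ballI finite_set_avoid) auto
    then obtain \<epsilon> where \<epsilon>: "\<And>x. x \<in> P \<Longrightarrow> \<epsilon> x > 0"
      "\<And>x g. \<lbrakk>x \<in> P; g \<in> Aut; g v = f v; g x \<noteq> f x\<rbrakk> \<Longrightarrow> \<epsilon> x \<le> dist (f x) (g x)"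
      using bchoice[of P "\<lambda>x \<epsilon>. \<epsilon> > 0 \<and> (\<forall>z\<in>(\<lambda>g. g x) ` {g \<in> Aut. g v = f v}. z \<noteq> f x \<longrightarrow> \<epsilon> \<le> dist (f x) z)"]
      by blast
    \<comment> \<open>\<open>\<epsilon>0\<close> fixes the value at the vertex \<open>v\<close>, and the \<open>\<epsilon> x\<close> then fix the values at the points \<open>x\<close> of \<open>P\<close>.\<close>
    define \<delta> where "\<delta> = Min (insert \<epsilon>0 (\<epsilon> ` P))"
    have \<delta>: "\<delta> > 0" "\<delta> \<le> \<epsilon>0" "\<And>x. x \<in> P \<Longrightarrow> \<delta> \<le> \<epsilon> x"
      using P(1) \<epsilon>0(1) \<epsilon>(1) by (auto simp: \<delta>_def)
    have "{g \<in> Aut. \<forall>x\<in>insert v P. dist (f x) (g x) < \<delta>} \<subseteq> agreeing f P"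
    proof
      fix g assume "g \<in> {g \<in> Aut. \<forall>x\<in>insert v P. dist (f x) (g x) < \<delta>}"
      then have g: "g \<in> Aut" "dist (f v) (g v) < \<delta>" "\<And>x. x \<in> P \<Longrightarrow> dist (f x) (g x) < \<delta>" by auto
      have gv: "g v = f v"
        using \<epsilon>0(2)[of "g v"] AutD(5)[OF g(1) v(1)] Aut_vertex[OF g(1) v] Aut_vertex[OF f v] g(2) \<delta>(2) by simp
      have "g x = f x" if "x \<in> P" for x
        using \<epsilon>(2)[OF that g(1) gv] g(3)[OF that] \<delta>(3)[OF that] by fastforce
      then show "g \<in> agreeing f P" using g(1) by (simp add: agreeing_def)
    qed
    then show "\<exists>K \<epsilon>. compact K \<and> K \<subseteq> Y \<and> \<epsilon> > 0 \<and> {g \<in> Aut. \<forall>x\<in>K. dist (f x) (g x) < \<epsilon>} \<subseteq> U"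
      using P v(1) \<delta>(1) finite_imp_compact[of "insert v P"]
      by (intro exI[of _ "insert v P"] exI[of _ \<delta>]) auto
  next
    assume "\<exists>K \<epsilon>. compact K \<and> K \<subseteq> Y \<and> \<epsilon> > 0 \<and> {g \<in> Aut. \<forall>x\<in>K. dist (f x) (g x) < \<epsilon>} \<subseteq> U"
    then obtain K \<epsilon> where K: "compact K" "K \<subseteq> Y" "\<epsilon> > 0" "{g \<in> Aut. \<forall>x\<in>K. dist (f x) (g x) < \<epsilon>} \<subseteq> U" by blast
    obtain v where v: "v \<in> Y" "p v = 1" by (rule vertex_exists)
    obtain P where P: "finite P" "P \<subseteq> K"
      "\<And>g. \<lbrakk>g \<in> {g \<in> Aut. g v = f v}; \<And>y. y \<in> P \<Longrightarrow> g y = f y\<rbrakk> \<Longrightarrow> \<forall>y\<in>K. g y = f y"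
      using finite_restrictions_determined[OF finite_restrictions[OF v(1) K(1,2), of "f v"], of f] by blast
    have "agreeing f (insert v P) \<subseteq> U"
    proof
      fix g assume "g \<in> agreeing f (insert v P)"
      then have "g \<in> Aut" "g v = f v" "\<And>y. y \<in> P \<Longrightarrow> g y = f y" by (auto simp: agreeing_def)
      then show "g \<in> U" using P(3)[of g] K(3,4) by auto
    qed
    then show "\<exists>P. finite P \<and> P \<subseteq> Y \<and> agreeing f P \<subseteq> U"
      using P v(1) K(2) by (intro exI[of _ "insert v P"]) auto
  qed
  then show ?thesis
    unfolding aut_topology_def openin_compact_convergence_topology
    by (intro conj_cong refl ball_cong) (simp only: subset_iff)
qed

lemma topspace_aut [simp]: "topspace (aut_topology L Y p) = Aut"
  by (simp add: aut_topology_def)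

lemma openin_agreeing: "finite P \<Longrightarrow> P \<subseteq> Y \<Longrightarrow> openin (aut_topology L Y p) (agreeing f P)"
  unfolding openin_aut_topology agreeing_def by fastforce

lemma compact_neighbourhood:
  assumes "y \<in> Y"
  obtains U K where "openin (top_of_set Y) U" "y \<in> U" "U \<subseteq> K" "compact K" "K \<subseteq> Y"
proof -
  obtain U where U: "openin (top_of_set Y) U" "y \<in> U" "\<And>C. \<lbrakk>C \<in> cells; C \<inter> U \<noteq> {}\<rbrakk> \<Longrightarrow> y \<in> C"
    using cells_locally_finite[OF assms] by blast
  let ?K = "\<Union>{C \<in> cells. y \<in> C}"
  have "U \<subseteq> ?K"
  proof
    fix z assume z: "z \<in> U"
    then have "z \<in> Y" using U(1) openin_imp_subset by blast
    then obtain C where "C \<in> cells" "z \<in> C" by (rule in_some_cell)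
    then show "z \<in> ?K" using U(3)[of C] z by blast
  qed
  moreover have "compact ?K" using finite_cells_at cellD(2) by (intro compact_Union) auto
  moreover have "?K \<subseteq> Y" using cellD(1) by blast
  ultimately show thesis using that U(1,2) by blast
qed

lemma continuous_on_if_eq_on_compacts:
  assumes "\<And>K. \<lbrakk>compact K; K \<subseteq> Y\<rbrakk> \<Longrightarrow> \<exists>g. continuous_on Y g \<and> (\<forall>y\<in>K. g y = h y)"
  shows "continuous_on Y h"
  unfolding continuous_on_eq_continuous_within
proof
  fix y assume y: "y \<in> Y"
  obtain U K where U: "openin (top_of_set Y) U" "y \<in> U" "U \<subseteq> K" and K: "compact K" "K \<subseteq> Y"
    using compact_neighbourhood[OF y] by blast
  obtain g where g: "continuous_on Y g" "\<And>z. z \<in> K \<Longrightarrow> g z = h z" using assms[OF K] by blast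
  show "continuous (at y within Y) h"
  proof (rule continuous_transform_within_openin[OF _ U(1,2)])
    show "continuous (at y within Y) g" using g(1) y by (simp add: continuous_on_eq_continuous_within)
    show "g z = h z" if "z \<in> U" for z using g(2) U(3) that by blast
  qed
qed

lemma pointwise_limit_agrees_on_compact:
  assumes x: "x \<in> Y" and K: "compact K" "K \<subseteq> Y"
    and lim: "\<And>P. \<lbrakk>finite P; P \<subseteq> Y\<rbrakk> \<Longrightarrow> \<exists>g\<in>Aut. g x = z \<and> (\<forall>y\<in>P. g y = h y)"
  obtains g where "g \<in> Aut" "g x = z" "\<And>y. y \<in> K \<Longrightarrow> g y = h y"
proof -
  obtain P where P: "finite P" "P \<subseteq> K"
    "\<And>g. \<lbrakk>g \<in> {g \<in> Aut. g x = z}; \<And>y. y \<in> P \<Longrightarrow> g y = h y\<rbrakk> \<Longrightarrow> \<forall>y\<in>K. g y = h y"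
    using finite_restrictions_determined[OF finite_restrictions[OF x K, of z], of h] by blast
  obtain g where "g \<in> Aut" "g x = z" "\<forall>y\<in>P. g y = h y" using lim[OF P(1)] P(2) K(2) by blast
  then show thesis using that[of g] P(3)[of g] by blast
qed

text \<open>By \<open>finite_restrictions\<close>, such a limit coincides with automorphisms on arbitrary compact sets, and
  continuity and the condition on cubes can be checked on compact sets. The inverse of the limit is
  a limit of the inverses.\<close>

lemma pointwise_limit_in_Aut:
  assumes x: "x \<in> Y" and z: "z \<in> Y" and ext: "h \<in> extensional Y"
    and lim: "\<And>P. \<lbrakk>finite P; P \<subseteq> Y\<rbrakk> \<Longrightarrow> \<exists>g\<in>Aut. g x = z \<and> (\<forall>y\<in>P. g y = h y)"
  shows "h \<in> Aut"
proof -
  let ?inv = "\<lambda>g. inv\<^bsub>aut_group L Y p\<^esub> g"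
  interpret G: group "aut_group L Y p" by (rule group_aut)
  note agree = pointwise_limit_agrees_on_compact[OF x _ _ lim]
  have maps: "h y \<in> Y" if "y \<in> Y" for y
  proof -
    obtain g where "g \<in> Aut" "g y = h y" using lim[of "{y}"] \<open>y \<in> Y\<close> by auto
    then show ?thesis using AutD(5)[of g y] that by simp
  qed
  have inj: "inj_on h Y"
  proof (rule inj_onI)
    fix a b assume ab: "a \<in> Y" "b \<in> Y" "h a = h b"
    then obtain g where "g \<in> Aut" "g a = h a" "g b = h b" using lim[of "{a, b}"] by auto
    then show "a = b" using ab AutD(3)[of g] by (metis bij_betw_def inj_onD)
  qed
  have "Y \<subseteq> h ` Y"
  proof
    fix y assume y: "y \<in> Y"
    let ?B = "(\<lambda>g. g y) ` {g \<in> Aut. g z = x}"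
    have B: "finite ?B" "?B \<subseteq> Y" using finite_orbit[OF z y] AutD(5)[OF _ y] by blast+
    obtain g where g: "g \<in> Aut" "g x = z" "\<forall>y\<in>?B. g y = h y" using lim[OF B] by blast
    have "?inv g \<in> Aut" "?inv g z = x"
      using G.inv_closed[OF g(1)] g(2) inv_aut_eq_iff[OF g(1) z x] by simp_all
    then have "?inv g y \<in> ?B" by blast
    then have "g (?inv g y) = h (?inv g y)" by (rule g(3)[rule_format])
    then have "h (?inv g y) = y" using inv_aut_apply(2)[OF g(1) y] by simp
    then show "y \<in> h ` Y" using inv_aut_apply(1)[OF g(1) y] by (intro image_eqI) simp_all
  qed
  then have bij: "bij_betw h Y Y" using inj maps by (auto simp: bij_betw_def)
  let ?k = "inv_into Y h"
  have k: "?k y \<in> Y" "h (?k y) = y" if "y \<in> Y" for y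
    using that bij by (auto simp: bij_betw_def inv_into_into f_inv_into_f)
  have limk: "\<exists>g\<in>Aut. g z = x \<and> (\<forall>y\<in>P. g y = ?k y)" if "finite P" "P \<subseteq> Y" for P
  proof -
    have kP: "finite (?k ` P)" "?k ` P \<subseteq> Y" using that k(1) by blast+
    obtain g where g: "g \<in> Aut" "g x = z" "\<forall>y\<in>?k ` P. g y = h y"
      using lim[OF kP] by blast
    have "?inv g \<in> Aut" "?inv g z = x"
      using G.inv_closed[OF g(1)] g(2) inv_aut_eq_iff[OF g(1) z x] by simp_all
    moreover have "?inv g y = ?k y" if "y \<in> P" for y
    proof -
      have "y \<in> Y" using that \<open>P \<subseteq> Y\<close> by blast
      moreover have "g (?k y) = h (?k y)" using g(3) that by blast
      ultimately show ?thesis using inv_aut_eq_iff[OF g(1), of y "?k y"] k[of y] by simp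
    qed
    ultimately show ?thesis by blast
  qed
  have "continuous_on Y h"
    by (rule continuous_on_if_eq_on_compacts) (metis agree AutD(4))
  moreover have "continuous_on Y ?k"
    by (rule continuous_on_if_eq_on_compacts) (metis pointwise_limit_agrees_on_compact[OF z _ _ limk] AutD(4))
  ultimately have "homeomorphism Y Y h ?k"
    using maps k inj by (intro homeomorphismI) auto
  moreover have "\<exists>\<tau> \<psi> \<iota>. cube \<tau> \<psi> \<and> cube_isometry \<sigma> \<tau> \<iota> \<and> (\<forall>x\<in>unit_cube \<sigma>. h (\<phi> x) = \<psi> (\<iota> x))"
    if \<phi>: "cube \<sigma> \<phi>" for \<sigma> \<phi>
  proof -
    have "\<phi> ` unit_cube \<sigma> \<in> cells" using \<phi> by (auto simp: cells_def)
    then obtain g where g: "g \<in> Aut" "\<And>y. y \<in> \<phi> ` unit_cube \<sigma> \<Longrightarrow> g y = h y"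
      using agree[OF cellD(2) cellD(1)] by metis
    then show ?thesis using Aut_cube[OF g(1) \<phi>] by (metis imageI)
  qed
  ultimately show ?thesis
    unfolding Aut_iff using ext bij by (auto simp: Bij_def)
qed

text \<open>The topology of \<open>Aut\<close> is inherited from the product of copies of the discrete space \<open>Y\<close>, indexed
  by \<open>Y\<close>. By \<open>finite_orbit\<close> the given set lies in a product of finite sets, and it is closed by
  \<open>pointwise_limit_in_Aut\<close>.\<close>

lemma compactin_transporter:
  assumes x: "x \<in> Y" and z: "z \<in> Y"
  shows "compactin (aut_topology L Y p) {g \<in> Aut. g x = z}"
proof -
  let ?A = "{g \<in> Aut. g x = z}"
  let ?\<Pi> = "product_topology (\<lambda>_. discrete_topology UNIV) Y :: ('y \<Rightarrow> 'y) topology"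
  let ?box = "\<lambda>f P. Pi\<^sub>E Y (\<lambda>y. if y \<in> P then {f y} else UNIV)"
  have top\<Pi>: "topspace ?\<Pi> = extensional Y"
    by (auto simp: PiE_def)
  have box: "openin ?\<Pi> (?box f P)" if "finite P" for f P
  proof -
    have "finite {i \<in> Y. (if i \<in> P then {f i} else UNIV) \<noteq> topspace (discrete_topology (UNIV :: 'y set))}"
      by (rule finite_subset[OF _ that]) auto
    then show ?thesis by (simp add: openin_PiE_gen)
  qed
  have "aut_topology L Y p = subtopology ?\<Pi> Aut"
    unfolding topology_eq
  proof (intro allI iffI)
    fix U assume U: "openin (aut_topology L Y p) U"
    then have ex: "\<forall>f\<in>U. \<exists>P. finite P \<and> P \<subseteq> Y \<and> agreeing f P \<subseteq> U" and sub: "U \<subseteq> Aut"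
      unfolding openin_aut_topology by blast+
    from bchoice[OF ex] obtain P where "\<forall>f\<in>U. finite (P f) \<and> P f \<subseteq> Y \<and> agreeing f (P f) \<subseteq> U" ..
    then have P: "\<And>f. f \<in> U \<Longrightarrow> finite (P f) \<and> P f \<subseteq> Y \<and> agreeing f (P f) \<subseteq> U" by simp
    have "openin ?\<Pi> (\<Union>f\<in>U. ?box f (P f))" using P box by (intro openin_Union) auto
    moreover have "U = (\<Union>f\<in>U. ?box f (P f)) \<inter> Aut"
    proof (intro equalityI subsetI)
      fix f assume "f \<in> U"
      then show "f \<in> (\<Union>f\<in>U. ?box f (P f)) \<inter> Aut"
        using sub AutD(2)[of f] by (auto simp: PiE_def Pi_def)
    next
      fix g assume "g \<in> (\<Union>f\<in>U. ?box f (P f)) \<inter> Aut"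
      then obtain f where f: "f \<in> U" "g \<in> ?box f (P f)" "g \<in> Aut" by blast
      have "g y = f y" if "y \<in> P f" for y
        using PiE_mem[OF f(2), of y] that P[OF f(1)] by auto
      then have "g \<in> agreeing f (P f)" using f(3) by (simp add: agreeing_def)
      then show "g \<in> U" using P[OF f(1)] by blast
    qed
    ultimately show "openin (subtopology ?\<Pi> Aut) U" unfolding openin_subtopology by blast
  next
    fix U assume "openin (subtopology ?\<Pi> Aut) U"
    then obtain W where W: "openin ?\<Pi> W" "U = W \<inter> Aut" unfolding openin_subtopology by blast
    show "openin (aut_topology L Y p) U"
      unfolding openin_aut_topology
    proof (intro conjI ballI)
      show "U \<subseteq> Aut" using W by blast
      fix f assume "f \<in> U"
      then have "f \<in> W" using W by blast
      then obtain B where B: "finite {i \<in> Y. B i \<noteq> UNIV}" "f \<in> Pi\<^sub>E Y B" "Pi\<^sub>E Y B \<subseteq> W"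
        using W(1)[unfolded openin_product_topology_alt, rule_format, OF \<open>f \<in> W\<close>] by (auto simp only: topspace_discrete_topology)
      have "agreeing f {i \<in> Y. B i \<noteq> UNIV} \<subseteq> U"
      proof
        fix g assume "g \<in> agreeing f {i \<in> Y. B i \<noteq> UNIV}"
        then have g: "g \<in> Aut" "\<And>i. i \<in> Y \<Longrightarrow> B i \<noteq> UNIV \<Longrightarrow> g i = f i" by (auto simp: agreeing_def)
        have "g i \<in> B i" if "i \<in> Y" for i
          using g(2)[OF that] PiE_mem[OF B(2) that] by (cases "B i = UNIV") auto
        then have "g \<in> Pi\<^sub>E Y B" using AutD(2)[OF g(1)] by (simp add: PiE_iff)
        then show "g \<in> U" using B(3) W(2) g(1) by blast
      qed
      then show "\<exists>P. finite P \<and> P \<subseteq> Y \<and> agreeing f P \<subseteq> U" using B(1) by blast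
    qed
  qed
  moreover have "compactin ?\<Pi> ?A"
  proof (rule closed_compactin)
    show "compactin ?\<Pi> (Pi\<^sub>E Y (\<lambda>y. (\<lambda>g. g y) ` ?A))"
      using finite_orbit[OF x] by (simp add: compactin_PiE compactin_discrete_topology)
    show "?A \<subseteq> Pi\<^sub>E Y (\<lambda>y. (\<lambda>g. g y) ` ?A)"
    proof
      fix g assume "g \<in> ?A"
      then show "g \<in> Pi\<^sub>E Y (\<lambda>y. (\<lambda>g. g y) ` ?A)" using AutD(2)[of g] unfolding PiE_iff by blast
    qed
    show "closedin ?\<Pi> ?A"
      unfolding closedin_def
    proof
      show "?A \<subseteq> topspace ?\<Pi>" unfolding top\<Pi> using AutD(2) by blast
      show "openin ?\<Pi> (topspace ?\<Pi> - ?A)"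
      proof (subst openin_subopen, intro ballI)
        fix h assume "h \<in> topspace ?\<Pi> - ?A"
        then have h: "h \<in> extensional Y" "h \<notin> ?A" unfolding top\<Pi> by auto
        have "\<exists>P. finite P \<and> P \<subseteq> Y \<and> \<not> (\<exists>g\<in>Aut. g x = z \<and> (\<forall>y\<in>P. g y = h y))"
        proof (rule ccontr)
          assume *: "\<not> ?thesis"
          then have "h \<in> Aut" by (intro pointwise_limit_in_Aut[OF x z h(1)]) blast
          moreover have "h x = z" using * x by (metis bot_least finite.emptyI finite.insertI insertI1 insert_subset)
          ultimately show False using h(2) by blast
        qed
        then obtain P where P: "finite P" "P \<subseteq> Y" "\<And>g. \<lbrakk>g \<in> Aut; g x = z\<rbrakk> \<Longrightarrow> \<exists>y\<in>P. g y \<noteq> h y" by blast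
        have "h \<in> ?box h P" using h(1) by (auto simp: PiE_iff)
        moreover have "?box h P \<subseteq> topspace ?\<Pi> - ?A"
        proof
          fix g assume g: "g \<in> ?box h P"
          have "g y = h y" if "y \<in> P" for y using PiE_mem[OF g, of y] that P(2) by auto
          then have "g \<notin> ?A" using P(3)[of g] by blast
          moreover have "g \<in> extensional Y" using g by (simp add: PiE_iff)
          ultimately show "g \<in> topspace ?\<Pi> - ?A" unfolding top\<Pi> by blast
        qed
        ultimately show "\<exists>T. openin ?\<Pi> T \<and> h \<in> T \<and> T \<subseteq> topspace ?\<Pi> - ?A" using box[OF P(1)] by blast
      qed
    qed
  qed
  ultimately show ?thesis by (simp add: compactin_subtopology)
qed

theorem locally_compact_group_aut: "locally_compact_group (aut_group L Y p) (aut_topology L Y p)"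
proof -
  let ?T = "aut_topology L Y p" and ?G = "aut_group L Y p"
  interpret G: group ?G by (rule group_aut)
  have "continuous_map (prod_topology ?T ?T) ?T (\<lambda>(f, g). f \<otimes>\<^bsub>?G\<^esub> g)"
    unfolding continuous_map_def
  proof (intro conjI allI impI)
    show "(\<lambda>(f, g). f \<otimes>\<^bsub>?G\<^esub> g) \<in> topspace (prod_topology ?T ?T) \<rightarrow> topspace ?T"
      using G.m_closed by auto
    fix U assume U: "openin ?T U"
    show "openin (prod_topology ?T ?T) {x \<in> topspace (prod_topology ?T ?T). (case x of (f, g) \<Rightarrow> f \<otimes>\<^bsub>?G\<^esub> g) \<in> U}"
      unfolding openin_prod_topology_alt
    proof (intro allI impI)
      fix f g assume "(f, g) \<in> {x \<in> topspace (prod_topology ?T ?T). (case x of (f, g) \<Rightarrow> f \<otimes>\<^bsub>?G\<^esub> g) \<in> U}"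
      then have fg: "f \<in> Aut" "g \<in> Aut" "compose Y f g \<in> U" by auto
      then obtain P where P: "finite P" "P \<subseteq> Y" "agreeing (compose Y f g) P \<subseteq> U"
        using U unfolding openin_aut_topology by blast
      have gP: "g ` P \<subseteq> Y" using AutD(5)[OF fg(2)] P(2) by blast
      have "agreeing f (g ` P) \<times> agreeing g P \<subseteq>
          {x \<in> topspace (prod_topology ?T ?T). (case x of (f, g) \<Rightarrow> f \<otimes>\<^bsub>?G\<^esub> g) \<in> U}"
      proof
        fix x assume "x \<in> agreeing f (g ` P) \<times> agreeing g P"
        then obtain f' g' where x: "x = (f', g')" and *: "f' \<in> agreeing f (g ` P)" "g' \<in> agreeing g P" by blast
        then have A: "f' \<in> Aut" "g' \<in> Aut" by (auto simp: agreeing_def)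
        have "compose Y f' g' \<in> agreeing (compose Y f g) P"
          using * P(2) compose_Aut[OF A] by (auto simp: agreeing_def compose_def)
        then show "x \<in> {x \<in> topspace (prod_topology ?T ?T). (case x of (f, g) \<Rightarrow> f \<otimes>\<^bsub>?G\<^esub> g) \<in> U}"
          using A P(3) x by auto
      qed
      moreover have "f \<in> agreeing f (g ` P)" "g \<in> agreeing g P" using fg by (auto simp: agreeing_def)
      ultimately show "\<exists>V W. openin ?T V \<and> openin ?T W \<and> f \<in> V \<and> g \<in> W \<and>
          V \<times> W \<subseteq> {x \<in> topspace (prod_topology ?T ?T). (case x of (f, g) \<Rightarrow> f \<otimes>\<^bsub>?G\<^esub> g) \<in> U}"
        using openin_agreeing[of "g ` P" f] openin_agreeing[of P g] P gP by blast
    qed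
  qed
  moreover have "continuous_map ?T ?T (\<lambda>f. inv\<^bsub>?G\<^esub> f)"
    unfolding continuous_map_def
  proof (intro conjI allI impI)
    show "(\<lambda>f. inv\<^bsub>?G\<^esub> f) \<in> topspace ?T \<rightarrow> topspace ?T" by auto
    fix U assume U: "openin ?T U"
    show "openin ?T {f \<in> topspace ?T. inv\<^bsub>?G\<^esub> f \<in> U}"
      unfolding openin_aut_topology
    proof (intro conjI ballI)
      fix f assume "f \<in> {f \<in> topspace ?T. inv\<^bsub>?G\<^esub> f \<in> U}"
      then have f: "f \<in> Aut" "inv\<^bsub>?G\<^esub> f \<in> U" by auto
      then obtain P where P: "finite P" "P \<subseteq> Y" "agreeing (inv\<^bsub>?G\<^esub> f) P \<subseteq> U"
        using U unfolding openin_aut_topology by blast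
      let ?Q = "(inv\<^bsub>?G\<^esub> f) ` P"
      have Q: "?Q \<subseteq> Y" using inv_aut_apply(1)[OF f(1)] P(2) by blast
      have "agreeing f ?Q \<subseteq> {f \<in> topspace ?T. inv\<^bsub>?G\<^esub> f \<in> U}"
      proof
        fix g assume "g \<in> agreeing f ?Q"
        then have g: "g \<in> Aut" "\<And>y. y \<in> P \<Longrightarrow> g ((inv\<^bsub>?G\<^esub> f) y) = f ((inv\<^bsub>?G\<^esub> f) y)" by (auto simp: agreeing_def)
        have "(inv\<^bsub>?G\<^esub> g) y = (inv\<^bsub>?G\<^esub> f) y" if "y \<in> P" for y
          using that P(2) g(2)[OF that] inv_aut_apply[OF f(1), of y] inv_aut_eq_iff[OF g(1), of y] by auto
        then have "inv\<^bsub>?G\<^esub> g \<in> agreeing (inv\<^bsub>?G\<^esub> f) P" using g(1) by (auto simp: agreeing_def)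
        then show "g \<in> {f \<in> topspace ?T. inv\<^bsub>?G\<^esub> f \<in> U}" using P(3) g(1) by auto
      qed
      then show "\<exists>P. finite P \<and> P \<subseteq> Y \<and> agreeing f P \<subseteq> {f \<in> topspace ?T. inv\<^bsub>?G\<^esub> f \<in> U}"
        using P(1) Q by blast
    qed auto
  qed
  moreover have "Hausdorff_space ?T"
    unfolding Hausdorff_space_def
  proof (intro allI impI, elim conjE)
    fix f g assume "f \<in> topspace ?T" "g \<in> topspace ?T" "f \<noteq> g"
    then have fg: "f \<in> Aut" "g \<in> Aut" by auto
    then obtain y where y: "y \<in> Y" "f y \<noteq> g y" using Aut_eqI \<open>f \<noteq> g\<close> by blast
    then have "disjnt (agreeing f {y}) (agreeing g {y})" by (auto simp: agreeing_def disjnt_def)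
    moreover have "f \<in> agreeing f {y}" "g \<in> agreeing g {y}" using fg by (auto simp: agreeing_def)
    ultimately show "\<exists>U V. openin ?T U \<and> openin ?T V \<and> f \<in> U \<and> g \<in> V \<and> disjnt U V"
      using openin_agreeing[of "{y}"] y(1) by blast
  qed
  moreover have "locally_compact_space ?T"
    unfolding locally_compact_space_def
  proof
    fix f assume "f \<in> topspace ?T"
    then have f: "f \<in> Aut" by simp
    obtain y where y: "y \<in> Y" by (rule vertex_exists)
    have "agreeing f {y} = {g \<in> Aut. g y = f y}" by (auto simp: agreeing_def)
    then have "compactin ?T (agreeing f {y})" using compactin_transporter[OF y AutD(5)[OF f y]] by simp
    moreover have "f \<in> agreeing f {y}" using f by (simp add: agreeing_def)
    ultimately show "\<exists>U K. openin ?T U \<and> compactin ?T K \<and> f \<in> U \<and> U \<subseteq> K"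
      using openin_agreeing[of "{y}" f] y by blast
  qed
  ultimately show ?thesis
    unfolding locally_compact_group_def using group_aut by simp
qed

end


section \<open>Covolumes along a tower of uniform lattices\<close>

lemma r_coset_eq_preimage:
  assumes "group G" "g \<in> carrier G" "A \<subseteq> carrier G"
  shows "A #>\<^bsub>G\<^esub> g = {x \<in> carrier G. x \<otimes>\<^bsub>G\<^esub> inv\<^bsub>G\<^esub> g \<in> A}"
proof -
  interpret group G by fact
  show ?thesis
  proof (intro equalityI subsetI)
    fix x assume "x \<in> A #>\<^bsub>G\<^esub> g"
    then obtain a where a: "a \<in> A" "x = a \<otimes>\<^bsub>G\<^esub> g" unfolding r_coset_def by blast
    then show "x \<in> {x \<in> carrier G. x \<otimes>\<^bsub>G\<^esub> inv\<^bsub>G\<^esub> g \<in> A}"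
      using assms(2,3) by (auto simp: m_assoc subset_iff)
  next
    fix x assume "x \<in> {x \<in> carrier G. x \<otimes>\<^bsub>G\<^esub> inv\<^bsub>G\<^esub> g \<in> A}"
    then have "x \<otimes>\<^bsub>G\<^esub> inv\<^bsub>G\<^esub> g \<in> A" "x = (x \<otimes>\<^bsub>G\<^esub> inv\<^bsub>G\<^esub> g) \<otimes>\<^bsub>G\<^esub> g"
      using assms(2) by (auto simp: m_assoc)
    then show "x \<in> A #>\<^bsub>G\<^esub> g" unfolding r_coset_def by blast
  qed
qed

text \<open>The projection from \<open>A\<close> to the space of left cosets of \<open>\<Gamma>\<close> is injective.\<close>

definition inj_mod :: "('a, 'b) monoid_scheme \<Rightarrow> 'a set \<Rightarrow> 'a set \<Rightarrow> bool" where
  "inj_mod G \<Gamma> A \<longleftrightarrow> (\<forall>a\<in>A. \<forall>\<gamma>\<in>\<Gamma>. a \<otimes>\<^bsub>G\<^esub> \<gamma> \<in> A \<longrightarrow> a \<otimes>\<^bsub>G\<^esub> \<gamma> = a)"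

locale haar_group = group G for G (structure) +
  fixes T :: "'a topology" and \<mu> :: "'a measure"
  assumes lc: "locally_compact_group G T" and haar: "haar_measure G T \<mu>"
begin

lemma topspace_T: "topspace T = carrier G"
  using lc by (simp add: locally_compact_group_def)

lemma continuous_mult: "continuous_map (prod_topology T T) T (\<lambda>(x, y). x \<otimes> y)"
  and continuous_inv: "continuous_map T T (\<lambda>x. inv x)"
  using lc by (simp_all add: locally_compact_group_def)

lemma continuous_right_mult:
  assumes "g \<in> carrier G"
  shows "continuous_map T T (\<lambda>x. x \<otimes> g)"
proof -
  have "continuous_map T (prod_topology T T) (\<lambda>x. (x, g))"
    using assms by (intro continuous_map_pairedI) (auto simp: topspace_T)
  from continuous_map_compose[OF this continuous_mult] show ?thesis by (simp add: comp_def)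
qed

lemma openin_r_coset:
  assumes "openin T U" "g \<in> carrier G"
  shows "openin T (U #> g)"
proof -
  have "U \<subseteq> carrier G" using openin_subset[OF assms(1)] topspace_T by simp
  then have "U #> g = {x \<in> topspace T. x \<otimes> inv g \<in> U}"
    using r_coset_eq_preimage[OF group_axioms assms(2)] topspace_T by simp
  then show ?thesis
    using openin_continuous_map_preimage[OF continuous_right_mult[of "inv g"] assms(1)] assms(2) by simp
qed

lemma space_\<mu>: "space \<mu> = carrier G"
  and sets_\<mu>: "sets \<mu> = sigma_sets (carrier G) {U. openin T U}"
  and emeasure_r_coset: "A \<in> sets \<mu> \<Longrightarrow> g \<in> carrier G \<Longrightarrow> emeasure \<mu> (A #> g) = emeasure \<mu> A"
  and emeasure_compact: "compactin T K \<Longrightarrow> emeasure \<mu> K < \<infinity>"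
  using haar by (auto simp: haar_measure_def)

lemma open_in_sets: "openin T U \<Longrightarrow> U \<in> sets \<mu>"
  by (simp add: sets_\<mu> sigma_sets.Basic)

lemma sets_\<mu>_carrier: "A \<in> sets \<mu> \<Longrightarrow> A \<subseteq> carrier G"
  using sets.sets_into_space[of A \<mu>] space_\<mu> by simp

lemma r_coset_in_sets:
  assumes "A \<in> sets \<mu>" "g \<in> carrier G"
  shows "A #> g \<in> sets \<mu>"
proof -
  have "(\<lambda>x. x \<otimes> inv g) \<in> measurable \<mu> \<mu>"
  proof (rule measurable_sigma_sets[OF sets_\<mu>])
    show "{U. openin T U} \<subseteq> Pow (carrier G)"
      using openin_subset topspace_T by fastforce
    show "(\<lambda>x. x \<otimes> inv g) \<in> space \<mu> \<rightarrow> carrier G"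
      using assms(2) by (simp add: space_\<mu>)
    fix U assume "U \<in> {U. openin T U}"
    then have "openin T {x \<in> topspace T. x \<otimes> inv g \<in> U}"
      using openin_continuous_map_preimage[OF continuous_right_mult[of "inv g"]] assms(2) by simp
    moreover have "(\<lambda>x. x \<otimes> inv g) -` U \<inter> space \<mu> = {x \<in> topspace T. x \<otimes> inv g \<in> U}"
      by (auto simp: space_\<mu> topspace_T)
    ultimately show "(\<lambda>x. x \<otimes> inv g) -` U \<inter> space \<mu> \<in> sets \<mu>"
      by (simp only: open_in_sets)
  qed
  then have "(\<lambda>x. x \<otimes> inv g) -` A \<inter> space \<mu> \<in> sets \<mu>"
    using assms(1) by (rule measurable_sets)
  moreover have "A #> g = (\<lambda>x. x \<otimes> inv g) -` A \<inter> space \<mu>"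
    unfolding r_coset_eq_preimage[OF group_axioms assms(2) sets_\<mu>_carrier[OF assms(1)]] by (auto simp: space_\<mu>)
  ultimately show ?thesis by simp
qed

text \<open>Cut \<open>A\<close> into countably many pieces that translations by elements of \<open>\<Gamma>\<close> move into \<open>B\<close>. The
  translated pieces remain disjoint because no coset contains two points of \<open>A\<close>. All comparisons of
  covolumes below are instances of this.\<close>

lemma emeasure_inj_mod_le_covering:
  assumes \<Gamma>: "subgroup \<Gamma> G" "countable \<Gamma>" and A: "A \<in> sets \<mu>" and B: "B \<in> sets \<mu>"
    and inj: "inj_mod G \<Gamma> A" and cover: "\<And>g. g \<in> A \<Longrightarrow> \<exists>\<gamma>\<in>\<Gamma>. g \<otimes> \<gamma> \<in> B"
  shows "emeasure \<mu> A \<le> emeasure \<mu> B"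
proof -
  define c where "c = from_nat_into \<Gamma>"
  have "\<Gamma> \<noteq> {}" using \<Gamma>(1) subgroup.one_closed by blast
  then have rc: "range c = \<Gamma>" using \<Gamma>(2) by (simp add: c_def range_from_nat_into)
  then have c: "c n \<in> \<Gamma>" for n by blast
  have cG: "c n \<in> carrier G" for n using c \<Gamma>(1) subgroup.mem_carrier by metis
  have AG: "A \<subseteq> carrier G" and BG: "B \<subseteq> carrier G" using A B sets_\<mu>_carrier by auto
  \<comment> \<open>The points of \<open>A\<close> that \<open>c n\<close> moves into \<open>B\<close>.\<close>
  define E where "E n = A \<inter> (B #> inv (c n))" for n
  have E: "E n \<in> sets \<mu>" for n
    unfolding E_def using A B r_coset_in_sets cG by (intro sets.Int) auto
  have memE: "a \<in> E n \<longleftrightarrow> a \<in> A \<and> a \<otimes> c n \<in> B" for a n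
    unfolding E_def r_coset_eq_preimage[OF group_axioms inv_closed[OF cG] BG] using AG cG by auto
  have D: "disjointed E n \<in> sets \<mu>" for n
    using sets.range_disjointed_sets[of E \<mu>] E by blast
  have UE: "(\<Union>n. disjointed E n) = A"
  proof -
    have "A \<subseteq> (\<Union>n. E n)" using cover rc memE by blast
    then show ?thesis unfolding UN_disjointed_eq using memE by blast
  qed
  have "emeasure \<mu> A = (\<Sum>n. emeasure \<mu> (disjointed E n))"
    using suminf_emeasure[of "disjointed E" \<mu>] D disjoint_family_disjointed UE by (metis image_subsetI)
  also have "\<dots> = (\<Sum>n. emeasure \<mu> (disjointed E n #> c n))"
    using emeasure_r_coset D cG by simp
  also have "\<dots> = emeasure \<mu> (\<Union>n. disjointed E n #> c n)"
  proof (rule suminf_emeasure)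
    show "range (\<lambda>n. disjointed E n #> c n) \<subseteq> sets \<mu>" using r_coset_in_sets D cG by blast
    show "disjoint_family (\<lambda>n. disjointed E n #> c n)"
      unfolding disjoint_family_on_def
    proof (intro ballI impI)
      fix m n :: nat assume "m \<noteq> n"
      show "(disjointed E m #> c m) \<inter> (disjointed E n #> c n) = {}"
      proof (rule ccontr)
        assume "\<not> ?thesis"
        then obtain a b where a: "a \<in> disjointed E m" and b: "b \<in> disjointed E n" and eq: "a \<otimes> c m = b \<otimes> c n"
          unfolding r_coset_def by auto
        have aA: "a \<in> A" and bA: "b \<in> A" using a b disjointed_subset[of E] memE by blast+
        have "b = a \<otimes> (c m \<otimes> inv (c n))"
          using eq aA bA AG cG by (metis inv_solve_right m_assoc m_closed inv_closed subsetD)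
        moreover have "c m \<otimes> inv (c n) \<in> \<Gamma>"
          using c \<Gamma>(1) by (simp add: subgroup.m_closed subgroup.m_inv_closed)
        ultimately have "b = a" using inj aA bA unfolding inj_mod_def by metis
        moreover have "disjointed E m \<inter> disjointed E n = {}"
          using disjoint_family_disjointed[of E] \<open>m \<noteq> n\<close> unfolding disjoint_family_on_def by blast
        ultimately show False using a b by blast
      qed
    qed
  qed
  also have "\<dots> \<le> emeasure \<mu> B"
  proof (rule emeasure_mono[OF _ B])
    show "(\<Union>n. disjointed E n #> c n) \<subseteq> B"
      unfolding r_coset_def using disjointed_subset[of E] memE by blast
  qed
  finally show ?thesis .
qed

lemma mem_l_coset: "x \<in> g <# \<Gamma> \<longleftrightarrow> (\<exists>\<gamma>\<in>\<Gamma>. x = g \<otimes> \<gamma>)"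
  by (auto simp: l_coset_def)

text \<open>Around each point there is an open set of finite measure on which \<open>(x, y) \<mapsto> x\<^sup>-\<^sup>1 y\<close> takes values in a
  neighbourhood of \<open>\<one>\<close> that meets \<open>\<Gamma>\<close> only in \<open>\<one>\<close>. The images of these sets cover the compact
  quotient, and finitely many suffice.\<close>

lemma uniform_lattice_finite_cover:
  assumes \<Gamma>: "uniform_lattice G T \<Gamma>"
  obtains \<W> where "finite \<W>"
    "\<forall>W\<in>\<W>. openin T W \<and> inj_mod G \<Gamma> W \<and> emeasure \<mu> W < \<infinity>"
    "\<forall>g\<in>carrier G. \<exists>W\<in>\<W>. \<exists>\<gamma>\<in>\<Gamma>. g \<otimes> \<gamma> \<in> W"
proof -
  have sub: "subgroup \<Gamma> G" and disc: "subtopology T \<Gamma> = discrete_topology \<Gamma>" and coc: "cocompact G T \<Gamma>"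
    using \<Gamma> by (auto simp: uniform_lattice_def)
  have \<Gamma>G: "\<gamma> \<in> carrier G" if "\<gamma> \<in> \<Gamma>" for \<gamma> using sub that subgroup.mem_carrier by metis
  have "openin (subtopology T \<Gamma>) {\<one>}"
    unfolding disc using subgroup.one_closed[OF sub] by simp
  then obtain V where V: "openin T V" "{\<one>} = V \<inter> \<Gamma>" unfolding openin_subtopology by metis
  have ex: "\<exists>W. openin T W \<and> g \<in> W \<and> inj_mod G \<Gamma> W \<and> emeasure \<mu> W < \<infinity>" if g: "g \<in> carrier G" for g
  proof -
    have "continuous_map (prod_topology T T) T (\<lambda>z. inv (fst z))"
      using continuous_map_compose[OF continuous_map_fst continuous_inv] by (simp add: comp_def)
    then have "continuous_map (prod_topology T T) (prod_topology T T) (\<lambda>z. (inv (fst z), snd z))"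
      by (intro continuous_map_pairedI continuous_map_snd)
    from continuous_map_compose[OF this continuous_mult]
    have "continuous_map (prod_topology T T) T (\<lambda>z. inv (fst z) \<otimes> snd z)" by (simp add: comp_def)
    then have pre: "openin (prod_topology T T) {z \<in> topspace (prod_topology T T). inv (fst z) \<otimes> snd z \<in> V}"
      using V(1) by (rule openin_continuous_map_preimage)
    have gg: "(g, g) \<in> {z \<in> topspace (prod_topology T T). inv (fst z) \<otimes> snd z \<in> V}"
      using g V(2) topspace_T by auto
    obtain W1 W2 where W: "openin T W1" "openin T W2" "g \<in> W1" "g \<in> W2"
      "W1 \<times> W2 \<subseteq> {z \<in> topspace (prod_topology T T). inv (fst z) \<otimes> snd z \<in> V}"
      using pre[unfolded openin_prod_topology_alt, rule_format, OF gg] by (elim exE conjE)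
    obtain U K where U: "openin T U" "compactin T K" "g \<in> U" "U \<subseteq> K"
      using lc g topspace_T unfolding locally_compact_group_def locally_compact_space_def by metis
    have "inj_mod G \<Gamma> (W1 \<inter> W2 \<inter> U)"
      unfolding inj_mod_def
    proof (intro ballI impI)
      fix a \<gamma> assume a: "a \<in> W1 \<inter> W2 \<inter> U" "\<gamma> \<in> \<Gamma>" "a \<otimes> \<gamma> \<in> W1 \<inter> W2 \<inter> U"
      have aG: "a \<in> carrier G" using a(1) U(1) openin_subset topspace_T by blast
      have "inv a \<otimes> (a \<otimes> \<gamma>) \<in> V" using W(5) a by auto
      then have "\<gamma> \<in> V" using aG \<Gamma>G[OF a(2)] by (simp add: m_assoc[symmetric])
      then have "\<gamma> = \<one>" using V(2) a(2) by blast
      then show "a \<otimes> \<gamma> = a" using aG by simp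
    qed
    moreover have "emeasure \<mu> (W1 \<inter> W2 \<inter> U) < \<infinity>"
    proof -
      have "closedin T K" using lc U(2) by (simp add: locally_compact_group_def compactin_imp_closedin)
      then have "carrier G - (topspace T - K) \<in> sets \<mu>"
        using sets.compl_sets[of "topspace T - K" \<mu>] open_in_sets[of "topspace T - K"]
        by (simp add: closedin_def space_\<mu>)
      moreover have "carrier G - (topspace T - K) = K"
        using closedin_subset[OF \<open>closedin T K\<close>] topspace_T by blast
      ultimately have "emeasure \<mu> (W1 \<inter> W2 \<inter> U) \<le> emeasure \<mu> K"
        using U(4) by (intro emeasure_mono) auto
      then show ?thesis using emeasure_compact[OF U(2)] by (rule le_less_trans)
    qed
    moreover have "openin T (W1 \<inter> W2 \<inter> U)" using W U by blast
    ultimately show ?thesis using W(3,4) U(3) by blast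
  qed
  obtain W where W: "\<And>g. g \<in> carrier G \<Longrightarrow> openin T (W g) \<and> g \<in> W g \<and> inj_mod G \<Gamma> (W g) \<and> emeasure \<mu> (W g) < \<infinity>"
    using bchoice[of "carrier G" "\<lambda>g W. openin T W \<and> g \<in> W \<and> inj_mod G \<Gamma> W \<and> emeasure \<mu> W < \<infinity>"] ex by blast
  let ?\<pi> = "\<lambda>g. g <# \<Gamma>"
  obtain Q where Q: "quotient_map T Q ?\<pi>" "compact_space Q" using coc by (auto simp: cocompact_def)
  have top_Q: "topspace Q = ?\<pi> ` carrier G" using Q(1) topspace_T by (simp add: quotient_map_def)
  have same: "?\<pi> x = ?\<pi> w \<longleftrightarrow> (\<exists>\<gamma>\<in>\<Gamma>. x = w \<otimes> \<gamma>)" if "x \<in> carrier G" "w \<in> carrier G" for x w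
  proof
    assume "?\<pi> x = ?\<pi> w"
    moreover have "x \<in> ?\<pi> x" using that subgroup.one_closed[OF sub] by (force simp: mem_l_coset)
    ultimately show "\<exists>\<gamma>\<in>\<Gamma>. x = w \<otimes> \<gamma>" by (simp add: mem_l_coset)
  next
    assume "\<exists>\<gamma>\<in>\<Gamma>. x = w \<otimes> \<gamma>"
    then have "x \<in> w <# \<Gamma>" by (simp add: mem_l_coset)
    then show "?\<pi> x = ?\<pi> w" using l_repr_independence[OF _ that(2) sub] by simp
  qed
  have open_image: "openin Q (?\<pi> ` W g)" if g: "g \<in> carrier G" for g
  proof -
    have WG: "W g \<subseteq> carrier G" using W[OF g] openin_subset topspace_T by metis
    have "{x \<in> topspace T. ?\<pi> x \<in> ?\<pi> ` W g} = (\<Union>\<gamma>\<in>\<Gamma>. W g #> \<gamma>)"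
    proof (intro equalityI subsetI)
      fix x assume "x \<in> {x \<in> topspace T. ?\<pi> x \<in> ?\<pi> ` W g}"
      then obtain w where "x \<in> carrier G" "w \<in> W g" "?\<pi> x = ?\<pi> w" using topspace_T by auto
      then show "x \<in> (\<Union>\<gamma>\<in>\<Gamma>. W g #> \<gamma>)" using same[of x w] WG by (auto simp: r_coset_def)
    next
      fix x assume "x \<in> (\<Union>\<gamma>\<in>\<Gamma>. W g #> \<gamma>)"
      then obtain \<gamma> w where x: "\<gamma> \<in> \<Gamma>" "w \<in> W g" "x = w \<otimes> \<gamma>" by (auto simp: r_coset_def)
      then have "w \<in> carrier G" "x \<in> carrier G" using WG \<Gamma>G by auto
      then have "?\<pi> x = ?\<pi> w" using same x by blast
      then show "x \<in> {x \<in> topspace T. ?\<pi> x \<in> ?\<pi> ` W g}" using x \<open>x \<in> carrier G\<close> topspace_T by auto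
    qed
    moreover have "openin T (\<Union>\<gamma>\<in>\<Gamma>. W g #> \<gamma>)"
      using W[OF g] \<Gamma>G openin_r_coset by (intro openin_Union) auto
    moreover have "?\<pi> ` W g \<subseteq> topspace Q" using WG top_Q by auto
    ultimately show ?thesis using Q(1) unfolding quotient_map_def by metis
  qed
  let ?\<U> = "(\<lambda>g. ?\<pi> ` W g) ` carrier G"
  have U_open: "\<forall>U\<in>?\<U>. openin Q U" using open_image by blast
  have "topspace Q \<subseteq> \<Union>?\<U>"
  proof
    fix q assume "q \<in> topspace Q"
    then obtain g where g: "g \<in> carrier G" "q = ?\<pi> g" unfolding top_Q by (elim imageE)
    have "?\<pi> g \<in> ?\<pi> ` W g" using W[OF g(1)] by (intro imageI) simp
    then show "q \<in> \<Union>?\<U>" using g by (intro UnionI[of "?\<pi> ` W g"] imageI) simp_all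
  qed
  moreover have "\<Union>?\<U> \<subseteq> topspace Q" using U_open by (intro Union_least openin_subset) (rule bspec)
  ultimately have "\<Union>?\<U> = topspace Q" by (rule subset_antisym[rotated])
  then obtain \<F> where F: "finite \<F>" "\<F> \<subseteq> ?\<U>" "\<Union>\<F> = topspace Q"
    using Q(2)[unfolded compact_space, rule_format, of ?\<U>] U_open by auto
  obtain S where S: "S \<subseteq> carrier G" "finite S" "\<F> = (\<lambda>g. ?\<pi> ` W g) ` S"
    using finite_subset_image[OF F(1,2)] by blast
  show thesis
  proof (rule that[of "W ` S"]; (intro ballI)?)
    show "finite (W ` S)" using S by simp
    show "openin T V \<and> inj_mod G \<Gamma> V \<and> emeasure \<mu> V < \<infinity>" if "V \<in> W ` S" for V
      using that W S(1) by blast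
    fix g assume g: "g \<in> carrier G"
    then have "?\<pi> g \<in> \<Union>\<F>" unfolding F(3) top_Q by (rule imageI)
    then obtain s w where s: "s \<in> S" "w \<in> W s" "?\<pi> w = ?\<pi> g" unfolding S(3) by auto
    have "W s \<subseteq> carrier G"
      using W[of s] s(1) S(1) openin_subset[of T "W s"] topspace_T by (simp add: subset_iff)
    then have "w \<in> carrier G" using s(2) by (rule subsetD)
    then obtain \<gamma> where "\<gamma> \<in> \<Gamma>" "w = g \<otimes> \<gamma>" using same[OF _ g] s(3) by auto
    then show "\<exists>V\<in>W ` S. \<exists>\<gamma>\<in>\<Gamma>. g \<otimes> \<gamma> \<in> V" using s by blast
  qed
qed

text \<open>Enumerate the finite cover and remove from each set the saturations of the earlier ones. The first
  set of the cover that meets a coset then contributes the only representative.\<close>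

lemma fundamental_domain_exists:
  assumes \<Gamma>: "uniform_lattice G T \<Gamma>"
  obtains F where "fundamental_domain G \<mu> \<Gamma> F" "emeasure \<mu> F < \<infinity>"
proof -
  obtain \<W> where \<W>: "finite \<W>" "\<forall>W\<in>\<W>. openin T W \<and> inj_mod G \<Gamma> W \<and> emeasure \<mu> W < \<infinity>"
    "\<forall>g\<in>carrier G. \<exists>W\<in>\<W>. \<exists>\<gamma>\<in>\<Gamma>. g \<otimes> \<gamma> \<in> W"
    by (rule uniform_lattice_finite_cover[OF \<Gamma>])
  have sub: "subgroup \<Gamma> G" using \<Gamma> by (simp add: uniform_lattice_def)
  have \<Gamma>G: "\<gamma> \<in> carrier G" if "\<gamma> \<in> \<Gamma>" for \<gamma> using sub that subgroup.mem_carrier by metis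
  obtain n and W :: "nat \<Rightarrow> 'a set" where n: "\<W> = W ` {i. i < n}"
    using finite_imp_nat_seg_image_inj_on[OF \<W>(1)] by blast
  have W: "openin T (W i)" "inj_mod G \<Gamma> (W i)" "emeasure \<mu> (W i) < \<infinity>" "W i \<subseteq> carrier G" if "i < n" for i
    using \<W>(2)[rule_format, of "W i"] n that openin_subset[of T "W i"] topspace_T by auto
  let ?sat = "\<lambda>i. \<Union>\<gamma>\<in>\<Gamma>. W i #> \<gamma>"
  let ?F = "\<Union>i<n. W i - (\<Union>j<i. ?sat j)"
  have sat: "x \<in> ?sat i \<longleftrightarrow> x \<in> carrier G \<and> (\<exists>\<gamma>\<in>\<Gamma>. x \<otimes> \<gamma> \<in> W i)" if "i < n" for i x
  proof
    assume "x \<in> ?sat i"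
    then obtain \<gamma> w where "\<gamma> \<in> \<Gamma>" "w \<in> W i" "x = w \<otimes> \<gamma>" by (auto simp: r_coset_def)
    moreover from this have "x \<otimes> inv \<gamma> = w" "x \<in> carrier G" using \<Gamma>G W(4)[OF that] by (auto simp: m_assoc)
    ultimately show "x \<in> carrier G \<and> (\<exists>\<gamma>\<in>\<Gamma>. x \<otimes> \<gamma> \<in> W i)"
      using subgroup.m_inv_closed[OF sub] by metis
  next
    assume "x \<in> carrier G \<and> (\<exists>\<gamma>\<in>\<Gamma>. x \<otimes> \<gamma> \<in> W i)"
    then obtain \<gamma> where "x \<in> carrier G" "\<gamma> \<in> \<Gamma>" "x \<otimes> \<gamma> \<in> W i" by blast
    moreover from this have "x = (x \<otimes> \<gamma>) \<otimes> inv \<gamma>" using \<Gamma>G by (simp add: m_assoc)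
    ultimately show "x \<in> ?sat i"
      using subgroup.m_inv_closed[OF sub] unfolding r_coset_def by blast
  qed
  have "?sat i \<in> sets \<mu>" if "i < n" for i
    using openin_r_coset[OF W(1)[OF that]] \<Gamma>G by (intro open_in_sets openin_Union) auto
  then have "(\<Union>j<i. ?sat j) \<in> sets \<mu>" if "i < n" for i
    by (rule sets.finite_UN[OF finite_lessThan]) (use that in simp)
  then have "W i - (\<Union>j<i. ?sat j) \<in> sets \<mu>" if "i < n" for i
    using that open_in_sets[OF W(1)[OF that]] by (intro sets.Diff)
  then have F_sets: "?F \<in> sets \<mu>"
    by (intro sets.finite_UN[OF finite_lessThan]) simp
  have "\<exists>!x. x \<in> ?F \<inter> (g <# \<Gamma>)" if g: "g \<in> carrier G" for g
  proof -
    let ?P = "\<lambda>i. i < n \<and> (\<exists>\<gamma>\<in>\<Gamma>. g \<otimes> \<gamma> \<in> W i)"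
    define i where "i = (LEAST i. ?P i)"
    have "\<exists>i. ?P i" using \<W>(3)[rule_format, OF g] n by auto
    then have Pi: "?P i" unfolding i_def by (rule LeastI_ex)
    have least: "i \<le> j" if "?P j" for j unfolding i_def using that by (rule Least_le)
    obtain \<gamma> where \<gamma>: "\<gamma> \<in> \<Gamma>" "g \<otimes> \<gamma> \<in> W i" using Pi by blast
    have not_before: "g \<otimes> \<delta> \<notin> ?sat j" if "\<delta> \<in> \<Gamma>" "j < i" for \<delta> j
    proof
      assume "g \<otimes> \<delta> \<in> ?sat j"
      then obtain \<delta>' where "\<delta>' \<in> \<Gamma>" "(g \<otimes> \<delta>) \<otimes> \<delta>' \<in> W j"
        using sat[of j "g \<otimes> \<delta>"] \<open>j < i\<close> Pi by auto
      then have "g \<otimes> (\<delta> \<otimes> \<delta>') \<in> W j" "\<delta> \<otimes> \<delta>' \<in> \<Gamma>"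
        using g that(1) \<Gamma>G sub by (auto simp: m_assoc subgroup.m_closed)
      then show False using least[of j] that(2) Pi by auto
    qed
    have "g \<otimes> \<gamma> \<in> ?F" using not_before[OF \<gamma>(1)] \<gamma>(2) Pi by blast
    moreover have "g \<otimes> \<gamma> \<in> g <# \<Gamma>" using \<gamma>(1) by (auto simp: mem_l_coset)
    moreover have "y = g \<otimes> \<gamma>" if y: "y \<in> ?F \<inter> (g <# \<Gamma>)" for y
    proof -
      obtain \<delta> where \<delta>: "\<delta> \<in> \<Gamma>" "y = g \<otimes> \<delta>" using y by (auto simp: mem_l_coset)
      obtain k where k: "k < n" "y \<in> W k" "\<And>j. j < k \<Longrightarrow> y \<notin> ?sat j" using y by blast
      have e: "y \<otimes> (inv \<delta> \<otimes> \<gamma>) = g \<otimes> \<gamma>" "(g \<otimes> \<gamma>) \<otimes> (inv \<gamma> \<otimes> \<delta>) = y"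
      proof -
        have "y \<otimes> (inv \<delta> \<otimes> \<gamma>) = g \<otimes> (\<delta> \<otimes> inv \<delta>) \<otimes> \<gamma>" "(g \<otimes> \<gamma>) \<otimes> (inv \<gamma> \<otimes> \<delta>) = g \<otimes> (\<gamma> \<otimes> inv \<gamma>) \<otimes> \<delta>"
          using \<delta> \<gamma> \<Gamma>G g by (simp_all only: m_assoc m_closed inv_closed)
        then show "y \<otimes> (inv \<delta> \<otimes> \<gamma>) = g \<otimes> \<gamma>" "(g \<otimes> \<gamma>) \<otimes> (inv \<gamma> \<otimes> \<delta>) = y"
          using \<delta> \<gamma> \<Gamma>G g by simp_all
      qed
      have in\<Gamma>: "inv \<delta> \<otimes> \<gamma> \<in> \<Gamma>" "inv \<gamma> \<otimes> \<delta> \<in> \<Gamma>"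
        using \<delta>(1) \<gamma>(1) sub by (auto intro: subgroup.m_closed subgroup.m_inv_closed)
      have "i \<le> k" using least[of k] k(1,2) \<delta> by blast
      moreover have "\<not> i < k"
        using k(3)[of i] sat[of i y] Pi \<delta> \<Gamma>G g e(1) in\<Gamma>(1) \<gamma>(2) by (metis m_closed)
      ultimately have "y \<in> W i" using k(2) by simp
      then show ?thesis
        using W(2)[of i] Pi \<gamma>(2) in\<Gamma>(2) e(2) unfolding inj_mod_def by metis
    qed
    ultimately show ?thesis by (intro ex1I[of _ "g \<otimes> \<gamma>"] IntI) assumption+
  qed
  then have "fundamental_domain G \<mu> \<Gamma> ?F" using F_sets unfolding fundamental_domain_def by (intro conjI ballI)
  moreover have "emeasure \<mu> ?F < \<infinity>"
  proof -
    have "emeasure \<mu> ?F \<le> emeasure \<mu> (\<Union>i\<in>{..<n}. W i)"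
      using W(1) open_in_sets by (intro emeasure_mono sets.finite_UN) auto
    also have "\<dots> \<le> (\<Sum>i<n. emeasure \<mu> (W i))"
      using W(1) open_in_sets by (intro emeasure_subadditive_finite) auto
    also have "\<dots> < \<infinity>" using W(3) by (simp add: less_top)
    finally show ?thesis .
  qed
  ultimately show thesis by (rule that)
qed

lemma fundamental_domainD:
  assumes F: "fundamental_domain G \<mu> \<Gamma> F" and sub: "subgroup \<Gamma> G"
  shows "F \<in> sets \<mu>" "F \<subseteq> carrier G" "inj_mod G \<Gamma> F" "g \<in> carrier G \<Longrightarrow> \<exists>\<gamma>\<in>\<Gamma>. g \<otimes> \<gamma> \<in> F"
proof -
  show FS: "F \<in> sets \<mu>" using F by (simp add: fundamental_domain_def)
  then show FG: "F \<subseteq> carrier G" by (rule sets_\<mu>_carrier)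
  show "inj_mod G \<Gamma> F"
    unfolding inj_mod_def
  proof (intro ballI impI)
    fix a \<gamma> assume a: "a \<in> F" "\<gamma> \<in> \<Gamma>" "a \<otimes> \<gamma> \<in> F"
    have aG: "a \<in> carrier G" using a FG by blast
    have "a \<in> F \<inter> (a <# \<Gamma>)" "a \<otimes> \<gamma> \<in> F \<inter> (a <# \<Gamma>)"
      using a aG subgroup.one_closed[OF sub] by (force simp: mem_l_coset)+
    then show "a \<otimes> \<gamma> = a" using F aG unfolding fundamental_domain_def by blast
  qed
  show "\<exists>\<gamma>\<in>\<Gamma>. g \<otimes> \<gamma> \<in> F" if "g \<in> carrier G"
    using F that unfolding fundamental_domain_def by (metis IntE mem_l_coset)
qed

lemma covolume_domain:
  assumes "uniform_lattice G T \<Gamma>"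
  obtains F where "fundamental_domain G \<mu> \<Gamma> F" "covolume G \<mu> \<Gamma> = emeasure \<mu> F"
proof -
  have "\<exists>F. fundamental_domain G \<mu> \<Gamma> F" using fundamental_domain_exists[OF assms] by blast
  then have "fundamental_domain G \<mu> \<Gamma> (SOME F. fundamental_domain G \<mu> \<Gamma> F)" by (rule someI_ex)
  then show thesis using that by (simp add: covolume_def)
qed

lemma covolume_finite:
  assumes "uniform_lattice G T \<Gamma>" "countable \<Gamma>"
  shows "covolume G \<mu> \<Gamma> < \<infinity>"
proof -
  have sub: "subgroup \<Gamma> G" using assms by (simp add: uniform_lattice_def)
  obtain F where F: "fundamental_domain G \<mu> \<Gamma> F" "covolume G \<mu> \<Gamma> = emeasure \<mu> F"
    using covolume_domain[OF assms(1)] .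
  obtain E where E: "fundamental_domain G \<mu> \<Gamma> E" "emeasure \<mu> E < \<infinity>"
    using fundamental_domain_exists[OF assms(1)] .
  have "emeasure \<mu> F \<le> emeasure \<mu> E"
    by (rule emeasure_inj_mod_le_covering[OF sub assms(2)])
       (use fundamental_domainD[OF F(1) sub] fundamental_domainD[OF E(1) sub] in auto)
  then show ?thesis using F(2) E(2) by simp
qed

text \<open>Each of the \<open>m - 1\<close> proper inclusions below \<open>\<Gamma> m\<close> provides an element \<open>d i\<close> that is new, and
  together with \<open>\<one>\<close> these lie in \<open>m\<close> different left cosets of \<open>\<Gamma> 1\<close>. The corresponding \<open>m\<close> translates
  of a fundamental domain for \<open>\<Gamma> m\<close> are disjoint, and their union injects into the cosets of
  \<open>\<Gamma> 1\<close>.\<close>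

lemma covolume_tower_bound:
  assumes lat: "\<And>n. n \<ge> 1 \<Longrightarrow> uniform_lattice G T (\<Gamma> n)" and count: "countable (\<Gamma> 1)"
    and tower: "ascending_tower \<Gamma>" and m: "m \<ge> 1"
  shows "of_nat m * covolume G \<mu> (\<Gamma> m) \<le> covolume G \<mu> (\<Gamma> 1)"
proof -
  have sub: "subgroup (\<Gamma> n) G" if "n \<ge> 1" for n using lat[OF that] by (simp add: uniform_lattice_def)
  have mono: "\<Gamma> i \<subseteq> \<Gamma> j" if "1 \<le> i" "i \<le> j" for i j
    using that(2)
  proof (induction rule: dec_induct)
    case (step n)
    then show ?case using tower that(1) unfolding ascending_tower_def by (meson order_trans psubset_imp_subset)
  qed simp
  have "\<forall>i. \<exists>r. i \<ge> 1 \<longrightarrow> r \<in> \<Gamma> (Suc i) \<and> r \<notin> \<Gamma> i"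
    using tower unfolding ascending_tower_def by blast
  then obtain r where r: "\<And>i. i \<ge> 1 \<Longrightarrow> r i \<in> \<Gamma> (Suc i) \<and> r i \<notin> \<Gamma> i" by metis
  \<comment> \<open>\<open>r i\<close> is available for \<open>i \<ge> 1\<close> only; the index \<open>0\<close> is used for the coset of \<open>\<one>\<close>.\<close>
  define d where "d i = (if i = 0 then \<one> else r i)" for i :: nat
  have d_in: "d i \<in> \<Gamma> j" if "i < j" for i j
    using that r[of i] mono[of "Suc i" j] subgroup.one_closed[OF sub[of j]] by (auto simp: d_def)
  have dG: "d i \<in> carrier G" for i
    using d_in[of i "Suc i"] subgroup.mem_carrier[OF sub[of "Suc i"]] by simp
  have d_sep: "inv (d i) \<otimes> d j \<notin> \<Gamma> 1" if "i < j" for i j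
  proof
    assume "inv (d i) \<otimes> d j \<in> \<Gamma> 1"
    then have "d i \<otimes> (inv (d i) \<otimes> d j) \<in> \<Gamma> j"
      using that mono[of 1 j] d_in[OF that] subgroup.m_closed[OF sub[of j]] by auto
    moreover have "d i \<otimes> (inv (d i) \<otimes> d j) = d j" using dG by (simp add: m_assoc[symmetric])
    ultimately show False using r[of j] that by (simp add: d_def)
  qed
  have d_sep': "i = j" if "d i \<otimes> \<gamma> = d j" "\<gamma> \<in> \<Gamma> 1" for i j \<gamma>
  proof (rule ccontr)
    assume "i \<noteq> j"
    have \<gamma>G: "\<gamma> \<in> carrier G" using that(2) subgroup.mem_carrier[OF sub[of 1]] by simp
    have "\<gamma> = inv (d i) \<otimes> d j" using that(1) \<gamma>G dG by (simp add: m_assoc[symmetric] flip: that(1))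
    moreover from this have "inv \<gamma> = inv (d j) \<otimes> d i" using dG by (simp add: inv_mult_group)
    moreover have "inv \<gamma> \<in> \<Gamma> 1" using that(2) subgroup.m_inv_closed[OF sub[of 1]] by simp
    ultimately show False using d_sep[of i j] d_sep[of j i] that(2) \<open>i \<noteq> j\<close> by (metis linorder_neqE_nat)
  qed
  obtain F where F: "fundamental_domain G \<mu> (\<Gamma> m) F" "covolume G \<mu> (\<Gamma> m) = emeasure \<mu> F"
    using covolume_domain[OF lat[OF m]] .
  obtain E where E: "fundamental_domain G \<mu> (\<Gamma> 1) E" "covolume G \<mu> (\<Gamma> 1) = emeasure \<mu> E"
    using covolume_domain[OF lat[of 1]] by auto
  note Fd = fundamental_domainD[OF F(1) sub[OF m]] and Ed = fundamental_domainD[OF E(1) sub[of 1]]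
  have key: "f = f' \<and> d i \<otimes> \<gamma> = d j" if f: "f \<in> F" "f' \<in> F" "i < m" "j < m" "\<gamma> \<in> \<Gamma> 1"
    and eq: "(f \<otimes> d i) \<otimes> \<gamma> = f' \<otimes> d j" for f f' i j \<gamma>
  proof -
    have G: "f \<in> carrier G" "f' \<in> carrier G" "\<gamma> \<in> carrier G"
      using f Fd(2) subgroup.mem_carrier[OF sub[of 1]] by auto
    have "f' = f \<otimes> (d i \<otimes> \<gamma> \<otimes> inv (d j))"
    proof -
      have "f' = (f' \<otimes> d j) \<otimes> inv (d j)" using G dG by (simp add: m_assoc)
      also have "\<dots> = f \<otimes> (d i \<otimes> \<gamma> \<otimes> inv (d j))" unfolding eq[symmetric] using G dG by (simp add: m_assoc)
      finally show ?thesis .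
    qed
    moreover have "d i \<otimes> \<gamma> \<otimes> inv (d j) \<in> \<Gamma> m"
      using d_in f(3,4,5) mono[of 1 m] m subgroup.m_closed[OF sub[OF m]] subgroup.m_inv_closed[OF sub[OF m]]
      by (simp add: subset_iff)
    ultimately have "f' = f" using Fd(3) f(1,2) unfolding inj_mod_def by metis
    then have "f \<otimes> (d i \<otimes> \<gamma>) = f \<otimes> d j" using eq G dG by (simp add: m_assoc)
    then show ?thesis using \<open>f' = f\<close> G dG by simp
  qed
  let ?F = "\<Union>i<m. F #> d i"
  have sets: "F #> d i \<in> sets \<mu>" for i using r_coset_in_sets[OF Fd(1) dG] .
  have disj: "disjoint_family_on (\<lambda>i. F #> d i) {..<m}"
    unfolding disjoint_family_on_def
  proof (intro ballI impI, rule ccontr)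
    fix i j assume ij: "i \<in> {..<m}" "j \<in> {..<m}" "i \<noteq> j" and "(F #> d i) \<inter> (F #> d j) \<noteq> {}"
    then obtain f f' where f: "f \<in> F" "f' \<in> F" "f \<otimes> d i = f' \<otimes> d j" by (auto simp: r_coset_def)
    have one: "\<one> \<in> \<Gamma> 1" using subgroup.one_closed[OF sub[of 1]] by simp
    have "(f \<otimes> d i) \<otimes> \<one> = f' \<otimes> d j" using f Fd(2) dG by (simp add: subset_iff)
    then have "d i \<otimes> \<one> = d j" using key[OF f(1,2) _ _ one] ij by blast
    then show False using d_sep'[OF _ one] ij by blast
  qed
  have "inj_mod G (\<Gamma> 1) ?F"
    unfolding inj_mod_def
  proof (intro ballI impI)
    fix a \<gamma> assume a: "a \<in> ?F" "\<gamma> \<in> \<Gamma> 1" "a \<otimes> \<gamma> \<in> ?F"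
    then obtain i j f f' where f: "i < m" "j < m" "f \<in> F" "f' \<in> F" "a = f \<otimes> d i" "a \<otimes> \<gamma> = f' \<otimes> d j"
      by (auto simp: r_coset_def)
    then have *: "f = f'" "d i \<otimes> \<gamma> = d j" using key[of f f' i j \<gamma>] a(2) by auto
    then have "i = j" using d_sep' a(2) by blast
    then show "a \<otimes> \<gamma> = a" using f * by simp
  qed
  then have "emeasure \<mu> ?F \<le> emeasure \<mu> E"
    using sets Ed Fd(2) dG
    by (intro emeasure_inj_mod_le_covering[OF sub[of 1] count]) (auto simp: r_coset_def subset_iff intro!: sets.finite_UN)
  moreover have "emeasure \<mu> ?F = (\<Sum>i<m. emeasure \<mu> (F #> d i))"
    using sets disj by (intro sum_emeasure[symmetric]) auto
  moreover have "\<dots> = of_nat m * emeasure \<mu> F"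
    using emeasure_r_coset[OF Fd(1) dG] by simp
  ultimately show ?thesis using F(2) E(2) by simp
qed

theorem covolume_tower_tendsto_0:
  assumes lat: "\<And>n. n \<ge> 1 \<Longrightarrow> uniform_lattice G T (\<Gamma> n)" and count: "countable (\<Gamma> 1)"
    and tower: "ascending_tower \<Gamma>"
  shows "(\<lambda>n. covolume G \<mu> (\<Gamma> n)) \<longlonglongrightarrow> 0"
proof -
  obtain c where c: "covolume G \<mu> (\<Gamma> 1) = ennreal c" "c \<ge> 0"
    using covolume_finite[OF lat[of 1] count] by (cases "covolume G \<mu> (\<Gamma> 1)") auto
  have "covolume G \<mu> (\<Gamma> m) \<le> ennreal (c * inverse (real m))" if m: "m \<ge> 1" for m
  proof -
    have "ennreal (real m) * ennreal (inverse (real m)) = 1"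
      using m by (simp add: ennreal_mult[symmetric])
    then have "covolume G \<mu> (\<Gamma> m) = (ennreal (real m) * ennreal (inverse (real m))) * covolume G \<mu> (\<Gamma> m)"
      by simp
    also have "\<dots> = (of_nat m * covolume G \<mu> (\<Gamma> m)) * ennreal (inverse (real m))"
      unfolding ennreal_of_nat_eq_real_of_nat by (simp only: mult_ac)
    also have "\<dots> \<le> ennreal c * ennreal (inverse (real m))"
      using covolume_tower_bound[OF assms m] c(1) by (intro mult_right_mono) auto
    also have "\<dots> = ennreal (c * inverse (real m))"
      using c(2) by (simp add: ennreal_mult)
    finally show ?thesis .
  qed
  then have "\<forall>\<^sub>F m in sequentially. covolume G \<mu> (\<Gamma> m) \<le> ennreal (c * inverse (real m))"
    unfolding eventually_sequentially by blast
  moreover have "(\<lambda>m. ennreal (c * inverse (real m))) \<longlonglongrightarrow> 0"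
  proof -
    have "(\<lambda>m. c * inverse (real m)) \<longlonglongrightarrow> c * 0"
      by (intro tendsto_mult tendsto_const lim_inverse_n)
    then have "(\<lambda>m. ennreal (c * inverse (real m))) \<longlonglongrightarrow> ennreal (c * 0)"
      by (rule tendsto_ennrealI)
    then show ?thesis by simp
  qed
  ultimately show ?thesis
    using tendsto_sandwich[of "\<lambda>_. 0" "\<lambda>n. covolume G \<mu> (\<Gamma> n)" sequentially] by simp
qed

end


section \<open>The flip automorphisms\<close>

lemma continuous_int_valued_constant:
  fixes h :: "'a::topological_space \<Rightarrow> real"
  assumes "connected S" "continuous_on S h" "\<And>x. x \<in> S \<Longrightarrow> h x \<in> \<int>" "x \<in> S" "y \<in> S"
  shows "h x = h y"
proof -
  have "h constant_on S"
  proof (rule continuous_discrete_range_constant[OF assms(1,2)])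
    fix x assume x: "x \<in> S"
    have "1 \<le> norm (h y - h x)" if "y \<in> S" "h y \<noteq> h x" for y
    proof -
      obtain m :: int where m: "h x = of_int m" using assms(3)[OF x] by (elim Ints_cases)
      obtain n :: int where n: "h y = of_int n" using assms(3)[OF \<open>y \<in> S\<close>] by (elim Ints_cases)
      have "n \<noteq> m" using \<open>h y \<noteq> h x\<close> m n by auto
      then have "1 \<le> \<bar>n - m\<bar>" by linarith
      then show ?thesis using m n by (metis of_int_1_le_iff of_int_abs of_int_diff real_norm_def)
    qed
    then show "\<exists>e>0. \<forall>y. y \<in> S \<and> h y \<noteq> h x \<longrightarrow> e \<le> norm (h y - h x)"
      by (intro exI[of _ 1]) auto
  qed
  then show ?thesis using assms(4,5) unfolding constant_on_def by metis
qed

lemma cis_minus_if_int: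
  assumes "a \<in> \<int>"
  shows "cis (- (pi * a)) = cis (pi * a)"
proof -
  have "cis (pi * a) = cis (2 * pi * a) * cis (- (pi * a))"
    by (simp add: cis_mult)
  then show ?thesis using assms by simp
qed

lemma cis_eq_imp_cis_uminus_eq: "cis a = cis b \<Longrightarrow> cis (- a) = cis (- b)"
  by (metis cis_cnj)

context salvetti_cover
begin

lemma angle_exists: "\<exists>\<theta>. continuous_on Y \<theta> \<and> (\<forall>y\<in>Y. p y $ w = cis (2 * pi * \<theta> y))"
proof -
  obtain y where y: "y \<in> Y" by (rule vertex_exists)
  have n: "norm (p z $ w) = 1" if "z \<in> Y" for z
    using p_in[OF that] unfolding salvetti_iff[OF simplicial] by blast
  then have nz: "p z $ w \<noteq> 0" if "z \<in> Y" for z using that by force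
  then obtain a where a: "p y $ w = exp a" using y exp_Ln by metis
  obtain g where g: "continuous_on Y g" "\<And>z. z \<in> Y \<Longrightarrow> exp (g z) = p z $ w"
  proof (rule covering_metric_lift_exists[OF covering_space_exp_punctured_plane UNIV_I y simply_connected locally_path_connected_Y])
    show "continuous_on Y (\<lambda>z. p z $ w)" using continuous_p by (intro continuous_intros)
    show "(\<lambda>z. p z $ w) \<in> Y \<rightarrow> - {0}" using nz by auto
  qed (use a in auto)
  have "p z $ w = cis (2 * pi * (Im (g z) / (2 * pi)))" if "z \<in> Y" for z
  proof -
    have "Re (g z) = 0" using g(2)[OF that] n[OF that] norm_exp_eq_Re[of "g z"] by simp
    then show ?thesis using g(2)[OF that] by (simp add: exp_eq_polar flip: g(2)[OF that])
  qed
  moreover have "continuous_on Y (\<lambda>z. Im (g z) / (2 * pi))" using g(1) by (intro continuous_intros) auto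
  ultimately show ?thesis by blast
qed

text \<open>Up to an additive integer, the value at a vertex is the signed number of \<open>w\<close>-edges on a path to it
  from a base point. The logarithms exist since \<open>Y\<close> is simply connected.\<close>

definition angle :: "'v \<Rightarrow> 'y \<Rightarrow> real" where
  "angle w = (SOME \<theta>. continuous_on Y \<theta> \<and> (\<forall>y\<in>Y. p y $ w = cis (2 * pi * \<theta> y)))"

lemma continuous_angle: "continuous_on Y (angle w)"
  and p_angle: "y \<in> Y \<Longrightarrow> p y $ w = cis (2 * pi * angle w y)"
  using someI_ex[OF angle_exists[of w]] unfolding angle_def by blast+

lemma p_eq_1_iff_angle: "y \<in> Y \<Longrightarrow> p y $ w = 1 \<longleftrightarrow> angle w y \<in> \<int>"
  by (simp add: p_angle cis_2pi_eq_1_iff)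

lemma angle_cube:
  assumes \<phi>: "cube \<sigma> \<phi>" and x: "x \<in> unit_cube \<sigma>" "y \<in> unit_cube \<sigma>"
  shows "angle w (\<phi> x) - angle w (\<phi> y) = x $ w - y $ w"
proof -
  note cube = cubeD[OF \<phi>]
  have "angle w (\<phi> x) - x $ w = angle w (\<phi> y) - y $ w"
  proof (rule continuous_int_valued_constant[OF connected_unit_cube _ _ x, of "\<lambda>x. angle w (\<phi> x) - x $ w"])
    show "continuous_on (unit_cube \<sigma>) (\<lambda>x. angle w (\<phi> x) - x $ w)"
      using cube(2,3) by (intro continuous_intros continuous_on_compose2[OF continuous_angle]) auto
    fix z assume z: "z \<in> unit_cube \<sigma>"
    have "cis (2 * pi * angle w (\<phi> z)) = cis (2 * pi * z $ w)"
      using p_angle[OF cube(4)[OF z], of w] cube(5)[OF z] by simp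
    then show "angle w (\<phi> z) - z $ w \<in> \<int>" by (simp only: cis_2pi_eq_iff)
  qed
  then show ?thesis by simp
qed

end

locale nonadjacent_pair = salvetti_cover L Y p
  for L :: "'v::finite set set" and Y :: "'y::metric_space set" and p :: "'y \<Rightarrow> complex ^ 'v" +
  fixes u v :: 'v
  assumes nonadjacent: "{u, v} \<notin> L"
begin

lemma u_neq_v: "u \<noteq> v"
  using nonadjacent simplicial unfolding simplicial_complex_def by auto

text \<open>The coordinates of \<open>p y\<close> other than \<open>1\<close> are supported on a simplex.\<close>

lemma angle_u_or_v_int:
  assumes "y \<in> Y"
  shows "angle u y \<in> \<int> \<or> angle v y \<in> \<int>"
proof (rule ccontr)
  assume "\<not> ?thesis"
  then have "{u, v} \<subseteq> {w. p y $ w \<noteq> 1}" using p_eq_1_iff_angle[OF assms] by auto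
  moreover have "{w. p y $ w \<noteq> 1} \<in> L" using p_in[OF assms] salvetti_iff[OF simplicial] by blast
  ultimately show False using nonadjacent simplicial unfolding simplicial_complex_def by blast
qed

definition flip_sign :: "(int \<Rightarrow> bool) \<Rightarrow> 'y \<Rightarrow> real" where
  "flip_sign e y = (if e \<lfloor>angle v y\<rfloor> then - 1 else 1)"

text \<open>A square root of the coordinate \<open>u\<close> of \<open>p\<close>. At a vertex it is \<open>1\<close> or \<open>-1\<close> and records the
  parity of \<open>angle u\<close>.\<close>

definition half_turn :: "'y \<Rightarrow> complex" where
  "half_turn y = cis (pi * angle u y)"

definition flipped_half_turn :: "(int \<Rightarrow> bool) \<Rightarrow> 'y \<Rightarrow> complex" where
  "flipped_half_turn e y = cis (pi * (flip_sign e y * angle u y))"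

text \<open>The map \<open>f\<close> reverses the \<open>u\<close>-edges at the levels in \<open>e\<close>. Prescribing \<open>half_turn\<close> instead of its
  square \<open>p (f y) $ u\<close> encodes in addition that \<open>f\<close> preserves the parity of \<open>u\<close>-edges.\<close>

definition flips :: "(int \<Rightarrow> bool) \<Rightarrow> ('y \<Rightarrow> 'y) \<Rightarrow> bool" where
  "flips e f \<longleftrightarrow> continuous_on Y f \<and> f \<in> Y \<rightarrow> Y \<and>
     (\<forall>y\<in>Y. half_turn (f y) = flipped_half_turn e y \<and> (\<forall>w. w \<noteq> u \<longrightarrow> p (f y) $ w = p y $ w))"

lemma flipped_half_turn_int:
  assumes "angle u y \<in> \<int>"
  shows "flipped_half_turn e y = half_turn y"
  using cis_minus_if_int[OF assms] by (simp add: flipped_half_turn_def half_turn_def flip_sign_def)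

lemma flipped_half_turn_False: "flipped_half_turn (\<lambda>_. False) y = half_turn y"
  by (simp add: flipped_half_turn_def half_turn_def flip_sign_def)

lemma half_turn_sq: "y \<in> Y \<Longrightarrow> (half_turn y)\<^sup>2 = p y $ u"
  by (simp add: half_turn_def p_angle power2_eq_square cis_mult algebra_simps)

lemma flipped_half_turn_nonzero: "flipped_half_turn e y \<noteq> 0"
  by (simp add: flipped_half_turn_def)

lemma flipped_half_turn_sq_eq_1_iff:
  assumes "y \<in> Y"
  shows "(flipped_half_turn e y)\<^sup>2 = 1 \<longleftrightarrow> p y $ u = 1"
proof -
  have "(flipped_half_turn e y)\<^sup>2 = cis (2 * pi * (flip_sign e y * angle u y))"
    by (simp add: flipped_half_turn_def power2_eq_square cis_mult algebra_simps)
  also have "\<dots> = 1 \<longleftrightarrow> angle u y \<in> \<int>"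
    unfolding cis_2pi_eq_1_iff by (simp add: flip_sign_def)
  finally show ?thesis using p_eq_1_iff_angle[OF assms] by simp
qed

text \<open>The sign can jump only where \<open>angle v\<close> passes an integer. For points whose level lies strictly
  between two integers \<open>angle u\<close> is an integer, and there both signs give the same value.\<close>

lemma continuous_flipped_half_turn: "continuous_on Y (flipped_half_turn e)"
  unfolding continuous_on_eq_continuous_within
proof
  fix y assume y: "y \<in> Y"
  define j where "j = \<lfloor>angle v y\<rfloor>"
  define s :: real where "s = (if e j then - 1 else 1)"
  let ?N = "Y \<inter> angle v -` {of_int j - 1 <..< of_int j + 1}"
  \<comment> \<open>Over \<open>?N\<close> the level of \<open>z\<close> is \<open>j\<close>, unless \<open>angle v z\<close> lies strictly between \<open>j - 1\<close> and \<open>j\<close>.\<close>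
  show "continuous (at y within Y) (flipped_half_turn e)"
  proof (rule continuous_transform_within_openin)
    have "continuous_on Y (\<lambda>z. cis (pi * (s * angle u z)))"
      unfolding cis_conv_exp using continuous_angle by (intro continuous_intros)
    then show "continuous (at y within Y) (\<lambda>z. cis (pi * (s * angle u z)))"
      using y by (simp add: continuous_on_eq_continuous_within)
    show "openin (top_of_set Y) ?N"
      using continuous_angle by (intro continuous_openin_preimage_gen) auto
    have "of_int j \<le> angle v y \<and> angle v y < of_int j + 1" unfolding j_def by linarith
    then show "y \<in> ?N" using y by auto
    fix z assume z: "z \<in> ?N"
    then have zY: "z \<in> Y" by blast
    show "cis (pi * (s * angle u z)) = flipped_half_turn e z"
    proof (cases "angle u z \<in> \<int>")
      case True
      then show ?thesis
        using flipped_half_turn_int[OF True] cis_minus_if_int[OF True] by (simp add: s_def half_turn_def)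
    next
      case False
      then obtain k :: int where k: "angle v z = of_int k" using angle_u_or_v_int[OF zY] by (auto elim: Ints_cases)
      then have "k = j" using z by auto
      then show ?thesis using k by (simp add: flipped_half_turn_def flip_sign_def s_def)
    qed
  qed
qed

lemma flipsD:
  assumes "flips e f"
  shows "continuous_on Y f" "f \<in> Y \<rightarrow> Y" "y \<in> Y \<Longrightarrow> f y \<in> Y" "y \<in> Y \<Longrightarrow> half_turn (f y) = flipped_half_turn e y"
    "y \<in> Y \<Longrightarrow> w \<noteq> u \<Longrightarrow> p (f y) $ w = p y $ w"
  using assms unfolding flips_def by auto

lemma flips_p:
  assumes "flips e f" "y \<in> Y"
  shows "p (f y) = (\<chi> w. if w = u then (flipped_half_turn e y)\<^sup>2 else p y $ w)"
  using flipsD[OF assms(1)] assms(2) half_turn_sq[of "f y"] by (simp add: vec_eq_iff)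

lemma flips_unique:
  assumes "flips e f" "flips e g" "x \<in> Y" "f x = g x" "y \<in> Y"
  shows "f y = g y"
  by (rule lift_unique[OF connected_Y assms(3,5)])
     (use flipsD(1,2)[OF assms(1)] flipsD(1,2)[OF assms(2)] flips_p[OF assms(1)] flips_p[OF assms(2)] assms(4) in auto)

lemma flips_shift:
  assumes f: "flips e f"
  obtains c :: int where "\<forall>y\<in>Y. angle v (f y) = angle v y + of_int c"
proof -
  let ?h = "\<lambda>y. angle v (f y) - angle v y"
  obtain x where x: "x \<in> Y" by (rule vertex_exists)
  have int: "?h y \<in> \<int>" if y: "y \<in> Y" for y
  proof -
    have "cis (2 * pi * angle v (f y)) = cis (2 * pi * angle v y)"
      using flipsD(5)[OF f y, of v] u_neq_v p_angle[OF y, of v] p_angle[OF flipsD(3)[OF f y], of v] by simp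
    then show ?thesis by (simp only: cis_2pi_eq_iff)
  qed
  have cont: "continuous_on Y ?h"
    using flipsD(1,2)[OF f] by (intro continuous_intros continuous_angle continuous_on_compose2[OF continuous_angle]) auto
  obtain c where c: "?h x = of_int c" using int[OF x] by (auto elim: Ints_cases)
  have "?h y = of_int c" if "y \<in> Y" for y
    using continuous_int_valued_constant[OF connected_Y cont int that x] c by simp
  then have "\<forall>y\<in>Y. angle v (f y) = angle v y + of_int c" by (simp add: algebra_simps)
  then show thesis by (rule that)
qed

lemma flips_compose:
  assumes f: "flips e f" and g: "flips e' g" and c: "\<forall>y\<in>Y. angle v (g y) = angle v y + of_int c"
  shows "flips (\<lambda>j. e (j + c) \<noteq> e' j) (\<lambda>y. f (g y))"
  unfolding flips_def
proof (intro conjI ballI allI impI)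
  show "continuous_on Y (\<lambda>y. f (g y))"
    by (rule continuous_on_compose2[OF flipsD(1)[OF f] flipsD(1)[OF g]]) (use flipsD(2)[OF g] in auto)
  show "(\<lambda>y. f (g y)) \<in> Y \<rightarrow> Y" using flipsD(3)[OF f] flipsD(3)[OF g] by blast
  fix y assume y: "y \<in> Y"
  note gy = flipsD(3)[OF g y]
  show "p (f (g y)) $ w = p y $ w" if "w \<noteq> u" for w
    using flipsD(5)[OF f gy that] flipsD(5)[OF g y that] by simp
  have eq: "cis (pi * angle u (g y)) = cis (pi * (flip_sign e' y * angle u y))"
    using flipsD(4)[OF g y] by (simp add: half_turn_def flipped_half_turn_def)
  have "\<lfloor>angle v (g y)\<rfloor> = \<lfloor>angle v y\<rfloor> + c" using c y by simp
  then have "half_turn (f (g y)) = cis (pi * (flip_sign (\<lambda>j. e (j + c)) y * angle u (g y)))"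
    using flipsD(4)[OF f gy] by (simp add: flipped_half_turn_def flip_sign_def)
  also have "\<dots> = cis (pi * (flip_sign (\<lambda>j. e (j + c) \<noteq> e' j) y * angle u y))"
    using eq cis_eq_imp_cis_uminus_eq[OF eq] by (auto simp: flip_sign_def)
  finally show "half_turn (f (g y)) = flipped_half_turn (\<lambda>j. e (j + c) \<noteq> e' j) y"
    by (simp add: flipped_half_turn_def)
qed

text \<open>The conjugated coordinates define a map \<open>G\<close> from \<open>Y\<close> to the Salvetti complex, which lifts to \<open>Y\<close>.
  The lift has the right \<open>half_turn\<close> up to a sign that is constant on the connected space \<open>Y\<close>.\<close>

lemma flips_exists:
  assumes y: "y \<in> Y" "y' \<in> Y" "half_turn y' = flipped_half_turn e y" "\<And>w. w \<noteq> u \<Longrightarrow> p y' $ w = p y $ w"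
  obtains f where "flips e f" "f y = y'"
proof -
  define G where "G z = (\<chi> w. if w = u then (flipped_half_turn e z)\<^sup>2 else p z $ w)" for z
  have "continuous_on Y (\<lambda>z. if w = u then (flipped_half_turn e z)\<^sup>2 else p z $ w)" for w
    using continuous_flipped_half_turn[of e] continuous_p by (cases "w = u") (auto intro!: continuous_intros)
  then have cont: "continuous_on Y G" unfolding G_def by (intro continuous_on_vec_lambda)
  have G_in: "G z \<in> salvetti L" if z: "z \<in> Y" for z
  proof -
    have *: "\<And>w. norm (p z $ w) = 1" "{w. p z $ w \<noteq> 1} \<in> L"
      using p_in[OF z] salvetti_iff[OF simplicial] by blast+
    have "norm (G z $ w) = 1" for w
      using *(1) by (simp add: G_def flipped_half_turn_def norm_power)
    moreover have "{w. G z $ w \<noteq> 1} = {w. p z $ w \<noteq> 1}"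
      using flipped_half_turn_sq_eq_1_iff[OF z] by (auto simp: G_def)
    ultimately show ?thesis using *(2) salvetti_iff[OF simplicial] by simp
  qed
  have "G y = p y'"
    using y half_turn_sq[OF y(2)] by (simp add: G_def vec_eq_iff)
  then obtain f where f: "continuous_on Y f" "f \<in> Y \<rightarrow> Y" "f y = y'" "\<And>z. z \<in> Y \<Longrightarrow> p (f z) = G z"
    using lift_exists[OF simply_connected locally_path_connected_Y cont, of y y'] G_in y(1,2) by blast
  define r where "r z = half_turn (f z) / flipped_half_turn e z" for z
  have sq: "(r z)\<^sup>2 = 1" if "z \<in> Y" for z
  proof -
    have "(half_turn (f z))\<^sup>2 = (flipped_half_turn e z)\<^sup>2"
      using half_turn_sq[of "f z"] f(2,4) that by (auto simp: G_def)
    then show ?thesis using flipped_half_turn_nonzero[of e z] by (simp add: r_def power_divide)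
  qed
  have "continuous_on Y half_turn"
    unfolding half_turn_def cis_conv_exp using continuous_angle by (intro continuous_intros)
  then have "continuous_on Y (\<lambda>z. half_turn (f z))"
    using f(1,2) by (intro continuous_on_compose2[of Y half_turn Y f]) auto
  then have "continuous_on Y r"
    unfolding r_def using continuous_flipped_half_turn flipped_half_turn_nonzero by (intro continuous_on_divide) auto
  moreover have "finite (r ` Y)"
    by (rule finite_subset[of _ "{1, - 1}"]) (use sq power2_eq_1_iff in auto)
  ultimately have "r constant_on Y" using continuous_finite_range_constant[OF connected_Y] by blast
  moreover have "r y = 1"
    using y(3) f(3) flipped_half_turn_nonzero[of e y] by (simp add: r_def)
  ultimately have "r z = 1" if "z \<in> Y" for z using that y(1) unfolding constant_on_def by metis
  then have "half_turn (f z) = flipped_half_turn e z" if "z \<in> Y" for z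
    using that flipped_half_turn_nonzero[of e z] unfolding r_def by (metis divide_eq_1_iff)
  moreover have "p (f z) $ w = p z $ w" if "z \<in> Y" "w \<noteq> u" for z w using f(4) that by (simp add: G_def)
  ultimately have "flips e f" using f(1,2) by (simp add: flips_def)
  then show thesis using f(3) by (rule that)
qed

lemma flips_id: "flips (\<lambda>_. False) (\<lambda>y. y)"
  by (simp add: flips_def flipped_half_turn_False)

lemma flips_cong:
  assumes "\<And>y. y \<in> Y \<Longrightarrow> f y = g y"
  shows "flips e f \<longleftrightarrow> flips e g"
  unfolding flips_def using assms by (auto simp: Pi_def cong: continuous_on_cong)

text \<open>If \<open>f\<close> shifts levels by \<open>c\<close>, then lift the pattern shifted back by \<open>c\<close>, starting at \<open>f x\<close> with value
  \<open>x\<close>. Both composites flip nothing and fix a point, so they are the identity.\<close>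

lemma flips_inverse:
  assumes f: "flips e f"
  obtains c g where "flips (\<lambda>j. e (j - c)) g" "\<forall>y\<in>Y. g (f y) = y" "\<forall>y\<in>Y. f (g y) = y"
proof -
  obtain c where c: "\<forall>y\<in>Y. angle v (f y) = angle v y + of_int c"
    using flips_shift[OF f] .
  obtain x where x: "x \<in> Y" by (rule vertex_exists)
  let ?e = "\<lambda>j. e (j - c)"
  note fx = flipsD(3)[OF f x]
  have fl: "\<lfloor>angle v (f x)\<rfloor> = \<lfloor>angle v x\<rfloor> + c" using c x by simp
  have s: "flip_sign ?e (f x) = flip_sign e x" by (simp add: flip_sign_def fl)
  have eq: "cis (pi * angle u (f x)) = cis (pi * (flip_sign e x * angle u x))"
    using flipsD(4)[OF f x] by (simp add: half_turn_def flipped_half_turn_def)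
  have "half_turn x = flipped_half_turn ?e (f x)"
    using eq cis_eq_imp_cis_uminus_eq[OF eq]
    by (auto simp: half_turn_def flipped_half_turn_def s) (auto simp: flip_sign_def split: if_splits)
  then obtain g where g: "flips ?e g" "g (f x) = x"
    using flips_exists[OF fx x, of ?e] flipsD(5)[OF f x] by metis
  obtain c' where c': "\<forall>y\<in>Y. angle v (g y) = angle v y + of_int c'"
    using flips_shift[OF g(1)] .
  have "c' = - c" using bspec[OF c' fx] bspec[OF c x] g(2) by simp
  then have 1: "flips (\<lambda>_. False) (\<lambda>y. f (g y))"
    using flips_compose[OF f g(1) c'] by simp
  have 2: "flips (\<lambda>_. False) (\<lambda>y. g (f y))"
    using flips_compose[OF g(1) f c] by simp
  show thesis
  proof (rule that[OF g(1)]; intro ballI)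
    show "g (f y) = y" if "y \<in> Y" for y using flips_unique[OF 2 flips_id x _ that] g(2) by simp
    show "f (g y) = y" if "y \<in> Y" for y using flips_unique[OF 1 flips_id fx _ that] g(2) by simp
  qed
qed

end


section \<open>The lattices\<close>

context nonadjacent_pair
begin

text \<open>The action of a reversal of the \<open>u\<close>-edges on the unit cube.\<close>

definition reflect :: "real ^ 'v \<Rightarrow> real ^ 'v" where
  "reflect x = (\<chi> w. if w = u then 1 - x $ w else x $ w)"

lemma reflect_nth: "reflect x $ w = (if w = u then 1 - x $ w else x $ w)"
  by (simp add: reflect_def)

lemma reflect_reflect: "reflect (reflect x) = x"
  by (simp add: vec_eq_iff reflect_nth)

lemma reflect_in_unit_cube: "u \<in> \<sigma> \<Longrightarrow> x \<in> unit_cube \<sigma> \<Longrightarrow> reflect x \<in> unit_cube \<sigma>"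
  unfolding unit_cube_def by (auto simp: reflect_nth)

text \<open>On a cube with \<open>u\<close>-edges the level is constant, so that either all or none of these edges are
  reversed; on the other cubes there is nothing to reverse.\<close>

lemma flips_cube:
  assumes f: "flips e f" and \<phi>: "cube \<sigma> \<phi>"
  obtains (straight) "cube \<sigma> (\<lambda>x. f (\<phi> x))"
  | (reversed) "u \<in> \<sigma>" "cube \<sigma> (\<lambda>x. f (\<phi> (reflect x)))"
proof -
  note cube = cubeD[OF \<phi>]
  have maps: "continuous_on (unit_cube \<sigma>) (\<lambda>x. f (\<phi> x))" "(\<lambda>x. f (\<phi> x)) ` unit_cube \<sigma> \<subseteq> Y"
    using continuous_on_compose2[OF flipsD(1)[OF f] cube(2)] flipsD(3)[OF f] cube(4) by auto
  have pf: "p (f (\<phi> x)) $ w = torus_map x $ w" if "x \<in> unit_cube \<sigma>" "w \<noteq> u" for x w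
    using flipsD(5)[OF f cube(4)[OF that(1)] that(2)] cube(5)[OF that(1)] by simp
  have pu: "p (f (\<phi> x)) $ u = cis (2 * pi * (flip_sign e (\<phi> x) * x $ u))" if x: "x \<in> unit_cube \<sigma>" for x
  proof -
    have "angle u (\<phi> x) - x $ u \<in> \<int>"
      using cube(5)[OF x] p_angle[OF cube(4)[OF x], of u] by (simp flip: cis_2pi_eq_iff)
    then have "flip_sign e (\<phi> x) * (angle u (\<phi> x) - x $ u) \<in> \<int>"
      by (simp add: flip_sign_def)
    then have "flip_sign e (\<phi> x) * angle u (\<phi> x) - flip_sign e (\<phi> x) * x $ u \<in> \<int>"
      by (simp only: right_diff_distrib)
    moreover have "p (f (\<phi> x)) $ u = cis (2 * pi * (flip_sign e (\<phi> x) * angle u (\<phi> x)))"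
      unfolding flips_p[OF f cube(4)[OF x]]
      by (simp add: flipped_half_turn_def power2_eq_square cis_mult algebra_simps)
    ultimately show ?thesis by (simp only: cis_2pi_eq_iff)
  qed
  show thesis
  proof (cases "u \<in> \<sigma>")
    case False
    have "p (f (\<phi> x)) = torus_map x" if x: "x \<in> unit_cube \<sigma>" for x
    proof -
      have "x $ u = 0" using unit_cubeD(3)[OF x False] .
      then have "p (f (\<phi> x)) $ u = torus_map x $ u" using pu[OF x] by simp
      then have "p (f (\<phi> x)) $ w = torus_map x $ w" for w using pf[OF x, of w] by (cases "w = u") simp_all
      then show ?thesis by (rule vec_eq_iff[THEN iffD2, OF allI])
    qed
    then show thesis using maps cube(1) by (intro straight) (simp add: lifted_cube_def)
  next
    case True
    \<comment> \<open>Such a cube has no edge in the direction of \<open>v\<close>, so it lies in a single level.\<close>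
    have v: "v \<notin> \<sigma>"
    proof
      assume "v \<in> \<sigma>"
      then have "{u, v} \<subseteq> \<sigma>" using True by simp
      then show False using cube(1) simplicial nonadjacent unfolding simplicial_complex_def by blast
    qed
    have "angle v (\<phi> x) = angle v (\<phi> 0)" if "x \<in> unit_cube \<sigma>" for x
      using angle_cube[OF \<phi> that unit_cube_zero, of v] unit_cubeD(3)[OF that v] by simp
    then have level: "flip_sign e (\<phi> x) = flip_sign e (\<phi> 0)" if "x \<in> unit_cube \<sigma>" for x
      using that by (simp add: flip_sign_def)
    have "flip_sign e (\<phi> 0) = 1 \<or> flip_sign e (\<phi> 0) = - 1" by (simp add: flip_sign_def)
    then consider "flip_sign e (\<phi> 0) = 1" | "flip_sign e (\<phi> 0) = - 1" by blast
    then show thesis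
    proof cases
      case 1
      have "p (f (\<phi> x)) = torus_map x" if x: "x \<in> unit_cube \<sigma>" for x
      proof -
        have "p (f (\<phi> x)) $ u = torus_map x $ u" using pu[OF x] level[OF x] 1 by simp
        then have "p (f (\<phi> x)) $ w = torus_map x $ w" for w using pf[OF x, of w] by (cases "w = u") simp_all
      then show ?thesis by (rule vec_eq_iff[THEN iffD2, OF allI])
      qed
      then show thesis using maps cube(1) by (intro straight) (simp add: lifted_cube_def)
    next
      case 2
      note r = reflect_in_unit_cube[OF True]
      have "p (f (\<phi> (reflect x))) = torus_map x" if x: "x \<in> unit_cube \<sigma>" for x
      proof -
        have "p (f (\<phi> (reflect x))) $ u = cis (2 * pi * (x $ u - 1))"
          using pu[OF r[OF x]] level[OF r[OF x]] 2 by (simp add: reflect_nth algebra_simps)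
        also have "\<dots> = cis (2 * pi * x $ u)" unfolding cis_2pi_eq_iff by simp
        finally have "p (f (\<phi> (reflect x))) $ u = torus_map x $ u" by simp
        moreover have "p (f (\<phi> (reflect x))) $ w = torus_map x $ w" if "w \<noteq> u" for w
          using pf[OF r[OF x] that] that by (simp add: reflect_nth)
        ultimately have "p (f (\<phi> (reflect x))) $ w = torus_map x $ w" for w by (cases "w = u") simp_all
        then show ?thesis by (rule vec_eq_iff[THEN iffD2, OF allI])
      qed
      moreover have "continuous_on (unit_cube \<sigma>) reflect"
        unfolding reflect_def
      proof (rule continuous_on_vec_lambda)
        fix w show "continuous_on (unit_cube \<sigma>) (\<lambda>x. if w = u then 1 - x $ w else x $ w)"
          by (cases "w = u") (auto intro!: continuous_intros)
      qed
      then have "continuous_on (unit_cube \<sigma>) (\<lambda>x. f (\<phi> (reflect x)))"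
        by (rule continuous_on_compose2[OF maps(1)]) (use r in blast)
      moreover have "(\<lambda>x. f (\<phi> (reflect x))) ` unit_cube \<sigma> \<subseteq> Y" using maps(2) r by blast
      ultimately show thesis using cube(1) True by (intro reversed) (simp_all add: lifted_cube_def)
    qed
  qed
qed

lemma reflect_cube_isometry:
  assumes "u \<in> \<sigma>"
  shows "cube_isometry \<sigma> \<sigma> reflect"
proof -
  have "dist (reflect x) (reflect y) = dist x y" for x y
  proof -
    have "(\<lambda>w. dist (reflect x $ w) (reflect y $ w)) = (\<lambda>w. dist (x $ w) (y $ w))"
      by (auto simp: dist_real_def fun_eq_iff reflect_nth)
    then show ?thesis unfolding dist_vec_def by simp
  qed
  moreover have "reflect ` unit_cube \<sigma> = unit_cube \<sigma>"
    using reflect_in_unit_cube[OF assms] reflect_reflect by (metis image_subset_iff subsetI image_eqI subset_antisym)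
  ultimately show ?thesis unfolding cube_isometry_def by blast
qed

lemma flips_in_Aut:
  assumes f: "flips e f" and bij: "f \<in> Bij Y"
  shows "f \<in> Aut"
  unfolding Aut_iff
proof (intro conjI allI impI bij)
  obtain c g where g: "flips (\<lambda>j. e (j - c)) g" "\<forall>y\<in>Y. g (f y) = y" "\<forall>y\<in>Y. f (g y) = y"
    by (rule flips_inverse[OF f])
  have "homeomorphism Y Y f g"
    by (rule homeomorphismI)
       (use flipsD(1,2)[OF f] flipsD(1,2)[OF g(1)] g(2,3) in \<open>simp_all add: image_subset_iff_funcset\<close>)
  then show "\<exists>g. homeomorphism Y Y f g" by blast
  fix \<sigma> \<phi> assume \<phi>: "cube \<sigma> \<phi>"
  show "\<exists>\<tau> \<psi> \<iota>. cube \<tau> \<psi> \<and> cube_isometry \<sigma> \<tau> \<iota> \<and> (\<forall>x\<in>unit_cube \<sigma>. f (\<phi> x) = \<psi> (\<iota> x))"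
  proof (rule flips_cube[OF f \<phi>])
    assume "cube \<sigma> (\<lambda>x. f (\<phi> x))"
    moreover have "cube_isometry \<sigma> \<sigma> (\<lambda>x. x)" by (simp add: cube_isometry_def)
    ultimately show ?thesis by blast
  next
    assume u: "u \<in> \<sigma>" and c: "cube \<sigma> (\<lambda>x. f (\<phi> (reflect x)))"
    have "\<forall>x\<in>unit_cube \<sigma>. f (\<phi> x) = (\<lambda>x. f (\<phi> (reflect x))) (reflect x)" by (simp add: reflect_reflect)
    then show ?thesis using c reflect_cube_isometry[OF u] by blast
  qed
qed

definition periodic :: "int \<Rightarrow> (int \<Rightarrow> bool) \<Rightarrow> bool" where
  "periodic N e \<longleftrightarrow> (\<forall>j. e j = e (j mod N))"

definition flip_group :: "int \<Rightarrow> ('y \<Rightarrow> 'y) set" where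
  "flip_group N = {f \<in> Bij Y. \<exists>e. periodic N e \<and> flips e f}"

lemma periodic_shift:
  assumes "periodic N e"
  shows "periodic N (\<lambda>j. e (j + c))"
  unfolding periodic_def
proof
  fix j
  have "e (j + c) = e ((j + c) mod N)" using assms unfolding periodic_def by blast
  also have "\<dots> = e ((j mod N + c) mod N)" by (simp add: mod_add_left_eq)
  also have "\<dots> = e (j mod N + c)" using assms unfolding periodic_def by metis
  finally show "e (j + c) = e (j mod N + c)" .
qed

lemma finite_periodic:
  assumes "N > 0"
  shows "finite {e. periodic N e}"
proof (rule inj_on_finite)
  show "inj_on (\<lambda>e. {j \<in> {0..<N}. e j}) {e. periodic N e}"
  proof (rule inj_onI)
    fix e e' assume e: "e \<in> {e. periodic N e}" "e' \<in> {e. periodic N e}"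
      and eq: "{j \<in> {0..<N}. e j} = {j \<in> {0..<N}. e' j}"
    show "e = e'"
    proof
      fix j
      have "j mod N \<in> {0..<N}" using assms by simp
      then have "e (j mod N) = e' (j mod N)" using eq by blast
      then show "e j = e' j" using e unfolding periodic_def by blast
    qed
  qed
  show "(\<lambda>e. {j \<in> {0..<N}. e j}) ` {e. periodic N e} \<subseteq> Pow {0..<N}" by blast
qed simp

lemma flip_group_subset_Aut: "flip_group N \<subseteq> Aut"
  using flips_in_Aut unfolding flip_group_def by blast

lemma flip_groupI:
  assumes "flips e f" "periodic N e"
  shows "restrict f Y \<in> flip_group N"
proof -
  obtain c g where g: "flips (\<lambda>j. e (j - c)) g" "\<forall>y\<in>Y. g (f y) = y" "\<forall>y\<in>Y. f (g y) = y"
    by (rule flips_inverse[OF assms(1)])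
  have "bij_betw f Y Y"
    by (rule bij_betwI[of f Y Y g]) (use flipsD(2)[OF assms(1)] flipsD(2)[OF g(1)] g(2,3) in simp_all)
  then have "restrict f Y \<in> Bij Y" unfolding Bij_def by (simp add: bij_betw_restrict_eq)
  moreover have "flips e (restrict f Y)" using flips_cong[of f "restrict f Y" e] assms(1) by simp
  ultimately show ?thesis using assms(2) unfolding flip_group_def by blast
qed

lemma subgroup_flip_group: "subgroup (flip_group N) (aut_group L Y p)"
proof (rule group.subgroupI[OF group_aut flip_group_subset_Aut])
  have "restrict (\<lambda>y. y) Y \<in> flip_group N"
    by (rule flip_groupI[OF flips_id]) (simp add: periodic_def)
  then show "flip_group N \<noteq> {}" by blast
next
  fix f assume f: "f \<in> flip_group N"
  then obtain e where e: "periodic N e" "flips e f" unfolding flip_group_def by blast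
  have fA: "f \<in> Aut" using f flip_group_subset_Aut by blast
  obtain c g where g: "flips (\<lambda>j. e (j - c)) g" "\<forall>y\<in>Y. g (f y) = y" "\<forall>y\<in>Y. f (g y) = y"
    by (rule flips_inverse[OF e(2)])
  have "restrict g Y \<in> flip_group N"
    using flip_groupI[OF g(1)] periodic_shift[OF e(1), of "- c"] by simp
  moreover have "inv\<^bsub>aut_group L Y p\<^esub> f = restrict g Y"
    unfolding inv_aut[OF fA]
  proof (rule restrict_ext)
    fix y assume y: "y \<in> Y"
    show "inv_into Y f y = g y"
      using AutD(3)[OF fA] flipsD(3)[OF g(1) y] g(3) y by (simp add: bij_betw_def inv_into_f_eq)
  qed
  ultimately show "inv\<^bsub>aut_group L Y p\<^esub> f \<in> flip_group N" by simp
next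
  fix f g assume fg: "f \<in> flip_group N" "g \<in> flip_group N"
  then obtain e e' where e: "periodic N e" "flips e f" "periodic N e'" "flips e' g" unfolding flip_group_def by blast
  obtain c where c: "\<forall>y\<in>Y. angle v (g y) = angle v y + of_int c" using flips_shift[OF e(4)] .
  have "periodic N (\<lambda>j. e (j + c) \<noteq> e' j)"
    using periodic_shift[OF e(1), of c] e(3) unfolding periodic_def by metis
  then have "restrict (\<lambda>y. f (g y)) Y \<in> flip_group N"
    by (rule flip_groupI[OF flips_compose[OF e(2,4) c]])
  moreover have "f \<in> Aut" "g \<in> Aut" using fg flip_group_subset_Aut by blast+
  moreover have "compose Y f g = restrict (\<lambda>y. f (g y)) Y" by (simp add: compose_def)
  ultimately show "f \<otimes>\<^bsub>aut_group L Y p\<^esub> g \<in> flip_group N" by simp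
qed

text \<open>There are finitely many periodic patterns, and for each of them the map is determined by its value
  at \<open>x\<close>.\<close>

lemma finite_flip_group_transporter:
  assumes "N > 0" "x \<in> Y"
  shows "finite {f \<in> flip_group N. f x = z}"
proof (rule finite_subset)
  show "{f \<in> flip_group N. f x = z} \<subseteq> (\<Union>e\<in>{e. periodic N e}. {f \<in> Bij Y. flips e f \<and> f x = z})"
    unfolding flip_group_def by blast
  have "finite {f \<in> Bij Y. flips e f \<and> f x = z}" for e
  proof (cases "\<exists>f. f \<in> Bij Y \<and> flips e f \<and> f x = z")
    case True
    then obtain f where f: "f \<in> Bij Y" "flips e f" "f x = z" by blast
    have "g = f" if "g \<in> Bij Y" "flips e g" "g x = z" for g
    proof (rule extensionalityI[OF Bij_imp_extensional[OF that(1)] Bij_imp_extensional[OF f(1)]])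
      fix y assume "y \<in> Y"
      then show "g y = f y" using flips_unique[OF that(2) f(2) assms(2)] that(3) f(3) by simp
    qed
    then have "{f \<in> Bij Y. flips e f \<and> f x = z} \<subseteq> {f}" by blast
    then show ?thesis by (rule finite_subset) simp
  next
    case False
    then have "{f \<in> Bij Y. flips e f \<and> f x = z} = {}" by blast
    then show ?thesis by (simp only: finite.emptyI)
  qed
  then show "finite (\<Union>e\<in>{e. periodic N e}. {f \<in> Bij Y. flips e f \<and> f x = z})"
    using finite_periodic[OF assms(1)] by (intro finite_UN_I)
qed

lemma flip_group_discrete:
  assumes "N > 0"
  shows "subtopology (aut_topology L Y p) (flip_group N) = discrete_topology (flip_group N)"
proof -
  obtain x where x: "x \<in> Y" by (rule vertex_exists)
  have "openin (subtopology (aut_topology L Y p) (flip_group N)) {f}" if f: "f \<in> flip_group N" for f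
  proof -
    let ?H = "{g \<in> flip_group N. g x = f x}"
    have fA: "f \<in> Aut" using f flip_group_subset_Aut by blast
    have "\<forall>g\<in>?H - {f}. \<exists>y. y \<in> Y \<and> g y \<noteq> f y"
    proof
      fix g assume g: "g \<in> ?H - {f}"
      then have "g \<in> Aut" "g \<noteq> f" using flip_group_subset_Aut by blast+
      then show "\<exists>y. y \<in> Y \<and> g y \<noteq> f y" using Aut_eqI[of g f] fA by blast
    qed
    from bchoice[OF this] obtain y where y: "\<forall>g\<in>?H - {f}. y g \<in> Y \<and> g (y g) \<noteq> f (y g)" ..
    let ?P = "insert x (y ` (?H - {f}))"
    have "finite ?P" using finite_flip_group_transporter[OF assms x] by simp
    moreover have "?P \<subseteq> Y" using x y by auto
    ultimately have "openin (aut_topology L Y p) (agreeing f ?P)" by (rule openin_agreeing)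
    moreover have "{f} = agreeing f ?P \<inter> flip_group N"
    proof (intro equalityI subsetI)
      fix g assume g: "g \<in> agreeing f ?P \<inter> flip_group N"
      then have gx: "g \<in> ?H" by (simp add: agreeing_def)
      show "g \<in> {f}"
      proof (rule ccontr)
        assume "g \<notin> {f}"
        then have "g \<in> ?H - {f}" using gx by blast
        then have "y g \<in> ?P" "g (y g) \<noteq> f (y g)" using y by blast+
        moreover have "\<forall>z\<in>?P. g z = f z" using g unfolding agreeing_def by blast
        ultimately show False by blast
      qed
    qed (use f fA in \<open>simp add: agreeing_def\<close>)
    ultimately show ?thesis unfolding openin_subtopology by blast
  qed
  moreover have "topspace (subtopology (aut_topology L Y p) (flip_group N)) = flip_group N"
    using flip_group_subset_Aut by (auto simp: topspace_subtopology)
  ultimately show ?thesis by (metis discrete_topology_unique)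
qed

lemma half_turn_vertex:
  assumes "y \<in> Y" "p y = 1"
  shows "half_turn y = 1 \<or> half_turn y = - 1"
  using half_turn_sq[OF assms(1)] assms(2) by (simp add: power2_eq_1_iff)

text \<open>Flipping nothing gives a deck transformation.\<close>

lemma flip_group_vertex_transitive:
  assumes x: "x \<in> Y" "p x = 1" and y: "y \<in> Y" "p y = 1" and eq: "half_turn x = half_turn y"
  obtains f where "f \<in> flip_group N" "f x = y"
proof -
  have h: "half_turn y = flipped_half_turn (\<lambda>_. False) x"
    using eq by (simp add: flipped_half_turn_False)
  have w: "p y $ w = p x $ w" if "w \<noteq> u" for w using x y by simp
  obtain f where f: "flips (\<lambda>_. False) f" "f x = y" using flips_exists[OF x(1) y(1) h w] .
  have "restrict f Y \<in> flip_group N" by (rule flip_groupI[OF f(1)]) (simp add: periodic_def)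
  moreover have "restrict f Y x = y" using f(2) x(1) by simp
  ultimately show thesis by (rule that)
qed

text \<open>Two vertices \<open>x\<close> and \<open>x'\<close> represent the possible values of \<open>half_turn\<close>. Given \<open>g\<close>, some element of
  the group takes one of them to the preimage of \<open>x\<close> under \<open>g\<close>. So \<open>g\<close> can be changed within its coset to
  an automorphism that takes \<open>x\<close> or \<open>x'\<close> to \<open>x\<close>, and these automorphisms form a compact set.\<close>

lemma flip_group_cocompact: "cocompact (aut_group L Y p) (aut_topology L Y p) (flip_group N)"
proof -
  let ?G = "aut_group L Y p" and ?T = "aut_topology L Y p"
  interpret G: group ?G by (rule group_aut)
  let ?\<pi> = "\<lambda>g. g <#\<^bsub>?G\<^esub> flip_group N"
  obtain x where x: "x \<in> Y" "p x = 1" by (rule vertex_exists)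
  obtain x' where x': "x' \<in> Y" "p x' = 1"
    "\<And>y. \<lbrakk>y \<in> Y; p y = 1; half_turn y \<noteq> half_turn x\<rbrakk> \<Longrightarrow> half_turn x' = half_turn y"
  proof (cases "\<exists>y\<in>Y. p y = 1 \<and> half_turn y \<noteq> half_turn x")
    case True
    then obtain y where y: "y \<in> Y" "p y = 1" "half_turn y \<noteq> half_turn x" by blast
    have "half_turn y = half_turn z" if "z \<in> Y" "p z = 1" "half_turn z \<noteq> half_turn x" for z
      using half_turn_vertex[OF that(1,2)] half_turn_vertex[OF y(1,2)] half_turn_vertex[OF x] that(3) y(3) by auto
    then show thesis using that[of y] y by blast
  next
    case False
    then show thesis using that[of x] x by blast
  qed
  let ?K = "{k \<in> Aut. k x = x} \<union> {k \<in> Aut. k x' = x}"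
  have K: "compactin ?T ?K"
    using compactin_transporter[OF x(1) x(1)] compactin_transporter[OF x'(1) x(1)] by (rule compactin_Un)
  have cover: "\<exists>k\<in>?K. ?\<pi> k = ?\<pi> g" if g: "g \<in> Aut" for g
  proof -
    let ?y = "(inv\<^bsub>?G\<^esub> g) x"
    have y: "?y \<in> Y" "p ?y = 1"
      using inv_aut_apply(1)[OF g x(1)] Aut_vertex[OF G.inv_closed[OF g] x] by simp_all
    have "\<exists>f\<in>flip_group N. f x = ?y \<or> f x' = ?y"
    proof (cases "half_turn ?y = half_turn x")
      case True
      then show ?thesis using flip_group_vertex_transitive[OF x y, of N] by metis
    next
      case False
      then show ?thesis using flip_group_vertex_transitive[OF x'(1,2) y x'(3)[OF y False], of N] by metis
    qed
    then obtain f where f: "f \<in> flip_group N" "f x = ?y \<or> f x' = ?y" by blast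
    have fA: "f \<in> Aut" using f(1) flip_group_subset_Aut by blast
    have gf: "g \<otimes>\<^bsub>?G\<^esub> f \<in> Aut" using g fA by (rule G.m_closed)
    have "(g \<otimes>\<^bsub>?G\<^esub> f) x = x \<or> (g \<otimes>\<^bsub>?G\<^esub> f) x' = x"
      using f(2) g fA x(1) x'(1) inv_aut_apply(2)[OF g x(1)] by (auto simp: compose_eq)
    then have "g \<otimes>\<^bsub>?G\<^esub> f \<in> ?K" using gf by blast
    moreover have "g \<otimes>\<^bsub>?G\<^esub> f \<in> g <#\<^bsub>?G\<^esub> flip_group N" using f(1) unfolding l_coset_def by blast
    then have "?\<pi> (g \<otimes>\<^bsub>?G\<^esub> f) = ?\<pi> g"
      using G.l_repr_independence[OF _ g subgroup_flip_group] by simp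
    ultimately show ?thesis by blast
  qed
  let ?open = "\<lambda>U. U \<subseteq> ?\<pi> ` Aut \<and> openin ?T {g \<in> Aut. ?\<pi> g \<in> U}"
  have ist: "istopology ?open"
    unfolding istopology_def
  proof (intro conjI allI impI)
    fix U V assume "?open U" "?open V"
    moreover have "{g \<in> Aut. ?\<pi> g \<in> U \<inter> V} = {g \<in> Aut. ?\<pi> g \<in> U} \<inter> {g \<in> Aut. ?\<pi> g \<in> V}" by blast
    ultimately show "U \<inter> V \<subseteq> ?\<pi> ` Aut" "openin ?T {g \<in> Aut. ?\<pi> g \<in> U \<inter> V}" by auto
  next
    fix \<U> assume *: "\<forall>U\<in>\<U>. ?open U"
    have "{g \<in> Aut. ?\<pi> g \<in> \<Union>\<U>} = (\<Union>U\<in>\<U>. {g \<in> Aut. ?\<pi> g \<in> U})" by blast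
    moreover have "openin ?T (\<Union>U\<in>\<U>. {g \<in> Aut. ?\<pi> g \<in> U})" using * by (intro openin_Union) auto
    ultimately show "openin ?T {g \<in> Aut. ?\<pi> g \<in> \<Union>\<U>}" by simp
    show "\<Union>\<U> \<subseteq> ?\<pi> ` Aut" using * by (intro Union_least) simp
  qed
  define Q where "Q = topology ?open"
  have Q: "openin Q U \<longleftrightarrow> ?open U" for U unfolding Q_def using ist by (simp add: topology_inverse')
  have all: "{g \<in> Aut. ?\<pi> g \<in> ?\<pi> ` Aut} = topspace ?T" by auto
  have "openin Q (?\<pi> ` Aut)" unfolding Q all by (simp only: openin_topspace order_refl simp_thms)
  then have "?\<pi> ` Aut \<subseteq> topspace Q" by (rule openin_subset)
  moreover have "topspace Q \<subseteq> ?\<pi> ` Aut" using Q[of "topspace Q"] openin_topspace[of Q] by (simp only: simp_thms)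
  ultimately have top_Q: "topspace Q = ?\<pi> ` Aut" by (rule subset_antisym[rotated])
  have quot: "quotient_map ?T Q ?\<pi>"
    unfolding quotient_map_def top_Q Q by simp
  have "?\<pi> ` Aut \<subseteq> ?\<pi> ` ?K"
  proof
    fix q assume "q \<in> ?\<pi> ` Aut"
    then obtain g where g: "g \<in> Aut" "q = ?\<pi> g" by (elim imageE)
    then obtain k where "k \<in> ?K" "?\<pi> k = ?\<pi> g" using cover[OF g(1)] by (elim bexE)
    then show "q \<in> ?\<pi> ` ?K" using g(2) by (intro image_eqI[of _ _ k]) simp_all
  qed
  moreover have "?\<pi> ` ?K \<subseteq> ?\<pi> ` Aut" by (intro image_mono) blast
  ultimately have "topspace Q = ?\<pi> ` ?K" using top_Q by simp
  then have "compactin Q (topspace Q)"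
    using image_compactin[OF K quotient_imp_continuous_map[OF quot]] by simp
  then show ?thesis
    unfolding cocompact_def using quot by (auto simp: compact_space_def)
qed

theorem uniform_lattice_flip_group:
  "N > 0 \<Longrightarrow> uniform_lattice (aut_group L Y p) (aut_topology L Y p) (flip_group N)"
  unfolding uniform_lattice_def
  using locally_compact_group_aut subgroup_flip_group flip_group_discrete flip_group_cocompact by blast

lemma countable_flip_group:
  assumes "N > 0"
  shows "countable (flip_group N)"
proof -
  obtain x where x: "x \<in> Y" "p x = 1" by (rule vertex_exists)
  have "flip_group N \<subseteq> (\<Union>z\<in>{z \<in> Y. p z = 1}. {f \<in> flip_group N. f x = z})"
  proof
    fix f assume f: "f \<in> flip_group N"
    then have fA: "f \<in> Aut" using flip_group_subset_Aut by blast
    then show "f \<in> (\<Union>z\<in>{z \<in> Y. p z = 1}. {f \<in> flip_group N. f x = z})"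
      using f AutD(5)[OF fA x(1)] Aut_vertex[OF fA x] by simp
  qed
  moreover have "countable (\<Union>z\<in>{z \<in> Y. p z = 1}. {f \<in> flip_group N. f x = z})"
    using countable_fibre[of 1] finite_flip_group_transporter[OF assms x(1)]
    by (intro countable_UN[OF _ countable_finite])
  ultimately show ?thesis by (rule countable_subset)
qed

text \<open>An element that stabilises a cube fixes its centre, since the centre is the only point of the cube
  over its image under \<open>p\<close>. So it is the identity on the cube or reverses its \<open>u\<close>-edges.\<close>

theorem flip_group_acts_admissibly: "acts_admissibly L Y p (flip_group N)"
  unfolding acts_admissibly_def
proof (intro ballI allI impI)
  fix f \<sigma> \<phi> y
  assume "f \<in> flip_group N" and \<phi>: "cube \<sigma> \<phi>" and stab: "f ` \<phi> ` unit_cube \<sigma> = \<phi> ` unit_cube \<sigma>"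
    and "y \<in> \<phi> ` unit_cube \<sigma>"
  then obtain e where f: "flips e f" unfolding flip_group_def by blast
  obtain x where x: "x \<in> unit_cube \<sigma>" "y = \<phi> x" using \<open>y \<in> \<phi> ` unit_cube \<sigma>\<close> by (elim imageE)
  define c :: "real ^ 'v" where "c = (\<chi> w. if w \<in> \<sigma> then 1 / 2 else 0)"
  have c: "c \<in> open_cube \<sigma>" by (simp add: c_def open_cube_def)
  then have c': "c \<in> unit_cube \<sigma>" using open_cube_subset by blast
  obtain d where d: "d \<in> unit_cube \<sigma>" "f (\<phi> c) = \<phi> d"
  proof -
    have "f (\<phi> c) \<in> \<phi> ` unit_cube \<sigma>" using stab c' by blast
    then show thesis using that by (elim imageE)
  qed
  show "f y = y"
  proof (rule flips_cube[OF f \<phi>])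
    assume *: "cube \<sigma> (\<lambda>x. f (\<phi> x))"
    have "torus_map c = torus_map d"
      using cubeD(5)[OF * c'] cubeD(5)[OF \<phi> d(1)] d(2) by simp
    then have "c = d" using torus_map_eq_open_cube[OF c d(1)] by simp
    then show ?thesis using cube_lift_unique[OF * \<phi> c' x(1)] d(2) x(2) by simp
  next
    assume u: "u \<in> \<sigma>" and *: "cube \<sigma> (\<lambda>x. f (\<phi> (reflect x)))"
    have rc: "reflect c = c" by (simp add: vec_eq_iff c_def u reflect_nth)
    have "torus_map c = torus_map d"
      using cubeD(5)[OF * c'] cubeD(5)[OF \<phi> d(1)] d(2) rc by simp
    then have "c = d" using torus_map_eq_open_cube[OF c d(1)] by simp
    then have eq: "f (\<phi> (reflect z)) = \<phi> z" if "z \<in> unit_cube \<sigma>" for z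
      using cube_lift_unique[OF * \<phi> c' that] d(2) rc by simp
    let ?a = "axis u 1 :: real ^ 'v"
    have a: "?a \<in> unit_cube \<sigma>" using u by (simp add: unit_cube_def axis_def)
    have "reflect ?a = 0" by (simp add: vec_eq_iff axis_def reflect_nth)
    then have fa: "f (\<phi> 0) = \<phi> ?a" using eq[OF a] by simp
    \<comment> \<open>An inverted edge would change the parity that \<open>half_turn\<close> records at its ends.\<close>
    have \<phi>0: "\<phi> 0 \<in> Y" using cubeD(4)[OF \<phi> unit_cube_zero] .
    have "p (\<phi> 0) $ u = 1" using cubeD(5)[OF \<phi> unit_cube_zero] by simp
    then have "angle u (\<phi> 0) \<in> \<int>" using p_eq_1_iff_angle[OF \<phi>0] by simp
    then have "half_turn (\<phi> ?a) = half_turn (\<phi> 0)"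
      using flipsD(4)[OF f \<phi>0] flipped_half_turn_int fa by simp
    moreover have "angle u (\<phi> ?a) = angle u (\<phi> 0) + 1"
      using angle_cube[OF \<phi> a unit_cube_zero, of u] by (simp add: axis_def)
    then have "half_turn (\<phi> ?a) = - half_turn (\<phi> 0)"
      by (simp add: half_turn_def distrib_left cis_mult[symmetric])
    ultimately have "half_turn (\<phi> 0) = 0" by simp
    then show ?thesis by (simp add: half_turn_def)
  qed
qed

text \<open>Move along \<open>v\<close>-edges, forwards or backwards, from any vertex.\<close>

lemma vertex_at_level: "\<exists>y\<in>Y. p y = 1 \<and> angle v y = of_int j"
proof -
  have v: "{v} \<in> L" using simplicial unfolding simplicial_complex_def by blast
  let ?a = "axis v 1 :: real ^ 'v"
  have a: "?a \<in> unit_cube {v}" by (simp add: unit_cube_def axis_def)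
  have t: "torus_map ?a = 1" "torus_map 0 = (1 :: complex ^ 'v)" by (simp_all add: vec_eq_iff axis_def)
  obtain x where x: "x \<in> Y" "p x = 1" by (rule vertex_exists)
  then obtain k where k: "angle v x = of_int k"
    using p_eq_1_iff_angle[OF x(1), of v] by (auto elim: Ints_cases)
  show ?thesis
  proof (induction j rule: int_induct[of _ k])
    case base
    then show ?case using x k by blast
  next
    case (step1 i)
    then obtain y where y: "y \<in> Y" "p y = 1" "angle v y = of_int i" by blast
    then obtain \<phi> where \<phi>: "cube {v} \<phi>" "\<phi> 0 = y"
      using cube_lift_exists[OF v unit_cube_zero y(1)] t(2) by metis
    have "angle v (\<phi> ?a) = of_int (i + 1)"
      using angle_cube[OF \<phi>(1) a unit_cube_zero, of v] \<phi>(2) y(3) by (simp add: axis_def)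
    moreover have "p (\<phi> ?a) = 1" using cubeD(5)[OF \<phi>(1) a] t(1) by simp
    ultimately show ?case using cubeD(4)[OF \<phi>(1) a] by blast
  next
    case (step2 i)
    then obtain y where y: "y \<in> Y" "p y = 1" "angle v y = of_int i" by blast
    then obtain \<phi> where \<phi>: "cube {v} \<phi>" "\<phi> ?a = y"
      using cube_lift_exists[OF v a y(1)] t(1) by metis
    have "angle v (\<phi> 0) = of_int (i - 1)"
      using angle_cube[OF \<phi>(1) a unit_cube_zero, of v] \<phi>(2) y(3) by (simp add: axis_def)
    moreover have "p (\<phi> 0) = 1" using cubeD(5)[OF \<phi>(1) unit_cube_zero] t(2) by simp
    ultimately show ?case using cubeD(4)[OF \<phi>(1) unit_cube_zero] by blast
  qed
qed

text \<open>A reversal at level \<open>j\<close> is visible at the midpoint of a \<open>u\<close>-edge of this level, where \<open>half_turn\<close> is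
  not real.\<close>

lemma flips_pattern_unique:
  assumes "flips e f" "flips e' f"
  shows "e j = e' j"
proof -
  have u: "{u} \<in> L" using simplicial unfolding simplicial_complex_def by blast
  obtain y where y: "y \<in> Y" "p y = 1" "angle v y = of_int j" using vertex_at_level by blast
  have t: "torus_map 0 = (1 :: complex ^ 'v)" by (simp add: vec_eq_iff)
  obtain \<phi> where \<phi>: "cube {u} \<phi>" "\<phi> 0 = y"
    using cube_lift_exists[OF u unit_cube_zero y(1)] y(2) t by metis
  let ?a = "axis u (1/2) :: real ^ 'v"
  have a: "?a \<in> unit_cube {u}" by (simp add: unit_cube_def axis_def)
  note m = cubeD(4)[OF \<phi>(1) a]
  have av: "angle v (\<phi> ?a) = of_int j"
    using angle_cube[OF \<phi>(1) a unit_cube_zero, of v] \<phi>(2) y(3) u_neq_v by (simp add: axis_def)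
  obtain k :: int where k: "angle u y = of_int k"
    using p_eq_1_iff_angle[OF y(1), of u] y(2) by (auto elim: Ints_cases)
  define t where "t = real_of_int k + 1 / 2"
  have au: "angle u (\<phi> ?a) = t"
    using angle_cube[OF \<phi>(1) a unit_cube_zero, of u] \<phi>(2) k by (simp add: axis_def t_def)
  have ne: "cis (pi * t) \<noteq> cis (- (pi * t))"
  proof
    assume eq: "cis (pi * t) = cis (- (pi * t))"
    have "cis (2 * pi * t) = cis (pi * t) * cis (pi * t)"
      by (simp add: cis_mult algebra_simps)
    also have "\<dots> = 1" by (subst (2) eq) (simp add: cis_mult)
    finally have "t \<in> \<int>" unfolding cis_2pi_eq_1_iff .
    then obtain l :: int where "t = of_int l" by (elim Ints_cases)
    then have "real_of_int (2 * k + 1) = real_of_int (2 * l)" unfolding t_def by simp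
    then have "2 * k + 1 = 2 * l" by (simp only: of_int_eq_iff)
    then show False by presburger
  qed
  have "flipped_half_turn e (\<phi> ?a) = flipped_half_turn e' (\<phi> ?a)"
    using flipsD(4)[OF assms(1) m] flipsD(4)[OF assms(2) m] by simp
  then show ?thesis
    using ne ne[symmetric] unfolding flipped_half_turn_def flip_sign_def av au by (auto split: if_splits)
qed

theorem flip_group_strict_mono:
  assumes "N > 0"
  shows "flip_group N \<subset> flip_group (2 * N)"
proof
  have "periodic (2 * N) e" if "periodic N e" for e
    unfolding periodic_def
  proof
    fix j
    have "e (j mod (2 * N)) = e (j mod (2 * N) mod N)" using that unfolding periodic_def by blast
    also have "j mod (2 * N) mod N = j mod N" by (simp add: mod_mod_cancel)
    also have "e (j mod N) = e j" using that unfolding periodic_def by blast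
    finally show "e j = e (j mod (2 * N))" by simp
  qed
  then show "flip_group N \<subseteq> flip_group (2 * N)" unfolding flip_group_def by blast
  \<comment> \<open>One reversed level in each period: level \<open>0\<close> is reversed and level \<open>N\<close> is not.\<close>
  define e where "e j \<longleftrightarrow> 2 * N dvd j" for j :: int
  have per: "periodic (2 * N) e" unfolding periodic_def e_def by (simp add: dvd_mod_iff)
  obtain x where x: "x \<in> Y" "p x = 1" by (rule vertex_exists)
  have "angle u x \<in> \<int>" using p_eq_1_iff_angle[OF x(1), of u] x(2) by simp
  then have h: "half_turn x = flipped_half_turn e x" by (simp add: flipped_half_turn_int)
  obtain f where f: "flips e f" "f x = x" using flips_exists[OF x(1) x(1) h refl] .
  have in2: "restrict f Y \<in> flip_group (2 * N)" by (rule flip_groupI[OF f(1) per])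
  have "restrict f Y \<notin> flip_group N"
  proof
    assume "restrict f Y \<in> flip_group N"
    then obtain e' where e': "periodic N e'" "flips e' (restrict f Y)" unfolding flip_group_def by blast
    then have "flips e' f" using flips_cong[of f "restrict f Y" e'] by simp
    then have ee': "e j = e' j" for j using flips_pattern_unique[OF f(1)] by blast
    have "e 0" by (simp add: e_def)
    moreover have "\<not> e N" using assms by (auto simp: e_def dest: zdvd_imp_le)
    moreover have "e' N = e' (N mod N)" using e'(1) unfolding periodic_def by blast
    ultimately show False using ee' by simp
  qed
  then show "flip_group N \<noteq> flip_group (2 * N)" using in2 by blast
qed

end

theorem corollary7p3:
  fixes L :: "'v::finite set set"
    and Y :: "'y::metric_space set"
    and p :: "'y \<Rightarrow> complex ^ 'v"
  assumes "flag_complex L" and "\<not> full_simplex L"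
    and "covering_space Y p (salvetti L)" and "simply_connected Y"
  shows "\<exists>\<Gamma> :: nat \<Rightarrow> ('y \<Rightarrow> 'y) set.
           (\<forall>n\<ge>1. uniform_lattice (aut_group L Y p) (aut_topology L Y p) (\<Gamma> n) \<and>
                   acts_admissibly L Y p (\<Gamma> n)) \<and>
           ascending_tower \<Gamma> \<and>
           (\<forall>\<mu>. haar_measure (aut_group L Y p) (aut_topology L Y p) \<mu> \<longrightarrow>
                 (\<lambda>n. covolume (aut_group L Y p) \<mu> (\<Gamma> n)) \<longlonglongrightarrow> 0)"
proof -
  obtain u v where uv: "{u, v} \<notin> L"
    using assms(1,2) unfolding flag_complex_def full_simplex_def by blast
  interpret nonadjacent_pair L Y p u v
    using assms(1)[unfolded flag_complex_def] assms(3,4) uv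
    by (intro nonadjacent_pair.intro salvetti_cover.intro nonadjacent_pair_axioms.intro) (elim conjE)
  define \<Gamma> where "\<Gamma> n = flip_group (2 ^ n)" for n :: nat
  have lat: "uniform_lattice (aut_group L Y p) (aut_topology L Y p) (\<Gamma> n)" for n
    unfolding \<Gamma>_def by (rule uniform_lattice_flip_group) simp
  have tower: "ascending_tower \<Gamma>"
    unfolding ascending_tower_def \<Gamma>_def using flip_group_strict_mono by simp
  have "(\<lambda>n. covolume (aut_group L Y p) \<mu> (\<Gamma> n)) \<longlonglongrightarrow> 0"
    if "haar_measure (aut_group L Y p) (aut_topology L Y p) \<mu>" for \<mu>
  proof -
    interpret H: haar_group "aut_group L Y p" "aut_topology L Y p" \<mu>
      by (intro haar_group.intro haar_group_axioms.intro group_aut locally_compact_group_aut that)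
    have "countable (\<Gamma> 1)" unfolding \<Gamma>_def by (rule countable_flip_group) simp
    with lat show ?thesis using tower by (rule H.covolume_tower_tendsto_0)
  qed
  moreover have "acts_admissibly L Y p (\<Gamma> n)" for n
    unfolding \<Gamma>_def by (rule flip_group_acts_admissibly)
  ultimately show ?thesis using lat tower by blast
qed


end
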